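(* Let $N\ge1$ be an integer, $\alpha>0$, and let $H$ be the self-adjoint operator $-\frac{d^2}{dx^2}$ on the infinite star graph with the Exner--Šeba vertex condition, with spectral-density kernel $\sigma_S(\omega,x,y)$, both as defined in the context. Then for every edge $j\in\{1,\dots,N\}$, every $x>0$ and every $\omega>0$, the local spectral density (the diagonal value of $\sigma_S$) is $$\sigma_{Sj}{}^{j}(\omega,x,x)=\frac1\pi+\frac1\pi\left(\frac2N-1\right)\cos(2\omega x)+\frac{2\alpha/\pi}{\alpha^2+N^2\omega^2}\left[\omega\sin(2\omega x)-\frac{\alpha}{N}\cos(2\omega x)\right]$$ (no summation over $j$).
   Context: Operator $H$: on $L^2(0,\infty)^N$, $(Hu)_j=-u_j''$ with domain consisting of all $u=(u_1,\dots,u_N)$ with $u_j\in H^2(0,\infty)$ (Sobolev space) satisfying $u_1(0)=\dots=u_N(0)=:u(0)$ and $\sum_{j=1}^N u_j'(0)=\alpha u(0)$. For $\alpha>0$, $H$ is self-adjoint and nonnegative. The spectral-density kernel $\sigma_S(\omega,x,y)$, $\omega>0$, $x,y>0$, is the continuous $N\times N$-matrix-valued function such that for every $\lambda>0$ the spectral projection $P(\lambda)=\mathbf 1_{[0,\lambda]}(H)$ has integral kernel $\int_0^{\sqrt\lambda}\sigma_S(\omega,x,y)\,d\omega$, i.e. $(P(\lambda)f)_j(x)=\sum_{l=1}^N\int_0^\infty\int_0^{\sqrt\lambda}\sigma_{Sj}{}^{l}(\omega,x,y)\,d\omega\,f_l(y)\,dy$ for $f\in C_c^\infty((0,\infty))^N$.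 *)

theory Defs
  imports "HOL-Analysis.Analysis"
begin

(* Conventions. The N edges of the star graph are the elements of a finite type 'n, so that
   N = CARD('n) \<ge> 1. The Hilbert space L^2(0,infinity)^N is complex; its elements are represented
   by functions on the half-line (values outside (0,infinity) are irrelevant), and two functions
   represent the same element iff they agree almost everywhere. *)

definition half_line :: "real measure" where
  "half_line = restrict_space lborel {0<..}"

definition L2 :: "(real \<Rightarrow> 'b::{banach, second_countable_topology}) set" where
  "L2 = {u. u \<in> borel_measurable half_line \<and> integrable half_line (\<lambda>x. (norm (u x))\<^sup>2)}"

definition L2_eq :: "(real \<Rightarrow> 'b) \<Rightarrow> (real \<Rightarrow> 'b) \<Rightarrow> bool" (infix "\<simeq>" 50) where
  "u \<simeq> v \<longleftrightarrow> (AE x in half_line. u x = v x)"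

definition L2_inner :: "(real \<Rightarrow> complex^'n) \<Rightarrow> (real \<Rightarrow> complex^'n) \<Rightarrow> complex" where
  "L2_inner u v = (\<integral>x. (\<Sum>j\<in>UNIV. u x $ j * cnj (v x $ j)) \<partial>half_line)"

definition L2_norm :: "(real \<Rightarrow> complex^'n) \<Rightarrow> real" where
  "L2_norm u = sqrt (\<integral>x. (norm (u x))\<^sup>2 \<partial>half_line)"


subsection \<open>Test functions, weak derivatives and the Sobolev space \<open>H\<^sup>2(0,\<infinity>)\<close>\<close>

definition test_functions :: "(real \<Rightarrow> complex) set" where
  "test_functions = {\<phi>.
     (\<exists>D :: nat \<Rightarrow> real \<Rightarrow> complex. D 0 = \<phi> \<and>
        (\<forall>n x. (D n has_vector_derivative D (Suc n) x) (at x))) \<and>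
     (\<exists>K. compact K \<and> K \<subseteq> {0<..} \<and> (\<forall>x. x \<notin> K \<longrightarrow> \<phi> x = 0))}"

definition is_weak_deriv :: "(real \<Rightarrow> complex) \<Rightarrow> (real \<Rightarrow> complex) \<Rightarrow> bool" where
  "is_weak_deriv u g \<longleftrightarrow>
     (\<forall>\<phi>\<in>test_functions.
        (\<integral>x. u x * vector_derivative \<phi> (at x) \<partial>half_line) = - (\<integral>x. g x * \<phi> x \<partial>half_line))"

definition sobolev_H1 :: "(real \<Rightarrow> complex) set" where
  "sobolev_H1 = {u \<in> L2. \<exists>g\<in>L2. is_weak_deriv u g}"

(* A representative of the weak derivative; it is unique up to equality almost everywhere. *)
definition weak_deriv :: "(real \<Rightarrow> complex) \<Rightarrow> (real \<Rightarrow> complex)" where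
  "weak_deriv u = (SOME g. g \<in> L2 \<and> is_weak_deriv u g)"

definition sobolev_H2 :: "(real \<Rightarrow> complex) set" where
  "sobolev_H2 = {u \<in> sobolev_H1. weak_deriv u \<in> sobolev_H1}"

(* The value at the vertex is that of the continuous representative on [0,infinity), which
   exists for every function in the Sobolev space of order one. *)
definition vertex_value :: "(real \<Rightarrow> complex) \<Rightarrow> complex \<Rightarrow> bool" where
  "vertex_value u c \<longleftrightarrow> (\<exists>w. continuous_on {0..} w \<and> w \<simeq> u \<and> w 0 = c)"


subsection \<open>The Hamiltonian of the star graph\<close>

definition edge :: "(real \<Rightarrow> complex^'n) \<Rightarrow> 'n \<Rightarrow> real \<Rightarrow> complex" where
  "edge u j = (\<lambda>x. u x $ j)"

definition star_dom :: "real \<Rightarrow> (real \<Rightarrow> complex^'n) set" where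
  "star_dom \<alpha> = {u.
     (\<forall>j. edge u j \<in> sobolev_H2) \<and>
     (\<exists>c d. (\<forall>j. vertex_value (edge u j) c) \<and>
            (\<forall>j. vertex_value (weak_deriv (edge u j)) (d j)) \<and>
            (\<Sum>j\<in>UNIV. d j) = of_real \<alpha> * c)}"

definition star_op :: "(real \<Rightarrow> complex^'n) \<Rightarrow> (real \<Rightarrow> complex^'n)" where
  "star_op u = (\<lambda>x. \<chi> j. - weak_deriv (weak_deriv (edge u j)) x)"


subsection \<open>Spectral measures of unbounded operators\<close>

(* An everywhere defined symmetric operator is bounded, hence this is an orthogonal projection. *)
definition L2_projection :: "((real \<Rightarrow> complex^'n) \<Rightarrow> (real \<Rightarrow> complex^'n)) \<Rightarrow> bool" where
  "L2_projection P \<longleftrightarrow>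
     (\<forall>u\<in>L2. P u \<in> L2) \<and>
     (\<forall>u\<in>L2. \<forall>v\<in>L2. u \<simeq> v \<longrightarrow> P u \<simeq> P v) \<and>
     (\<forall>u\<in>L2. \<forall>v\<in>L2. P (\<lambda>x. u x + v x) \<simeq> (\<lambda>x. P u x + P v x)) \<and>
     (\<forall>u\<in>L2. \<forall>c. P (\<lambda>x. c *s u x) \<simeq> (\<lambda>x. c *s P u x)) \<and>
     (\<forall>u\<in>L2. P (P u) \<simeq> P u) \<and>
     (\<forall>u\<in>L2. \<forall>v\<in>L2. L2_inner (P u) v = L2_inner u (P v))"

definition projection_valued_measure ::
  "(real set \<Rightarrow> (real \<Rightarrow> complex^'n) \<Rightarrow> (real \<Rightarrow> complex^'n)) \<Rightarrow> bool" where
  "projection_valued_measure E \<longleftrightarrow>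
     (\<forall>A\<in>sets borel. L2_projection (E A)) \<and>
     (\<forall>u\<in>L2. E {} u \<simeq> (\<lambda>x. 0)) \<and>
     (\<forall>u\<in>L2. E UNIV u \<simeq> u) \<and>
     (\<forall>A\<in>sets borel. \<forall>B\<in>sets borel. \<forall>u\<in>L2. E (A \<inter> B) u \<simeq> E A (E B u)) \<and>
     (\<forall>A :: nat \<Rightarrow> real set. range A \<subseteq> sets borel \<longrightarrow> disjoint_family A \<longrightarrow>
        (\<forall>u\<in>L2. (\<lambda>n. L2_norm (\<lambda>x. E (\<Union>i. A i) u x - (\<Sum>i<n. E (A i) u x))) \<longlonglongrightarrow> 0))"

definition spectral_distribution ::
  "(real set \<Rightarrow> (real \<Rightarrow> complex^'n) \<Rightarrow> (real \<Rightarrow> complex^'n)) \<Rightarrow> (real \<Rightarrow> complex^'n) \<Rightarrow> real measure"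
  where
  "spectral_distribution E u =
     measure_of UNIV (sets borel) (\<lambda>A. ennreal (Re (L2_inner (E A u) u)))"

(* E is the spectral measure of the operator T with domain D, i.e. T is the integral of t dE(t):
   D consists of the u for which t^2 is integrable with respect to <E(.)u, u>, and <Tu, u> is the
   integral of t d<E(t)u, u> for u in D. By the spectral theorem such an E exists and is unique
   when T is self-adjoint, and then E A is the operator obtained by applying the indicator
   function of A to T. *)
definition is_spectral_measure ::
  "(real \<Rightarrow> complex^'n) set \<Rightarrow> ((real \<Rightarrow> complex^'n) \<Rightarrow> (real \<Rightarrow> complex^'n)) \<Rightarrow>
   (real set \<Rightarrow> (real \<Rightarrow> complex^'n) \<Rightarrow> (real \<Rightarrow> complex^'n)) \<Rightarrow> bool" where
  "is_spectral_measure D T E \<longleftrightarrow>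
     projection_valued_measure E \<and>
     D = {u \<in> L2. integrable (spectral_distribution E u) (\<lambda>t. t\<^sup>2)} \<and>
     (\<forall>u\<in>D. L2_inner (T u) u = of_real (\<integral>t. t \<partial>spectral_distribution E u))"


subsection \<open>The spectral-density kernel\<close>

(* The matrix entry with upper index l and lower index j is \<sigma> \<omega> x y $ j $ l.
   Being an integral kernel includes the (absolute) convergence of the integrals involved. *)
definition is_spectral_density_kernel ::
  "real \<Rightarrow> (real \<Rightarrow> real \<Rightarrow> real \<Rightarrow> complex^'n^'n) \<Rightarrow> bool" where
  "is_spectral_density_kernel \<alpha> \<sigma> \<longleftrightarrow>
     continuous_on ({0<..} \<times> {0<..} \<times> {0<..}) (\<lambda>(\<omega>, x, y). \<sigma> \<omega> x y) \<and>
     (\<exists>E. is_spectral_measure (star_dom \<alpha>) star_op E \<and>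
       (\<forall>\<Lambda>>0.
         (\<forall>x>0. \<forall>y>0. \<forall>j l. set_integrable lborel {0<..sqrt \<Lambda>} (\<lambda>\<omega>. \<sigma> \<omega> x y $ j $ l)) \<and>
         (\<forall>f. (\<forall>l. edge f l \<in> test_functions) \<longrightarrow>
           (\<forall>x>0. \<forall>j l. integrable half_line
              (\<lambda>y. (LBINT \<omega>:{0<..sqrt \<Lambda>}. \<sigma> \<omega> x y $ j $ l) * f y $ l)) \<and>
           E {0..\<Lambda>} f \<simeq>
             (\<lambda>x. \<chi> j. \<Sum>l\<in>UNIV. \<integral>y. (LBINT \<omega>:{0<..sqrt \<Lambda>}. \<sigma> \<omega> x y $ j $ l) * f y $ l \<partial>half_line))))"

end

theory Submission imports Defs begin

text \<open>
  The density is read off the quadratic form of the spectral measure at a bump function \<open>f\<close>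
  supported on edge \<open>j\<close> near \<open>x\<close>. If \<open>(H - z) g = f\<close>, cutting the spectrum into short intervals, on
  which \<open>H\<close> is nearly a constant, shows that the Poisson integral of the spectral distribution of \<open>f\<close>
  at \<open>z\<close> is \<open>Im \<langle>g, f\<rangle>\<close>. For the star graph \<open>g\<close> is explicit: the free solution on edge \<open>j\<close> plus decaying
  exponentials fixed by the vertex condition. As \<open>z\<close> tends to \<open>\<omega>^2\<close> from above, \<open>Im \<langle>g, f\<rangle>\<close> converges to
  an expression in the single number \<open>\<integral> exp(i \<omega> y) \<phi>(y) dy\<close>, and Stieltjes inversion turns it into the density
  of the spectral distribution. The kernel gives the same distribution as an average of \<open>\<sigma>\<close>
  over the support of the bump; shrinking the support to \<open>x\<close> identifies \<open>\<sigma>\<close> on the diagonal.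
\<close>

subsection \<open>The space \<open>L^2\<close> on the half-line\<close>

text \<open>The hypotheses describe \<open>T\<close> through two data only: its domain, as
  square-integrability of \<open>t\<close>, and its quadratic form \<open><Tu, u>\<close>. Neither a
  functional calculus nor commutation of \<open>T\<close> with \<open>E A\<close> is given. The
  resolvent identity therefore rests on the estimate that \<open>E I (T g)\<close> differs from
  \<open>c E I g\<close> by at most \<open>\<delta>\<close> times the norm of \<open>E I g\<close>
  when \<open>I\<close> lies within \<open>\<delta>\<close> of \<open>c\<close>, obtained from form
  bounds and polarization alone.

  Inversion needs endpoints without atoms. The kernel itself excludes them: its average over a
  shrinking window bounds the mass of a point by a multiple of the length of the window.

  The coefficients come from scattering at the vertex. At \<open>\<kappa> = - i \<omega>\<close> the
  Green function on edge \<open>j\<close> is \<open>(i / (2 \<omega>)) (exp(i \<omega> |x - y|) + R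
  exp(i \<omega> (x + y)))\<close> with \<open>R = 2 \<kappa> / (N \<kappa> + \<alpha>) - 1\<close>,
  so the density on the diagonal is \<open>(1 + Re (R exp(2 i \<omega> x))) / pi\<close>. For
  \<open>\<alpha> = 0\<close> the amplitude \<open>R\<close> reduces to
  \<open>2 / N - 1\<close>.\<close>

lemma space_half_line: "space half_line = {0<..}"
  by (simp add: half_line_def space_restrict_space)

lemma L2_measurable: "u \<in> L2 \<Longrightarrow> u \<in> borel_measurable half_line"
  by (simp add: L2_def)

lemma L2_integrable_norm: "u \<in> L2 \<Longrightarrow> integrable half_line (\<lambda>x. (norm (u x))\<^sup>2)"
  by (simp add: L2_def)

lemma L2I: "u \<in> borel_measurable half_line \<Longrightarrow> integrable half_line (\<lambda>x. (norm (u x))\<^sup>2) \<Longrightarrow> u \<in> L2"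
  by (simp add: L2_def)

lemma L2_bound:
  assumes "u \<in> L2" "v \<in> borel_measurable half_line" "\<And>x. x > 0 \<Longrightarrow> norm (v x) \<le> C * norm (u x)"
  shows "v \<in> L2"
proof (rule L2I)
  show "integrable half_line (\<lambda>x. (norm (v x))\<^sup>2)"
  proof (rule Bochner_Integration.integrable_bound)
    show "integrable half_line (\<lambda>x. C\<^sup>2 * (norm (u x))\<^sup>2)"
      using L2_integrable_norm[OF assms(1)] by simp
    show "(\<lambda>x. (norm (v x))\<^sup>2) \<in> borel_measurable half_line"
      using assms(2) by measurable
    show "AE x in half_line. norm ((norm (v x))\<^sup>2) \<le> norm (C\<^sup>2 * (norm (u x))\<^sup>2)"
    proof (rule AE_I2)
      fix x assume "x \<in> space half_line"
      then have "(norm (v x))\<^sup>2 \<le> (C * norm (u x))\<^sup>2"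
        using assms(3)[of x] by (intro power_mono) (auto simp: space_half_line)
      then show "norm ((norm (v x))\<^sup>2) \<le> norm (C\<^sup>2 * (norm (u x))\<^sup>2)"
        by (simp add: power_mult_distrib)
    qed
  qed
qed fact

lemma L2_add:
  assumes "u \<in> L2" "v \<in> L2"
  shows "(\<lambda>x. u x + v x) \<in> L2"
proof (rule L2I)
  note [measurable] = L2_measurable[OF assms(1)] L2_measurable[OF assms(2)]
  show "(\<lambda>x. u x + v x) \<in> borel_measurable half_line" by measurable
  show "integrable half_line (\<lambda>x. (norm (u x + v x))\<^sup>2)"
  proof (rule Bochner_Integration.integrable_bound)
    show "integrable half_line (\<lambda>x. 2 * (norm (u x))\<^sup>2 + 2 * (norm (v x))\<^sup>2)"
      using L2_integrable_norm[OF assms(1)] L2_integrable_norm[OF assms(2)] by simp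
    have "(norm (u x + v x))\<^sup>2 \<le> 2 * (norm (u x))\<^sup>2 + 2 * (norm (v x))\<^sup>2" for x
    proof -
      have "(norm (u x + v x))\<^sup>2 \<le> (norm (u x) + norm (v x))\<^sup>2"
        by (intro power_mono norm_triangle_ineq) auto
      also have "\<dots> \<le> 2 * (norm (u x))\<^sup>2 + 2 * (norm (v x))\<^sup>2"
        using zero_le_power2[of "norm (u x) - norm (v x)"]
        by (simp add: power2_sum power2_diff)
      finally show ?thesis .
    qed
    then show "AE x in half_line. norm ((norm (u x + v x))\<^sup>2) \<le> norm (2 * (norm (u x))\<^sup>2 + 2 * (norm (v x))\<^sup>2)"
      by (intro AE_I2) auto
  qed measurable
qed

lemma L2_zero: "(\<lambda>x. 0) \<in> L2"
  by (simp add: L2_def)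

lemma L2_sum: "(\<And>i. i \<in> A \<Longrightarrow> u i \<in> L2) \<Longrightarrow> (\<lambda>x. \<Sum>i\<in>A. u i x) \<in> L2"
  by (induction A rule: infinite_finite_induct) (auto intro: L2_zero L2_add)

lemma norm_smult_vec: "norm (c *s v) = norm c * norm v" for c :: complex and v :: "complex^'n"
  by (simp add: norm_vec_def L2_set_def norm_mult power_mult_distrib flip: sum_distrib_left)
     (simp add: real_sqrt_mult)

lemma smult_measurable:
  fixes u :: "'a \<Rightarrow> complex^'n"
  assumes "u \<in> borel_measurable M"
  shows "(\<lambda>x. c *s u x) \<in> borel_measurable M"
proof -
  have "continuous_on UNIV (\<lambda>v::complex^'n. c *s v)"
    unfolding vector_scalar_mult_def by (intro continuous_intros)
  then have "(\<lambda>v::complex^'n. c *s v) \<in> borel_measurable borel"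
    by (rule borel_measurable_continuous_onI)
  from measurable_compose[OF assms this] show ?thesis .
qed

lemma L2_smult:
  fixes u :: "real \<Rightarrow> complex^'n"
  shows "u \<in> L2 \<Longrightarrow> (\<lambda>x. c *s u x) \<in> L2"
  by (rule L2_bound[where C="norm c" and u=u]) (auto simp: norm_smult_vec L2_measurable smult_measurable)

lemma L2_mult:
  fixes u :: "real \<Rightarrow> complex"
  shows "u \<in> L2 \<Longrightarrow> (\<lambda>x. c * u x) \<in> L2"
  by (rule L2_bound[where C="norm c" and u=u]) (auto simp: norm_mult dest: L2_measurable)

lemma L2_uminus: "u \<in> L2 \<Longrightarrow> (\<lambda>x. - u x) \<in> L2"
  by (rule L2_bound[where C=1 and u=u]) (auto dest: L2_measurable)

lemma L2_diff: "u \<in> L2 \<Longrightarrow> v \<in> L2 \<Longrightarrow> (\<lambda>x. u x - v x) \<in> L2"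
  using L2_add[of u "\<lambda>x. - v x"] L2_uminus[of v] by simp

lemma L2_edge: 
  fixes u :: "real \<Rightarrow> complex^'n"
  assumes "u \<in> L2" shows "edge u j \<in> L2"
  unfolding edge_def
proof (rule L2_bound[OF assms, where C=1])
  note [measurable] = L2_measurable[OF assms]
  have "(\<lambda>v::complex^'n. v $ j) \<in> borel_measurable borel"
    by (intro borel_measurable_continuous_onI continuous_intros)
  from measurable_compose[OF L2_measurable[OF assms] this]
  show "(\<lambda>x. u x $ j) \<in> borel_measurable half_line" .
qed (auto intro: Finite_Cartesian_Product.norm_nth_le)

lemma vec_measurable:
  fixes u :: "'a \<Rightarrow> complex^'n"
  assumes "\<And>j. (\<lambda>x. u x $ j) \<in> borel_measurable M"
  shows "u \<in> borel_measurable M"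
proof -
  have *: "(\<lambda>z::complex. axis j z :: complex^'n) \<in> borel_measurable borel" for j
  proof -
    have "continuous_on UNIV (\<lambda>z::complex. if i = j then z else 0)" for i
      by (cases "i = j") auto
    then show ?thesis
      unfolding axis_def by (intro borel_measurable_continuous_onI continuous_on_vec_lambda)
  qed
  have "(\<lambda>x. \<Sum>j\<in>UNIV. axis j (u x $ j)) \<in> borel_measurable M"
    using measurable_compose[OF assms *] by (intro borel_measurable_sum) auto
  moreover have "(\<Sum>j\<in>UNIV. axis j (u x $ j)) = u x" for x
    by (simp add: vec_eq_iff axis_def if_distrib[where f="\<lambda>f. f _"] cong: if_cong)
  ultimately show ?thesis by simp
qed

lemma L2_vecI:
  fixes u :: "real \<Rightarrow> complex^'n"
  assumes "\<And>j. edge u j \<in> L2"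
  shows "u \<in> L2"
proof (rule L2I)
  show "u \<in> borel_measurable half_line"
    using L2_measurable[OF assms] by (auto intro: vec_measurable simp: edge_def)
  have "(norm (u x))\<^sup>2 = (\<Sum>j\<in>UNIV. (norm (u x $ j))\<^sup>2)" for x
    by (simp add: norm_vec_def L2_set_def sum_nonneg)
  then show "integrable half_line (\<lambda>x. (norm (u x))\<^sup>2)"
    using L2_integrable_norm[OF assms] by (auto simp: edge_def)
qed


section \<open>Inner product and seminorm\<close>

lemma L2_mult_integrable:
  fixes u v :: "real \<Rightarrow> complex"
  assumes "u \<in> L2" "v \<in> L2"
  shows "integrable half_line (\<lambda>x. u x * v x)"
proof (rule Bochner_Integration.integrable_bound)
  note [measurable] = assms[THEN L2_measurable]
  show "integrable half_line (\<lambda>x. (norm (u x))\<^sup>2 + (norm (v x))\<^sup>2)"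
    using assms[THEN L2_integrable_norm] by simp
  show "(\<lambda>x. u x * v x) \<in> borel_measurable half_line" by measurable
  have "a * b \<le> a\<^sup>2 + b\<^sup>2" if "a \<ge> 0" "b \<ge> 0" for a b :: real
    using zero_le_power2[of "a - b"] that by (simp add: power2_diff) (use mult_nonneg_nonneg[OF that] in linarith)
  then show "AE x in half_line. norm (u x * v x) \<le> norm ((norm (u x))\<^sup>2 + (norm (v x))\<^sup>2)"
    by (intro AE_I2) (auto simp: norm_mult)
qed

lemma L2_cnj:
  assumes "u \<in> L2" shows "(\<lambda>x. cnj (u x)) \<in> L2"
proof (rule L2_bound[OF assms, where C=1])
  have "cnj \<in> borel_measurable borel"
    by (intro borel_measurable_continuous_onI continuous_intros)
  then show "(\<lambda>x. cnj (u x)) \<in> borel_measurable half_line"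
    using measurable_compose[OF L2_measurable[OF assms]] by blast
qed auto

lemma L2_inner_integrand_integrable:
  fixes u v :: "real \<Rightarrow> complex^'n"
  assumes "u \<in> L2" "v \<in> L2"
  shows "integrable half_line (\<lambda>x. u x $ j * cnj (v x $ j))"
  using L2_mult_integrable[OF L2_edge[OF assms(1)] L2_cnj[OF L2_edge[OF assms(2)]]]
  by (simp add: edge_def)

lemma L2_inner_sum:
  assumes "u \<in> L2" "v \<in> L2"
  shows "L2_inner u v = (\<Sum>j\<in>UNIV. \<integral>x. u x $ j * cnj (v x $ j) \<partial>half_line)"
  unfolding L2_inner_def
  by (intro Bochner_Integration.integral_sum L2_inner_integrand_integrable assms)

lemma L2_inner_cong:
  assumes "u \<simeq> u'" "v \<simeq> v'" "u \<in> L2" "v \<in> L2" "u' \<in> L2" "v' \<in> L2"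
  shows "L2_inner u v = L2_inner u' v'"
  unfolding L2_inner_def
proof (rule integral_cong_AE)
  show "(\<lambda>x. \<Sum>j\<in>UNIV. u x $ j * cnj (v x $ j)) \<in> borel_measurable half_line"
       "(\<lambda>x. \<Sum>j\<in>UNIV. u' x $ j * cnj (v' x $ j)) \<in> borel_measurable half_line"
    by (intro borel_measurable_sum borel_measurable_integrable L2_inner_integrand_integrable assms)+
  show "AE x in half_line. (\<Sum>j\<in>UNIV. u x $ j * cnj (v x $ j)) = (\<Sum>j\<in>UNIV. u' x $ j * cnj (v' x $ j))"
    using assms(1,2) unfolding L2_eq_def by eventually_elim simp
qed

lemma L2_inner_add_left:
  assumes "u \<in> L2" "v \<in> L2" "w \<in> L2"
  shows "L2_inner (\<lambda>x. u x + v x) w = L2_inner u w + L2_inner v w"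
  by (simp add: L2_inner_sum L2_add assms distrib_left distrib_right L2_inner_integrand_integrable sum.distrib)

lemma L2_inner_add_right:
  assumes "u \<in> L2" "v \<in> L2" "w \<in> L2"
  shows "L2_inner w (\<lambda>x. u x + v x) = L2_inner w u + L2_inner w v"
  by (simp add: L2_inner_sum L2_add assms distrib_left distrib_right L2_inner_integrand_integrable sum.distrib)

lemma L2_inner_smult_left:
  assumes "u \<in> L2" "v \<in> L2"
  shows "L2_inner (\<lambda>x. c *s u x) v = c * L2_inner u v"
  by (simp add: L2_inner_sum L2_smult assms mult.assoc sum_distrib_left)

lemma L2_inner_smult_right:
  assumes "u \<in> L2" "v \<in> L2"
  shows "L2_inner u (\<lambda>x. c *s v x) = cnj c * L2_inner u v"
  by (simp add: L2_inner_sum L2_smult assms sum_distrib_left mult.left_commute)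

lemma L2_inner_commute:
  assumes "u \<in> L2" "v \<in> L2"
  shows "L2_inner v u = cnj (L2_inner u v)"
  unfolding L2_inner_def Bochner_Integration.integral_cnj[symmetric]
  by (rule Bochner_Integration.integral_cong) (simp_all add: mult.commute)

lemma L2_inner_self:
  fixes u :: "real \<Rightarrow> complex^'n"
  shows "L2_inner u u = of_real ((L2_norm u)\<^sup>2)"
proof -
  have "(\<Sum>j\<in>UNIV. u x $ j * cnj (u x $ j)) = of_real ((norm (u x))\<^sup>2)" for x
    by (simp add: norm_vec_def L2_set_def sum_nonneg complex_norm_square[symmetric])
  moreover have "(\<integral>x. (norm (u x))\<^sup>2 \<partial>half_line) \<ge> 0"
    by (intro Bochner_Integration.integral_nonneg) auto
  ultimately show ?thesis
    by (simp add: L2_inner_def L2_norm_def del: of_real_power)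
qed

lemma L2_norm_nonneg: "L2_norm u \<ge> 0"
  unfolding L2_norm_def by (intro real_sqrt_ge_zero Bochner_Integration.integral_nonneg) auto

lemma L2_norm_smult:
  "L2_norm (\<lambda>x. c *s u x) = norm c * L2_norm u"
  by (simp add: L2_norm_def norm_smult_vec power_mult_distrib real_sqrt_mult)

lemma L2_norm_add_sq:
  assumes "u \<in> L2" "v \<in> L2"
  shows "(L2_norm (\<lambda>x. u x + v x))\<^sup>2 = (L2_norm u)\<^sup>2 + (L2_norm v)\<^sup>2 + 2 * Re (L2_inner u v)"
proof -
  have "complex_of_real ((L2_norm (\<lambda>x. u x + v x))\<^sup>2) =
     L2_inner u u + L2_inner v v + (L2_inner u v + cnj (L2_inner u v))"
    unfolding L2_inner_self[symmetric] L2_inner_commute[OF assms, symmetric]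
    by (simp add: L2_inner_add_left L2_inner_add_right L2_add assms)
  then have "complex_of_real ((L2_norm (\<lambda>x. u x + v x))\<^sup>2) =
     of_real ((L2_norm u)\<^sup>2 + (L2_norm v)\<^sup>2 + 2 * Re (L2_inner u v))"
    by (simp add: L2_inner_self complex_add_cnj)
  then show ?thesis using of_real_eq_iff by blast
qed

text \<open>Nonnegativity of \<open>||s u + t v||^2\<close> is used with \<open>s = ||v||\<close>
  and \<open>t = - ||u||\<close>. Since \<open>L2_norm\<close> is only a seminorm on functions, a
  vanishing norm is treated separately.\<close>

lemma L2_Cauchy_Schwarz_Re:
  assumes "u \<in> L2" "v \<in> L2"
  shows "Re (L2_inner u v) \<le> L2_norm u * L2_norm v"
proof -
  let ?a = "L2_norm u" and ?b = "L2_norm v"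
  have *: "0 \<le> s\<^sup>2 * ?a\<^sup>2 + t\<^sup>2 * ?b\<^sup>2 + 2 * s * t * Re (L2_inner u v)" for s t :: real
  proof -
    have "0 \<le> (L2_norm (\<lambda>x. of_real s *s u x + of_real t *s v x))\<^sup>2" by simp
    also have "\<dots> = s\<^sup>2 * ?a\<^sup>2 + t\<^sup>2 * ?b\<^sup>2 + 2 * s * t * Re (L2_inner u v)"
      using assms by (subst L2_norm_add_sq)
        (auto simp: L2_smult L2_norm_smult L2_inner_smult_left L2_inner_smult_right power_mult_distrib)
    finally show ?thesis .
  qed
  have ab: "?a \<ge> 0" "?b \<ge> 0" by (auto simp: L2_norm_nonneg)
  show ?thesis
  proof (cases "?a > 0 \<and> ?b > 0")
    case True
    have "2 * (?a * ?b) * Re (L2_inner u v) \<le> 2 * (?a * ?b) * (?a * ?b)"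
      using *[of ?b "- ?a"] by (simp add: power2_eq_square algebra_simps)
    then show ?thesis using True by simp
  next
    case False
    then consider "?a = 0" | "?b = 0" using ab by linarith
    then show ?thesis
    proof cases
      case 1
      show ?thesis
      proof (rule ccontr)
        assume n: "\<not> ?thesis"
        then have r: "Re (L2_inner u v) > 0" using 1 by simp
        \<comment> \<open>With \<open>?a = 0\<close> the quadratic form is
          \<open>t^2 ?b^2 + 2 s t Re <u, v>\<close>; this \<open>s\<close> makes it equal to -1 at
          \<open>t = -1\<close>.\<close>
        show False using *[of "(?b\<^sup>2 + 1) / (2 * Re (L2_inner u v))" "-1"] r 1 by (simp add: field_simps)
      qed
    next
      case 2
      show ?thesis
      proof (rule ccontr)
        assume n: "\<not> ?thesis"
        then have r: "Re (L2_inner u v) > 0" using 2 by simp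
        show False using *[of "-1" "(?a\<^sup>2 + 1) / (2 * Re (L2_inner u v))"] r 2 by (simp add: field_simps)
      qed
    qed
  qed
qed

lemma L2_Cauchy_Schwarz:
  assumes "u \<in> L2" "v \<in> L2"
  shows "\<bar>Re (L2_inner u v)\<bar> \<le> L2_norm u * L2_norm v"
  using L2_Cauchy_Schwarz_Re[OF assms]
    L2_Cauchy_Schwarz_Re[OF L2_smult[OF assms(1), of "-1"] assms(2),
      unfolded L2_inner_smult_left[OF assms] L2_norm_smult]
  by simp

lemma L2_norm_triangle:
  assumes "u \<in> L2" "v \<in> L2"
  shows "L2_norm (\<lambda>x. u x + v x) \<le> L2_norm u + L2_norm v"
proof (rule power2_le_imp_le)
  show "(L2_norm (\<lambda>x. u x + v x))\<^sup>2 \<le> (L2_norm u + L2_norm v)\<^sup>2"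
    using L2_Cauchy_Schwarz_Re[OF assms] by (simp add: L2_norm_add_sq[OF assms] power2_sum)
qed (simp add: L2_norm_nonneg)

lemma L2_norm_cong: "u \<simeq> v \<Longrightarrow> u \<in> L2 \<Longrightarrow> v \<in> L2 \<Longrightarrow> L2_norm u = L2_norm v"
  unfolding L2_norm_def L2_eq_def
  by (intro arg_cong[where f=sqrt] integral_cong_AE) (auto dest!: L2_measurable)

lemma L2_inner_zero: "L2_inner (\<lambda>x. 0) v = 0" "L2_inner v (\<lambda>x. 0) = 0"
  by (simp_all add: L2_inner_def)

lemma L2_norm_zero: "L2_norm (\<lambda>x. 0) = 0"
  by (simp add: L2_norm_def)

lemma L2_eq_refl [simp]: "u \<simeq> u" by (simp add: L2_eq_def)
lemma L2_eq_sym: "u \<simeq> v \<Longrightarrow> v \<simeq> u" unfolding L2_eq_def by (auto elim: eventually_mono)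
lemma L2_eq_trans [trans]: "u \<simeq> v \<Longrightarrow> v \<simeq> w \<Longrightarrow> u \<simeq> w" unfolding L2_eq_def by (auto elim: eventually_elim2)
lemma L2_eq_add: "u \<simeq> u' \<Longrightarrow> v \<simeq> v' \<Longrightarrow> (\<lambda>x. u x + v x) \<simeq> (\<lambda>x. u' x + v' x)"
  unfolding L2_eq_def by (erule (1) eventually_elim2) simp
lemma L2_eq_comp: "u \<simeq> u' \<Longrightarrow> (\<lambda>x. f x (u x)) \<simeq> (\<lambda>x. f x (u' x))"
  unfolding L2_eq_def by (erule eventually_mono) simp

lemma L2_eq_smult: "u \<simeq> u' \<Longrightarrow> (\<lambda>x. c *s u x) \<simeq> (\<lambda>x. c *s u' x)"
  by (rule L2_eq_comp[where f="\<lambda>_ y. c *s y"])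

subsection \<open>Smooth bump functions\<close>

text \<open>With \<open>t = 1 / x\<close> these are the functions \<open>p(t) exp(- t)\<close>,
  continued by zero. Carrying a polynomial along makes the family contain every derivative of the
  flat function \<open>exp(- 1 / x)\<close>.\<close>

definition flat_exp :: "real poly \<Rightarrow> real \<Rightarrow> real" where
  "flat_exp p x = (if x > 0 then poly p (1 / x) * exp (- 1 / x) else 0)"

text \<open>The difference quotient of \<open>flat_exp p\<close> at 0 from the right is
  \<open>t p(t) exp(- t)\<close> with \<open>t = 1 / x\<close>. The general exponent
  \<open>k\<close> is what the induction on \<open>p\<close> requires.\<close>

lemma poly_times_exp_tendsto_0:
  "((\<lambda>t::real. t ^ k * poly p t * exp (- t)) \<longlongrightarrow> 0) at_top"
proof (induction p arbitrary: k)
  case 0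
  then show ?case by simp
next
  case (pCons a p)
  have "((\<lambda>t::real. a * (t ^ k / exp t) + t ^ Suc k * poly p t * exp (- t)) \<longlongrightarrow> a * 0 + 0) at_top"
    by (intro tendsto_intros tendsto_power_div_exp_0 pCons.IH)
  then show ?case
    by (simp add: algebra_simps exp_minus divide_inverse)
qed

lemma flat_exp_tendsto_0: "((\<lambda>x. flat_exp p x / x) \<longlongrightarrow> 0) (at 0)"
proof (rule filterlim_split_at)
  have "\<forall>\<^sub>F x in at_left (0::real). x < 0" by (simp add: eventually_at_filter)
  then have "\<forall>\<^sub>F x in at_left 0. 0 = flat_exp p x / x"
    by eventually_elim (simp add: flat_exp_def)
  then show "((\<lambda>x. flat_exp p x / x) \<longlongrightarrow> 0) (at_left 0)"
    using tendsto_cong[of "\<lambda>x. 0" "\<lambda>x. flat_exp p x / x" "at_left 0" 0] by simp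
next
  have "((\<lambda>x::real. (inverse x) ^ 1 * poly p (inverse x) * exp (- inverse x)) \<longlongrightarrow> 0) (at_right 0)"
    by (rule filterlim_compose[OF poly_times_exp_tendsto_0 filterlim_inverse_at_top_right])
  moreover have "\<forall>\<^sub>F x in at_right (0::real). x > 0" by (simp add: eventually_at_filter)
  then have "\<forall>\<^sub>F x in at_right 0. (inverse x) ^ 1 * poly p (inverse x) * exp (- inverse x) = flat_exp p x / x"
    by eventually_elim (simp add: flat_exp_def field_simps)
  ultimately show "((\<lambda>x. flat_exp p x / x) \<longlongrightarrow> 0) (at_right 0)"
    by (simp only: tendsto_cong)
qed

text \<open>Since \<open>dt / dx = - t^2\<close> for \<open>t = 1 / x\<close>, differentiating
  \<open>p(t) exp(- t)\<close> gives \<open>t^2 (p - p')(t) exp(- t)\<close>; the polynomial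
  \<open>[:0, 0, 1:]\<close> is the factor \<open>t^2\<close>. At 0 the difference quotient tends to
  0.\<close>

lemma flat_exp_deriv:
  "(flat_exp p has_real_derivative flat_exp ([:0, 0, 1:] * (p - pderiv p)) x) (at x)"
proof -
  consider "x > 0" | "x < 0" | "x = 0" by linarith
  then show ?thesis
  proof cases
    case 1
    have "((\<lambda>x. poly p (1 / x)) has_real_derivative poly (pderiv p) (1 / x) * (- 1 / x\<^sup>2)) (at x)"
      by (rule DERIV_chain2[OF poly_DERIV])
         (use 1 in \<open>auto intro!: derivative_eq_intros simp: power2_eq_square\<close>)
    moreover have "((\<lambda>x. exp (- 1 / x)) has_real_derivative exp (- 1 / x) * (1 / x\<^sup>2)) (at x)"
      by (rule DERIV_chain2[OF DERIV_exp])
         (use 1 in \<open>auto intro!: derivative_eq_intros simp: power2_eq_square\<close>)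
    ultimately have "((\<lambda>x. poly p (1 / x) * exp (- 1 / x)) has_real_derivative
        poly (pderiv p) (1 / x) * (- 1 / x\<^sup>2) * exp (- 1 / x) + exp (- 1 / x) * (1 / x\<^sup>2) * poly p (1 / x)) (at x)"
      by (rule DERIV_mult)
    moreover have "poly (pderiv p) (1 / x) * (- 1 / x\<^sup>2) * exp (- 1 / x) + exp (- 1 / x) * (1 / x\<^sup>2) * poly p (1 / x)
        = flat_exp ([:0, 0, 1:] * (p - pderiv p)) x"
      using 1 by (simp add: flat_exp_def power2_eq_square divide_inverse algebra_simps)
    ultimately have "((\<lambda>x. poly p (1 / x) * exp (- 1 / x)) has_real_derivative
        flat_exp ([:0, 0, 1:] * (p - pderiv p)) x) (at x)"
      by simp
    then show ?thesis
      by (rule has_field_derivative_transform_within_open[where S="{0<..}"]) (use 1 in \<open>auto simp: flat_exp_def\<close>)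
  next
    case 2
    have "((\<lambda>x. 0) has_real_derivative flat_exp ([:0, 0, 1:] * (p - pderiv p)) x) (at x)"
      using 2 by (simp add: flat_exp_def)
    then show ?thesis
      by (rule has_field_derivative_transform_within_open[where S="{..<0}"]) (use 2 in \<open>auto simp: flat_exp_def\<close>)
  next
    case 3
    have "(flat_exp p has_real_derivative 0) (at 0)"
      using flat_exp_tendsto_0[of p] by (simp add: DERIV_def flat_exp_def)
    moreover have "flat_exp ([:0, 0, 1:] * (p - pderiv p)) 0 = 0" by (simp add: flat_exp_def)
    ultimately show ?thesis using 3 by simp
  qed
qed

text \<open>
  Closing the translates and dilates of \<open>flat_exp\<close> under sums and products makes the class stable under
  differentiation, so that smoothness of a product of cutoffs needs no Leibniz formula.
\<close>
inductive_set flat_algebra :: "(real \<Rightarrow> real) set" where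
  base: "(\<lambda>x. flat_exp p (s * x + c)) \<in> flat_algebra"
| add: "f \<in> flat_algebra \<Longrightarrow> g \<in> flat_algebra \<Longrightarrow> (\<lambda>x. f x + g x) \<in> flat_algebra"
| mult: "f \<in> flat_algebra \<Longrightarrow> g \<in> flat_algebra \<Longrightarrow> (\<lambda>x. f x * g x) \<in> flat_algebra"

lemma flat_algebra_deriv:
  "f \<in> flat_algebra \<Longrightarrow> \<exists>g\<in>flat_algebra. \<forall>x. (f has_real_derivative g x) (at x)"
proof (induction rule: flat_algebra.induct)
  case (base p s c)
  let ?p = "[:0, 0, 1:] * (p - pderiv p)"
  have "((\<lambda>x. flat_exp p (s * x + c)) has_real_derivative flat_exp ?p (s * x + c) * s) (at x)" for x
  proof (rule DERIV_chain2[where f="flat_exp p" and g="\<lambda>x. s * x + c"])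
    show "(flat_exp p has_real_derivative flat_exp ?p (s * x + c)) (at (s * x + c))"
      by (rule flat_exp_deriv)
    show "((\<lambda>x. s * x + c) has_real_derivative s) (at x)"
      by (auto intro!: derivative_eq_intros)
  qed
  \<comment> \<open>The chain-rule factor \<open>s\<close> is absorbed into the polynomial, so the
    algebra needs no rule for scalar multiples.\<close>
  moreover have "flat_exp ?p (s * x + c) * s = flat_exp (smult s ?p) (s * x + c)" for x
    by (simp add: flat_exp_def)
  ultimately show ?case
    using flat_algebra.base[of "smult s ?p" s c] by metis
next
  case (add f g)
  then obtain f' g' where "f' \<in> flat_algebra" "g' \<in> flat_algebra"
     "\<And>x. (f has_real_derivative f' x) (at x)" "\<And>x. (g has_real_derivative g' x) (at x)" by auto
  then show ?case
    by (intro bexI[where x="\<lambda>x. f' x + g' x"]) (auto intro: DERIV_add flat_algebra.add)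
next
  case (mult f g)
  then obtain f' g' where *: "f' \<in> flat_algebra" "g' \<in> flat_algebra"
     "\<And>x. (f has_real_derivative f' x) (at x)" "\<And>x. (g has_real_derivative g' x) (at x)" by auto
  show ?case
    by (intro bexI[where x="\<lambda>x. f' x * g x + g' x * f x"])
       (use * mult in \<open>auto intro!: flat_algebra.add flat_algebra.mult DERIV_mult\<close>)
qed

lemma flat_algebra_test_function:
  assumes "f \<in> flat_algebra" "compact K" "K \<subseteq> {0<..}" "\<And>x. x \<notin> K \<Longrightarrow> f x = 0"
  shows "(\<lambda>x. complex_of_real (f x)) \<in> test_functions"
proof -
  \<comment> \<open>A choice function for derivatives within the algebra; its iterates provide the
    whole sequence of derivatives demanded by \<open>test_functions\<close>.\<close>
  obtain d where d: "\<And>f. f \<in> flat_algebra \<Longrightarrow> d f \<in> flat_algebra"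
      "\<And>f x. f \<in> flat_algebra \<Longrightarrow> (f has_real_derivative d f x) (at x)"
    using flat_algebra_deriv by metis
  define D where "D n x = complex_of_real ((d ^^ n) f x)" for n x
  have dn: "(d ^^ n) f \<in> flat_algebra" for n
    by (induction n) (auto intro: d assms)
  have "(D n has_vector_derivative D (Suc n) x) (at x)" for n x
    using d(2)[OF dn[of n], of x] unfolding D_def
    by (auto intro!: has_vector_derivative_of_real simp: has_real_derivative_iff_has_vector_derivative)
  moreover have "D 0 = (\<lambda>x. complex_of_real (f x))" by (simp add: D_def fun_eq_iff)
  ultimately show ?thesis
    unfolding test_functions_def using assms(2-4) by (auto intro!: exI[of _ D] exI[of _ K])
qed

text \<open>The parameter \<open>c\<close> only steers the plateau: as \<open>c\<close> tends to 0 the bump increases to the indicator of \<open>(a, b)\<close>.\<close>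
definition bump :: "real \<Rightarrow> real \<Rightarrow> real \<Rightarrow> real \<Rightarrow> real" where
  "bump c a b x = flat_exp 1 ((x - a) / c) * flat_exp 1 ((b - x) / c)"

lemma flat_exp_1: "flat_exp 1 x = (if x > 0 then exp (- 1 / x) else 0)"
  by (simp add: flat_exp_def)

lemma bump_nonneg: "bump c a b x \<ge> 0"
  and bump_le_1: "bump c a b x \<le> 1"
proof -
  have *: "0 \<le> flat_exp 1 x" "flat_exp 1 x \<le> 1" for x
    by (cases "x > 0"; simp add: flat_exp_1)+
  show "bump c a b x \<ge> 0"
    unfolding bump_def by (intro mult_nonneg_nonneg *)
  show "bump c a b x \<le> 1"
    unfolding bump_def by (intro mult_le_one *)
qed

lemma bump_pos: "c > 0 \<Longrightarrow> a < x \<Longrightarrow> x < b \<Longrightarrow> bump c a b x > 0"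
  by (simp add: bump_def flat_exp_1)

lemma bump_eq_0: "c > 0 \<Longrightarrow> x \<notin> {a<..<b} \<Longrightarrow> bump c a b x = 0"
  unfolding bump_def flat_exp_1
  by (cases "x > a") (simp_all add: zero_less_divide_iff)

lemma bump_test_function:
  assumes "0 < a" "c > 0"
  shows "(\<lambda>x. complex_of_real (bump c a b x)) \<in> test_functions"
proof (rule flat_algebra_test_function[where K="{a..b}"])
  have "(\<lambda>x. flat_exp 1 ((1 / c) * x + (- a / c)) * flat_exp 1 ((- 1 / c) * x + b / c)) \<in> flat_algebra"
    by (intro flat_algebra.intros)
  moreover have "(\<lambda>x. flat_exp 1 ((1 / c) * x + (- a / c)) * flat_exp 1 ((- 1 / c) * x + b / c)) = bump c a b"
    by (simp add: bump_def fun_eq_iff diff_divide_distrib)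
  ultimately show "bump c a b \<in> flat_algebra" by simp
qed (use assms in \<open>auto intro: bump_eq_0\<close>)

lemma bump_tendsto:
  "(\<lambda>n. bump (1 / real (Suc n)) a b x) \<longlonglongrightarrow> indicator {a<..<b} x"
proof (cases "x \<in> {a<..<b}")
  case True
  have *: "(\<lambda>n. exp (- 1 / (y / (1 / real (Suc n))))) \<longlonglongrightarrow> 1" if "y > 0" for y :: real
  proof -
    have "(\<lambda>n. exp ((- 1 / y) * (1 / real (Suc n)))) \<longlonglongrightarrow> exp ((- 1 / y) * 0)"
      using LIMSEQ_inverse_real_of_nat by (intro tendsto_intros) (simp add: inverse_eq_divide)
    then show ?thesis by (simp add: field_simps)
  qed
  have "(\<lambda>n. exp (- 1 / ((x - a) / (1 / real (Suc n)))) * exp (- 1 / ((b - x) / (1 / real (Suc n))))) \<longlonglongrightarrow> 1 * 1"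
    using True by (intro tendsto_mult *) auto
  then show ?thesis using True by (simp add: bump_def flat_exp_1)
next
  case False
  then show ?thesis by (simp add: bump_eq_0)
qed

lemma test_functionD:
  assumes "\<phi> \<in> test_functions"
  obtains a b where "0 < a" "a < b" "\<And>x. x \<notin> {a..b} \<Longrightarrow> \<phi> x = 0"
    "\<And>x. (\<phi> has_vector_derivative vector_derivative \<phi> (at x)) (at x)"
    "continuous_on UNIV \<phi>" "continuous_on UNIV (\<lambda>x. vector_derivative \<phi> (at x))"
    "\<And>x. x \<notin> {a..b} \<Longrightarrow> vector_derivative \<phi> (at x) = 0"
proof -
  obtain D K where D: "D 0 = \<phi>" "\<And>n x. (D n has_vector_derivative D (Suc n) x) (at x)"
    and K: "compact K" "K \<subseteq> {0<..}" "\<And>x. x \<notin> K \<Longrightarrow> \<phi> x = 0"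
    using assms by (auto simp: test_functions_def)
  obtain a b where ab: "0 < a" "a < b" "K \<subseteq> {a..b}"
  proof (cases "K = {}")
    case True
    then show ?thesis using that[of 1 2] by simp
  next
    case False
    obtain s where s: "s \<in> K" "\<And>t. t \<in> K \<Longrightarrow> s \<le> t" using compact_attains_inf[OF K(1) False] by auto
    obtain t where t: "t \<in> K" "\<And>s. s \<in> K \<Longrightarrow> s \<le> t" using compact_attains_sup[OF K(1) False] by auto
    have "s > 0" using s K by auto
    \<comment> \<open>The right end is \<open>t + 1\<close> rather than \<open>t\<close> because
      \<open>K\<close> may be a single point and the interval has to be nondegenerate.\<close>
    moreover have "s < t + 1" using s(2)[OF t(1)] by simp
    moreover have "K \<subseteq> {s..t + 1}" using s(2) t(2) by force
    ultimately show ?thesis using that by blast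
  qed
  have v: "vector_derivative \<phi> (at x) = D 1 x" for x
    using D(2)[of 0 x] D(1) by (simp add: vector_derivative_at)
  have cont: "continuous_on UNIV (D n)" for n
    using D(2) by (intro continuous_at_imp_continuous_on ballI has_vector_derivative_continuous)
  show ?thesis
  proof (rule that[OF ab(1,2)])
    show *: "\<phi> x = 0" if "x \<notin> {a..b}" for x
      using that K(3)[of x] ab(3) by blast
    show "(\<phi> has_vector_derivative vector_derivative \<phi> (at x)) (at x)" for x
      using D(2)[of 0 x] D(1) by (simp add: v)
    show "continuous_on UNIV \<phi>" "continuous_on UNIV (\<lambda>x. vector_derivative \<phi> (at x))"
      using cont[of 0] cont[of 1] D(1) by (simp_all add: v)
    show "vector_derivative \<phi> (at x) = 0" if "x \<notin> {a..b}" for x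
    proof (rule vector_derivative_at)
      have "((\<lambda>x. 0) has_vector_derivative 0) (at x)" by simp
      then show "(\<phi> has_vector_derivative 0) (at x)"
        by (rule has_vector_derivative_transform_within_open[where S="- {a..b}"])
           (use that * in \<open>auto\<close>)
    qed
  qed
qed

subsection \<open>The fundamental lemma and weak derivatives\<close>

lemma half_line_integral:
  fixes f :: "real \<Rightarrow> 'b::{banach, second_countable_topology}"
  shows "integral\<^sup>L half_line f = (\<integral>x. indicator {0<..} x *\<^sub>R f x \<partial>lborel)"
  by (simp add: half_line_def integral_restrict_space)

lemma half_line_integrable:
  fixes f :: "real \<Rightarrow> 'b::{banach, second_countable_topology}"
  shows "integrable half_line f \<longleftrightarrow> integrable lborel (\<lambda>x. indicator {0<..} x *\<^sub>R f x)"
  by (simp add: half_line_def integrable_restrict_space)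

lemma half_line_AE: "(AE x in half_line. P x) \<longleftrightarrow> (AE x in lborel. 0 < x \<longrightarrow> P x)"
  unfolding half_line_def by (subst AE_restrict_space_iff) auto

lemma half_line_measurable:
  fixes f :: "real \<Rightarrow> 'b::real_normed_vector"
  shows "f \<in> borel_measurable half_line \<longleftrightarrow> (\<lambda>x. indicator {0<..} x *\<^sub>R f x) \<in> borel_measurable borel"
  by (simp add: half_line_def borel_measurable_restrict_space_iff)

lemma continuous_half_line_measurable:
  fixes f :: "real \<Rightarrow> 'b::real_normed_vector"
  assumes "continuous_on {0<..} f"
  shows "f \<in> borel_measurable half_line"
  unfolding half_line_measurable
  by (rule borel_measurable_continuous_on_indicator) (use assms in auto)

lemma exp_decay_integrable: "k > 0 \<Longrightarrow> integrable half_line (\<lambda>x. exp (- k * x))"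
proof -
  assume k: "k > 0"
  have "set_integrable lebesgue {0..} (\<lambda>x. exp (- k * x))"
    by (rule nonnegative_absolutely_integrable_1)
       (use integrable_on_exp_minus_to_infinity[OF k, of 0] in auto)
  then have "set_integrable lebesgue {0<..} (\<lambda>x. exp (- k * x))"
    by (rule set_integrable_subset) auto
  then have "integrable lebesgue (\<lambda>x. indicator {0<..} x *\<^sub>R exp (- k * x))"
    by (simp add: set_integrable_def)
  then show ?thesis
    unfolding half_line_integrable by (subst (asm) integrable_completion) auto
qed

lemma L2_exp_decay:
  fixes g :: "real \<Rightarrow> complex"
  assumes "g \<in> borel_measurable half_line" "k > 0" "\<And>x. x > 0 \<Longrightarrow> norm (g x) \<le> C * exp (- k * x)"
  shows "g \<in> L2"
proof -
  have "(\<lambda>x. exp (- k * x)) \<in> L2"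
  proof (rule L2I)
    show "(\<lambda>x. exp (- k * x)) \<in> borel_measurable half_line"
      by (intro continuous_half_line_measurable continuous_intros)
    show "integrable half_line (\<lambda>x. (norm (exp (- k * x)))\<^sup>2)"
    proof -
      have "(norm (exp (- k * x)))\<^sup>2 = exp (- (2 * k) * x)" for x
        by (simp add: power2_eq_square mult_exp_exp)
      then show ?thesis using exp_decay_integrable[of "2 * k"] assms(2) by simp
    qed
  qed
  from L2_bound[OF this assms(1), of C] assms(3) show ?thesis by auto
qed

lemma L2_compact_support:
  fixes g :: "real \<Rightarrow> complex"
  assumes "continuous_on UNIV g" "\<And>x. x \<notin> {a..b} \<Longrightarrow> g x = 0"
  shows "g \<in> L2"
proof -
  have "compact (g ` {a..b})"
    by (intro compact_continuous_image continuous_on_subset[OF assms(1)]) auto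
  then obtain C where C: "\<And>x. x \<in> {a..b} \<Longrightarrow> norm (g x) \<le> C"
    using compact_imp_bounded bounded_iff by (metis image_eqI)
  have "norm (g x) \<le> (\<bar>C\<bar> * exp b) * exp (- 1 * x)" if "x > 0" for x
  proof (cases "x \<in> {a..b}")
    case True
    have "norm (g x) \<le> \<bar>C\<bar> * 1" using C[OF True] by simp
    also have "\<dots> \<le> \<bar>C\<bar> * exp (b - x)" using True by (intro mult_left_mono) auto
    finally show ?thesis by (simp add: exp_diff exp_minus field_simps)
  next
    case False
    then show ?thesis using assms(2) by auto
  qed
  then show ?thesis
    using assms(1) by (intro L2_exp_decay[where k=1] continuous_half_line_measurable) (auto intro: continuous_on_subset)
qed

lemma test_function_L2:
  assumes "\<phi> \<in> test_functions"
  shows "\<phi> \<in> L2" "(\<lambda>x. vector_derivative \<phi> (at x)) \<in> L2"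
  using assms by (auto elim!: test_functionD intro: L2_compact_support)

text \<open>On a bounded interval \<open>|g| \<le> 1 + |g|^2\<close> trades square integrability for
  integrability; \<open>0 \<le> a\<close> keeps the interval inside the half-line.\<close>

lemma L2_locally_integrable:
  fixes g :: "real \<Rightarrow> complex"
  assumes "g \<in> L2" "0 \<le> a"
  shows "integrable lborel (\<lambda>x. indicator {a<..<b} x *\<^sub>R g x)"
proof (rule Bochner_Integration.integrable_bound)
  show "integrable lborel (\<lambda>x. indicator {a<..<b} x + indicator {0<..} x *\<^sub>R (norm (g x))\<^sup>2)"
    using L2_integrable_norm[OF assms(1)] unfolding half_line_integrable
    by (intro Bochner_Integration.integrable_add; cases "a \<le> b") (auto simp: integrable_indicator_iff)
  have "(\<lambda>x. indicator {a<..<b} x *\<^sub>R (indicator {0<..} x *\<^sub>R g x)) \<in> borel_measurable borel"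
    using L2_measurable[OF assms(1)] unfolding half_line_measurable by measurable
  moreover have "(\<lambda>x. indicator {a<..<b} x *\<^sub>R (indicator {0<..} x *\<^sub>R g x)) = (\<lambda>x. indicator {a<..<b} x *\<^sub>R g x)"
    using assms(2) by (auto simp: indicator_def fun_eq_iff)
  ultimately show "(\<lambda>x. indicator {a<..<b} x *\<^sub>R g x) \<in> borel_measurable lborel" by simp
  have "norm (g x) \<le> 1 + (norm (g x))\<^sup>2" for x
    using zero_le_power2[of "norm (g x) - 1"] by (simp add: power2_diff) (use norm_ge_zero[of "g x"] in linarith)
  then show "AE x in lborel. norm (indicator {a<..<b} x *\<^sub>R g x)
      \<le> norm (indicator {a<..<b} x + indicator {0<..} x *\<^sub>R (norm (g x))\<^sup>2)"
    using assms(2) by (intro AE_I2) (auto simp: indicator_def)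
qed

lemma sets_borel_eq_open_intervals:
  "sets borel = sigma_sets UNIV (range (\<lambda>(a, b). {a<..<b::real}))"
proof -
  have eq: "(\<lambda>(a, b). box a b) = (\<lambda>(a, b). {a<..<b::real})" by (auto simp: fun_eq_iff)
  have "sets borel = sigma_sets UNIV (range (\<lambda>(a, b). box a b :: real set))"
    by (subst borel_eq_box) simp
  then show ?thesis unfolding eq .
qed

text \<open>A pi-lambda argument: open intervals are stable under intersection and generate the
  Borel sets, and the sets over which \<open>h\<close> integrates to 0 are closed under complements
  and disjoint unions. The complement step is where \<open>total\<close> enters.\<close>

lemma interval_integrals_zero_imp_AE_zero:
  fixes h :: "real \<Rightarrow> complex"
  assumes h: "integrable lborel h"
    and zero: "\<And>a b. a < b \<Longrightarrow> (\<integral>x. indicator {a<..<b} x *\<^sub>R h x \<partial>lborel) = 0"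
    and total: "(\<integral>x. h x \<partial>lborel) = 0"
  shows "AE x in lborel. h x = 0"
proof -
  let ?G = "range (\<lambda>(a, b). {a<..<b::real})"
  have "(LINT x:A|lborel. h x) = 0" if "A \<in> sigma_sets UNIV ?G" for A
  proof -
    have "Int_stable ?G"
    proof (rule Int_stableI_image)
      fix p q :: "real \<times> real"
      show "\<exists>r\<in>UNIV. (case p of (a, b) \<Rightarrow> {a<..<b}) \<inter> (case q of (a, b) \<Rightarrow> {a<..<b}) = (case r of (a, b) \<Rightarrow> {a<..<b})"
        by (intro bexI[of _ "(max (fst p) (fst q), min (snd p) (snd q))"]) (auto split: prod.splits)
    qed
    moreover have "?G \<subseteq> Pow UNIV" by simp
    ultimately show ?thesis using that
  proof (induction rule: sigma_sets_induct_disjoint)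
    case (basic A)
    then obtain a b where "A = {a<..<b}" by auto
    then show ?case using zero[of a b] by (cases "a < b") (auto simp: set_lebesgue_integral_def)
  next
    case empty
    then show ?case by (simp add: set_lebesgue_integral_def)
  next
    case (compl A)
    then have A: "A \<in> sets lborel" by (simp add: sets_borel_eq_open_intervals)
    have "(\<integral>x. h x \<partial>lborel) = (LINT x:A|lborel. h x) + (LINT x:UNIV - A|lborel. h x)"
    proof -
      have I: "integrable lborel (\<lambda>x. indicator A x *\<^sub>R h x)" "integrable lborel (\<lambda>x. indicator (UNIV - A) x *\<^sub>R h x)"
        using A by (auto intro!: integrable_mult_indicator h)
      show ?thesis
        unfolding set_lebesgue_integral_def
        unfolding Bochner_Integration.integral_add[OF I, symmetric]
        by (rule Bochner_Integration.integral_cong) (auto simp: indicator_def)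
    qed
    then show ?case using total compl by simp
  next
    case (union A)
    then have A: "range A \<subseteq> sets lborel" by (simp add: sets_borel_eq_open_intervals)
    have "(LINT x:(\<Union>i. A i)|lborel. h x) = (\<Sum>i. (LINT x:A i|lborel. h x))"
    proof (rule lebesgue_integral_countable_add)
      show "set_integrable lborel (\<Union> (range A)) h"
        using A h unfolding set_integrable_def by (intro integrable_mult_indicator) auto
    qed (use A union in \<open>auto simp: disjoint_family_on_def\<close>)
    then show ?case using union by simp
  qed
  qed
  then have "(LINT x:A|lborel. h x) = 0" if "A \<in> sets lborel" for A
    using that by (simp add: sets_borel_eq_open_intervals)
  then have "AE x in lborel. h x \<in> {0}"
    by (intro sigma_finite_measure.averaging_theorem[OF sigma_finite_lborel] h) auto
  then show ?thesis by simp
qed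

text \<open>Dominated convergence along bumps tending to the indicator of \<open>(a, b)\<close>
  turns the hypothesis into vanishing interval integrals. Test functions vanish near 0 and
  \<open>g\<close> need not be integrable on the whole half-line, so the conclusion is first reached
  on each \<open>(1 / (n + 1), n)\<close> and then on the countable union.\<close>

theorem fundamental_lemma_calculus_of_variations:
  assumes g: "g \<in> L2" and zero: "\<And>\<phi>. \<phi> \<in> test_functions \<Longrightarrow> (\<integral>x. g x * \<phi> x \<partial>half_line) = 0"
  shows "g \<simeq> (\<lambda>x. 0)"
proof -
  have *: "(\<integral>x. indicator {a<..<b} x *\<^sub>R g x \<partial>lborel) = 0" if "0 < a" for a b
  proof -
    let ?\<phi> = "\<lambda>n x. complex_of_real (bump (1 / real (Suc n)) a b x)"
    have eq: "indicator {0<..} x *\<^sub>R (g x * ?\<phi> n x) = indicator {a<..<b} x *\<^sub>R g x * ?\<phi> n x" for n x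
      using that by (auto simp: indicator_def bump_eq_0)
    have "(\<lambda>n. \<integral>x. indicator {0<..} x *\<^sub>R (g x * ?\<phi> n x) \<partial>lborel) \<longlonglongrightarrow>
        (\<integral>x. indicator {a<..<b} x *\<^sub>R g x \<partial>lborel)"
    proof (rule integral_dominated_convergence)
      show "integrable lborel (\<lambda>x. norm (indicator {a<..<b} x *\<^sub>R g x))"
        by (intro integrable_norm L2_locally_integrable g) (use that in auto)
      show "(\<lambda>x. indicator {a<..<b} x *\<^sub>R g x) \<in> borel_measurable lborel"
        by (intro borel_measurable_integrable L2_locally_integrable g) (use that in auto)
      have "integrable half_line (\<lambda>x. g x * ?\<phi> n x)" for n
        by (intro L2_mult_integrable g test_function_L2 bump_test_function that) auto
      then show "(\<lambda>x. indicator {0<..} x *\<^sub>R (g x * ?\<phi> n x)) \<in> borel_measurable lborel" for n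
        unfolding half_line_integrable by (rule borel_measurable_integrable)
      have "(\<lambda>n. indicator {a<..<b} x *\<^sub>R g x * ?\<phi> n x) \<longlonglongrightarrow> indicator {a<..<b} x *\<^sub>R g x * of_real (indicator {a<..<b} x)" for x
        by (intro tendsto_intros bump_tendsto)
      then show "AE x in lborel. (\<lambda>n. indicator {0<..} x *\<^sub>R (g x * ?\<phi> n x)) \<longlonglongrightarrow> indicator {a<..<b} x *\<^sub>R g x"
        unfolding eq by (intro AE_I2) (metis (no_types, lifting) indicator_simps(1) indicator_simps(2) mult.right_neutral mult_zero_left of_real_1 scaleR_zero_left)
      have "norm (indicator {a<..<b} x *\<^sub>R g x * ?\<phi> n x) \<le> norm (indicator {a<..<b} x *\<^sub>R g x)" for n x
        unfolding norm_mult using bump_nonneg[of "1 / real (Suc n)" a b x] bump_le_1[of "1 / real (Suc n)" a b x]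
        by (intro mult_left_le) auto
      then show "AE x in lborel. norm (indicator {0<..} x *\<^sub>R (g x * ?\<phi> n x)) \<le> norm (indicator {a<..<b} x *\<^sub>R g x)" for n
        unfolding eq by (intro AE_I2)
    qed
    moreover have "(\<integral>x. indicator {0<..} x *\<^sub>R (g x * ?\<phi> n x) \<partial>lborel) = 0" for n
      using zero[OF bump_test_function[OF that, of "1 / real (Suc n)" b]] unfolding half_line_integral by simp
    ultimately show ?thesis by (simp add: LIMSEQ_const_iff)
  qed
  have "AE x in lborel. indicator {1 / real (Suc n)<..<real n} x *\<^sub>R g x = 0" for n
  proof (rule interval_integrals_zero_imp_AE_zero)
    show "integrable lborel (\<lambda>x. indicator {1 / real (Suc n)<..<real n} x *\<^sub>R g x)"
      by (intro L2_locally_integrable g) auto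
    show "(\<integral>x. indicator {1 / real (Suc n)<..<real n} x *\<^sub>R g x \<partial>lborel) = 0"
      by (rule *) auto
    fix a b :: real
    have "(\<integral>x. indicator {max a (1 / real (Suc n))<..<min b (real n)} x *\<^sub>R g x \<partial>lborel) = 0"
      by (rule *) (auto simp: less_max_iff_disj)
    moreover have "(\<lambda>x. indicator {max a (1 / real (Suc n))<..<min b (real n)} x *\<^sub>R g x)
        = (\<lambda>x. indicator {a<..<b} x *\<^sub>R indicator {1 / real (Suc n)<..<real n} x *\<^sub>R g x)"
      by (auto simp: indicator_def fun_eq_iff)
    ultimately show "(\<integral>x. indicator {a<..<b} x *\<^sub>R indicator {1 / real (Suc n)<..<real n} x *\<^sub>R g x \<partial>lborel) = 0"
      by (simp only:)
  qed
  then have "AE x in lborel. \<forall>n. indicator {1 / real (Suc n)<..<real n} x *\<^sub>R g x = 0"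
    by (subst AE_all_countable) blast
  then have "AE x in lborel. 0 < x \<longrightarrow> g x = 0"
  proof eventually_elim
    case (elim x)
    show ?case
    proof
      assume "0 < x"
      obtain m where m: "1 / real (Suc m) < x"
        using reals_Archimedean[OF \<open>0 < x\<close>] by (auto simp: inverse_eq_divide)
      obtain k where k: "x < real k" using reals_Archimedean2 by blast
      let ?n = "max m k"
      have "1 / real (Suc ?n) \<le> 1 / real (Suc m)" by (intro divide_left_mono) auto
      then have "x \<in> {1 / real (Suc ?n)<..<real ?n}" using m k by auto
      then show "g x = 0" using elim[rule_format, of ?n] by simp
    qed
  qed
  then show ?thesis by (simp add: L2_eq_def half_line_AE)
qed


section \<open>Uniqueness and computation of weak derivatives\<close>

lemma is_weak_deriv_unique:
  assumes "u \<in> L2" "v \<in> L2" "u \<simeq> v" "f \<in> L2" "g \<in> L2" "is_weak_deriv u f" "is_weak_deriv v g"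
  shows "f \<simeq> g"
proof -
  have "(\<lambda>x. f x - g x) \<simeq> (\<lambda>x. 0)"
  proof (rule fundamental_lemma_calculus_of_variations)
    show "(\<lambda>x. f x - g x) \<in> L2" by (intro L2_diff assms)
    fix \<phi> assume \<phi>: "\<phi> \<in> test_functions"
    note t = test_function_L2[OF \<phi>]
    have "(\<integral>x. u x * vector_derivative \<phi> (at x) \<partial>half_line) = (\<integral>x. v x * vector_derivative \<phi> (at x) \<partial>half_line)"
    proof (rule integral_cong_AE)
      show "AE x in half_line. u x * vector_derivative \<phi> (at x) = v x * vector_derivative \<phi> (at x)"
        using assms(3) unfolding L2_eq_def by eventually_elim simp
    qed (intro borel_measurable_integrable L2_mult_integrable assms t)+
    then have "(\<integral>x. f x * \<phi> x \<partial>half_line) = (\<integral>x. g x * \<phi> x \<partial>half_line)"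
      using assms(6,7) \<phi> by (simp add: is_weak_deriv_def)
    then show "(\<integral>x. (f x - g x) * \<phi> x \<partial>half_line) = 0"
      unfolding left_diff_distrib
      by (subst Bochner_Integration.integral_diff) (auto intro: L2_mult_integrable assms t)
  qed
  then show ?thesis by (simp add: L2_eq_def)
qed

lemma weak_deriv:
  assumes "u \<in> sobolev_H1"
  shows "weak_deriv u \<in> L2" "is_weak_deriv u (weak_deriv u)"
proof -
  have "\<exists>g. g \<in> L2 \<and> is_weak_deriv u g" using assms by (auto simp: sobolev_H1_def)
  from someI_ex[OF this] show "weak_deriv u \<in> L2" "is_weak_deriv u (weak_deriv u)"
    by (simp_all add: weak_deriv_def)
qed

text \<open>\<open>weak_deriv\<close> is an arbitrary choice of representative, so an explicit
  derivative can be matched with it only almost everywhere. Allowing \<open>u\<close> to differ from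
  \<open>v\<close> on a null set makes the rule applicable again to \<open>weak_deriv u\<close>
  itself.\<close>

lemma weak_deriv_eqI:
  assumes "u \<in> L2" "v \<in> L2" "u \<simeq> v" "g \<in> L2" "is_weak_deriv v g"
  shows "u \<in> sobolev_H1" "weak_deriv u \<simeq> g"
proof -
  have "is_weak_deriv u g" unfolding is_weak_deriv_def
  proof
    fix \<phi> assume \<phi>: "\<phi> \<in> test_functions"
    note t = test_function_L2[OF \<phi>]
    have "(\<integral>x. u x * vector_derivative \<phi> (at x) \<partial>half_line) = (\<integral>x. v x * vector_derivative \<phi> (at x) \<partial>half_line)"
    proof (rule integral_cong_AE)
      show "AE x in half_line. u x * vector_derivative \<phi> (at x) = v x * vector_derivative \<phi> (at x)"
        using assms(3) unfolding L2_eq_def by eventually_elim simp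
    qed (intro borel_measurable_integrable L2_mult_integrable assms t)+
    then show "(\<integral>x. u x * vector_derivative \<phi> (at x) \<partial>half_line) = - (\<integral>x. g x * \<phi> x \<partial>half_line)"
      using assms(5) \<phi> by (simp add: is_weak_deriv_def)
  qed
  then show h1: "u \<in> sobolev_H1" using assms by (auto simp: sobolev_H1_def)
  show "weak_deriv u \<simeq> g"
    by (rule is_weak_deriv_unique[OF assms(1,2,3) weak_deriv(1)[OF h1] assms(4) weak_deriv(2)[OF h1] assms(5)])
qed

lemma is_weak_deriv_linear:
  assumes "u \<in> L2" "v \<in> L2" "f \<in> L2" "g \<in> L2" "is_weak_deriv u f" "is_weak_deriv v g"
  shows "is_weak_deriv (\<lambda>x. a * u x + b * v x) (\<lambda>x. a * f x + b * g x)"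
  unfolding is_weak_deriv_def
proof
  fix \<phi> assume \<phi>: "\<phi> \<in> test_functions"
  note t = test_function_L2[OF \<phi>]
  let ?d = "\<lambda>x. vector_derivative \<phi> (at x)"
  have lin: "(\<integral>x. (a * p x + b * q x) * r x \<partial>half_line) =
      a * (\<integral>x. p x * r x \<partial>half_line) + b * (\<integral>x. q x * r x \<partial>half_line)"
    if "p \<in> L2" "q \<in> L2" "r \<in> L2" for p q r :: "real \<Rightarrow> complex"
    using that by (simp add: distrib_right mult.assoc L2_mult_integrable)
  show "(\<integral>x. (a * u x + b * v x) * ?d x \<partial>half_line) = - (\<integral>x. (a * f x + b * g x) * \<phi> x \<partial>half_line)"
    using assms(5,6) \<phi> by (simp add: lin assms t is_weak_deriv_def)
qed

lemma has_vector_derivative_imp_is_weak_deriv: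
  assumes deriv: "\<And>x. x > 0 \<Longrightarrow> (u has_vector_derivative u' x) (at x)"
    and cont: "continuous_on {0<..} u'"
  shows "is_weak_deriv u u'"
  unfolding is_weak_deriv_def
proof
  fix \<phi> assume \<phi>: "\<phi> \<in> test_functions"
  let ?d = "\<lambda>x. vector_derivative \<phi> (at x)"
  obtain a b where ab: "0 < a" "a < b" "\<And>x. x \<notin> {a..b} \<Longrightarrow> \<phi> x = 0"
    and d: "\<And>x. (\<phi> has_vector_derivative ?d x) (at x)"
    and c: "continuous_on UNIV \<phi>" "continuous_on UNIV ?d"
    and z: "\<And>x. x \<notin> {a..b} \<Longrightarrow> ?d x = 0"
    using test_functionD[OF \<phi>] by metis
  \<comment> \<open>These endpoints lie outside the support \<open>[a, b]\<close>, so the boundary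
    terms of the integration by parts vanish; \<open>a / 2\<close> is still inside the
    half-line.\<close>
  let ?a = "a / 2" and ?b = "b + 1"
  have ne: "\<phi> ?a = 0" "\<phi> ?b = 0" using ab by auto
  have uc: "continuous_on {?a..?b} u" "continuous_on {?a..?b} u'"
    using ab deriv by (auto intro!: continuous_at_imp_continuous_on has_vector_derivative_continuous[OF deriv]
        continuous_on_subset[OF cont])
  have I: "integrable lborel (\<lambda>x. indicator {?a..?b} x *\<^sub>R (u x * ?d x))"
       "integrable lborel (\<lambda>x. indicator {?a..?b} x *\<^sub>R (u' x * \<phi> x))"
    using uc c by (auto intro!: borel_integrable_compact continuous_intros intro: continuous_on_subset)
  have "(\<integral>x. indicator {?a..?b} x *\<^sub>R (u x * ?d x + u' x * \<phi> x) \<partial>lborel) = u ?b * \<phi> ?b - u ?a * \<phi> ?a"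
  proof (rule integral_FTC_Icc)
    show "?a \<le> ?b" using ab by simp
    show "((\<lambda>x. u x * \<phi> x) has_vector_derivative u x * ?d x + u' x * \<phi> x) (at x within {?a..?b})"
      if "?a \<le> x" "x \<le> ?b" for x
      by (rule has_vector_derivative_at_within[OF has_vector_derivative_mult[OF deriv d]])
         (use that ab in auto)
    show "continuous_on {?a..?b} (\<lambda>x. u x * ?d x + u' x * \<phi> x)"
      using uc c by (auto intro!: continuous_intros intro: continuous_on_subset)
  qed
  then have "(\<integral>x. indicator {?a..?b} x *\<^sub>R (u x * ?d x) \<partial>lborel) = - (\<integral>x. indicator {?a..?b} x *\<^sub>R (u' x * \<phi> x) \<partial>lborel)"
    using I ne by (simp add: scaleR_add_right eq_neg_iff_add_eq_0)
  moreover have "indicator {?a..?b} x *\<^sub>R (u x * ?d x) = indicator {0<..} x *\<^sub>R (u x * ?d x)"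
      "indicator {?a..?b} x *\<^sub>R (u' x * \<phi> x) = indicator {0<..} x *\<^sub>R (u' x * \<phi> x)" for x
    using ab(1,2) ab(3)[of x] z[of x] by (cases "x \<in> {a..b}"; auto simp: indicator_def)+
  ultimately show "(\<integral>x. u x * ?d x \<partial>half_line) = - (\<integral>x. u' x * \<phi> x \<partial>half_line)"
    by (simp add: half_line_integral)
qed

subsection \<open>The star-graph operator is linear\<close>

lemma sobolev_H1_L2: "u \<in> sobolev_H1 \<Longrightarrow> u \<in> L2"
  by (simp add: sobolev_H1_def)

lemma sobolev_H1_cong:
  assumes "u \<in> L2" "v \<in> sobolev_H1" "u \<simeq> v"
  shows "u \<in> sobolev_H1" "weak_deriv u \<simeq> weak_deriv v"
  using weak_deriv_eqI[OF assms(1) sobolev_H1_L2[OF assms(2)] assms(3) weak_deriv[OF assms(2)]] by auto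

lemma L2_linear_scalar:
  fixes u v :: "real \<Rightarrow> complex"
  shows "u \<in> L2 \<Longrightarrow> v \<in> L2 \<Longrightarrow> (\<lambda>x. a * u x + b * v x) \<in> L2"
  by (intro L2_add L2_mult)

lemma L2_linear:
  fixes u v :: "real \<Rightarrow> complex^'n"
  shows "u \<in> L2 \<Longrightarrow> v \<in> L2 \<Longrightarrow> (\<lambda>x. a *s u x + b *s v x) \<in> L2"
  by (intro L2_add L2_smult)

lemma sobolev_H1_linear:
  assumes "u \<in> sobolev_H1" "v \<in> sobolev_H1"
  shows "(\<lambda>x. a * u x + b * v x) \<in> sobolev_H1"
    "weak_deriv (\<lambda>x. a * u x + b * v x) \<simeq> (\<lambda>x. a * weak_deriv u x + b * weak_deriv v x)"
proof -
  note L = assms[THEN sobolev_H1_L2] and W = assms[THEN weak_deriv(1)] and w = assms[THEN weak_deriv(2)]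
  note * = weak_deriv_eqI[OF L2_linear_scalar[OF L] L2_linear_scalar[OF L] L2_eq_refl L2_linear_scalar[OF W]
     is_weak_deriv_linear[OF L W w]]
  show "(\<lambda>x. a * u x + b * v x) \<in> sobolev_H1"
    "weak_deriv (\<lambda>x. a * u x + b * v x) \<simeq> (\<lambda>x. a * weak_deriv u x + b * weak_deriv v x)"
    by (rule *)+
qed

lemma sobolev_H2D:
  assumes "u \<in> sobolev_H2"
  shows "u \<in> L2" "u \<in> sobolev_H1" "weak_deriv u \<in> sobolev_H1" "weak_deriv u \<in> L2"
    "weak_deriv (weak_deriv u) \<in> L2"
  using assms by (auto simp: sobolev_H2_def intro: sobolev_H1_L2 weak_deriv)

text \<open>The first weak derivative of the combination equals the combination of weak derivatives
  only almost everywhere, so it is replaced through \<open>sobolev_H1_cong\<close> before it is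
  differentiated again.\<close>

lemma sobolev_H2_linear:
  assumes "u \<in> sobolev_H2" "v \<in> sobolev_H2"
  shows "(\<lambda>x. a * u x + b * v x) \<in> sobolev_H2"
    "weak_deriv (\<lambda>x. a * u x + b * v x) \<simeq> (\<lambda>x. a * weak_deriv u x + b * weak_deriv v x)"
    "weak_deriv (weak_deriv (\<lambda>x. a * u x + b * v x)) \<simeq>
      (\<lambda>x. a * weak_deriv (weak_deriv u) x + b * weak_deriv (weak_deriv v) x)"
proof -
  note u = sobolev_H2D[OF assms(1)] and v = sobolev_H2D[OF assms(2)]
  note w = sobolev_H1_linear[OF u(2) v(2), of a b]
  note w' = sobolev_H1_linear[OF u(3) v(3), of a b]
  note w'' = sobolev_H1_cong[OF weak_deriv(1)[OF w(1)] w'(1) w(2)]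
  show "(\<lambda>x. a * u x + b * v x) \<in> sobolev_H2"
    using w w'' by (auto simp: sobolev_H2_def)
  show "weak_deriv (\<lambda>x. a * u x + b * v x) \<simeq> (\<lambda>x. a * weak_deriv u x + b * weak_deriv v x)"
    by (rule w(2))
  show "weak_deriv (weak_deriv (\<lambda>x. a * u x + b * v x)) \<simeq>
      (\<lambda>x. a * weak_deriv (weak_deriv u) x + b * weak_deriv (weak_deriv v) x)"
    by (rule L2_eq_trans[OF w''(2) w'(2)])
qed

lemma sobolev_H2I_classical:
  assumes "\<And>x. x > 0 \<Longrightarrow> (u has_vector_derivative u' x) (at x)"
    and "\<And>x. x > 0 \<Longrightarrow> (u' has_vector_derivative u'' x) (at x)"
    and "continuous_on {0<..} u''" and "u \<in> L2" "u' \<in> L2" "u'' \<in> L2"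
  shows "u \<in> sobolev_H2" "weak_deriv u \<simeq> u'" "weak_deriv (weak_deriv u) \<simeq> u''"
proof -
  have "continuous_on {0<..} u'"
    using assms(2) by (auto intro!: continuous_at_imp_continuous_on has_vector_derivative_continuous)
  then have "is_weak_deriv u u'" "is_weak_deriv u' u''"
    using assms by (auto intro: has_vector_derivative_imp_is_weak_deriv)
  then have a: "u \<in> sobolev_H1" "weak_deriv u \<simeq> u'" "u' \<in> sobolev_H1" "weak_deriv u' \<simeq> u''"
    using weak_deriv_eqI[OF assms(4) assms(4) L2_eq_refl assms(5)]
      weak_deriv_eqI[OF assms(5) assms(5) L2_eq_refl assms(6)] by auto
  note b = sobolev_H1_cong[OF weak_deriv(1)[OF a(1)] a(3) a(2)]
  show "u \<in> sobolev_H2" "weak_deriv u \<simeq> u'" "weak_deriv (weak_deriv u) \<simeq> u''"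
    using a b L2_eq_trans by (auto simp: sobolev_H2_def)
qed

lemma vertex_value_cong: "vertex_value v c \<Longrightarrow> u \<simeq> v \<Longrightarrow> vertex_value u c"
  unfolding vertex_value_def using L2_eq_trans L2_eq_sym by blast

lemma vertex_value_linear:
  assumes "vertex_value u c" "vertex_value v d"
  shows "vertex_value (\<lambda>x. a * u x + b * v x) (a * c + b * d)"
proof -
  obtain u' v' where "continuous_on {0..} u'" "u' \<simeq> u" "u' 0 = c" "continuous_on {0..} v'" "v' \<simeq> v" "v' 0 = d"
    using assms by (auto simp: vertex_value_def)
  then show ?thesis unfolding vertex_value_def
    by (intro exI[of _ "\<lambda>x. a * u' x + b * v' x"])
       (auto intro!: continuous_intros L2_eq_add L2_eq_comp[where f="\<lambda>_ y. a * y"] L2_eq_comp[where f="\<lambda>_ y. b * y"])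
qed

lemma L2_eq_vecI:
  fixes u v :: "real \<Rightarrow> complex^'n"
  assumes "\<And>j. edge u j \<simeq> edge v j"
  shows "u \<simeq> v"
proof -
  have "AE x in half_line. \<forall>j. u x $ j = v x $ j"
    using assms by (intro eventually_all_finite) (simp add: L2_eq_def edge_def)
  then show ?thesis unfolding L2_eq_def by eventually_elim (simp add: vec_eq_iff)
qed

lemma edge_linear: "edge (\<lambda>x. a *s u x + b *s v x) j = (\<lambda>x. a * edge u j x + b * edge v j x)"
  by (simp add: edge_def)

lemma edge_star_op: "edge (star_op u) j = (\<lambda>x. - weak_deriv (weak_deriv (edge u j)) x)"
  by (simp add: edge_def star_op_def)

lemma star_op_L2:
  assumes "u \<in> star_dom \<alpha>" shows "star_op u \<in> L2"
  by (intro L2_vecI) (use assms in \<open>auto simp: edge_star_op star_dom_def intro!: L2_uminus sobolev_H2D(5)\<close>)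

text \<open>Polarizing the form \<open><Tu, u>\<close> requires a linear domain and an operator that
  is linear up to null sets. The vertex conditions are linear in the boundary data \<open>c\<close>
  and \<open>d\<close>, so these witnesses combine linearly.\<close>

lemma star_dom_linear:
  fixes u v :: "real \<Rightarrow> complex^'n"
  assumes "u \<in> star_dom \<alpha>" "v \<in> star_dom \<alpha>"
  shows "(\<lambda>x. a *s u x + b *s v x) \<in> star_dom \<alpha>"
    "star_op (\<lambda>x. a *s u x + b *s v x) \<simeq> (\<lambda>x. a *s star_op u x + b *s star_op v x)"
proof -
  have H: "edge u j \<in> sobolev_H2" "edge v j \<in> sobolev_H2" for j
    using assms by (simp_all add: star_dom_def)
  note * = sobolev_H2_linear[OF H, of a _ b]
  obtain c d where cd: "\<And>j. vertex_value (edge u j) c" "\<And>j. vertex_value (weak_deriv (edge u j)) (d j)"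
       "(\<Sum>j\<in>UNIV. d j) = of_real \<alpha> * c"
    using assms(1) by (auto simp: star_dom_def)
  obtain c' d' where cd': "\<And>j. vertex_value (edge v j) c'" "\<And>j. vertex_value (weak_deriv (edge v j)) (d' j)"
       "(\<Sum>j\<in>UNIV. d' j) = of_real \<alpha> * c'"
    using assms(2) by (auto simp: star_dom_def)
  have 1: "vertex_value (edge (\<lambda>x. a *s u x + b *s v x) j) (a * c + b * c')" for j
    unfolding edge_linear by (intro vertex_value_linear cd cd')
  have 2: "vertex_value (weak_deriv (edge (\<lambda>x. a *s u x + b *s v x) j)) (a * d j + b * d' j)" for j
    unfolding edge_linear by (rule vertex_value_cong[OF vertex_value_linear *(2)]) (intro cd cd')+
  have 3: "(\<Sum>j\<in>UNIV. a * d j + b * d' j) = of_real \<alpha> * (a * c + b * c')"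
    by (simp add: sum.distrib flip: sum_distrib_left) (simp add: cd cd' algebra_simps)
  have 4: "edge (\<lambda>x. a *s u x + b *s v x) j \<in> sobolev_H2" for j
    unfolding edge_linear by (rule *)
  show "(\<lambda>x. a *s u x + b *s v x) \<in> star_dom \<alpha>"
    unfolding star_dom_def mem_Collect_eq
    by (intro conjI allI 4 exI[of _ "a * c + b * c'"] exI[of _ "\<lambda>j. a * d j + b * d' j"] 1 2 3)
  show "star_op (\<lambda>x. a *s u x + b *s v x) \<simeq> (\<lambda>x. a *s star_op u x + b *s star_op v x)"
  proof (rule L2_eq_vecI)
    fix j
    show "edge (star_op (\<lambda>x. a *s u x + b *s v x)) j \<simeq> edge (\<lambda>x. a *s star_op u x + b *s star_op v x) j"
      using L2_eq_comp[OF *(3)[of j], where f="\<lambda>_ y. - y"]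
      by (simp add: edge_star_op edge_linear)
  qed
qed

subsection \<open>Spectral measures\<close>

text \<open>Linearity is added to the spectral measure so that the quadratic form can be polarized;
  the symmetry of \<open>T\<close> is then derived in \<open>T_hermitian\<close>.\<close>

locale spectral_resolution =
  fixes D :: "(real \<Rightarrow> complex^'n) set" and T E
  assumes spectral: "is_spectral_measure D T E"
    and D_linear: "u \<in> D \<Longrightarrow> v \<in> D \<Longrightarrow> (\<lambda>x. a *s u x + b *s v x) \<in> D"
    and T_linear: "u \<in> D \<Longrightarrow> v \<in> D \<Longrightarrow> T (\<lambda>x. a *s u x + b *s v x) \<simeq> (\<lambda>x. a *s T u x + b *s T v x)"
    and T_L2: "u \<in> D \<Longrightarrow> T u \<in> L2"
begin

lemma pvm: "projection_valued_measure E"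
  using spectral by (simp add: is_spectral_measure_def)

lemma proj: "A \<in> sets borel \<Longrightarrow> L2_projection (E A)"
  using pvm by (simp add: projection_valued_measure_def)

context
  fixes A :: "real set" assumes A: "A \<in> sets borel"
begin

lemma E_L2: "u \<in> L2 \<Longrightarrow> E A u \<in> L2"
  and E_cong: "u \<in> L2 \<Longrightarrow> v \<in> L2 \<Longrightarrow> u \<simeq> v \<Longrightarrow> E A u \<simeq> E A v"
  and E_add: "u \<in> L2 \<Longrightarrow> v \<in> L2 \<Longrightarrow> E A (\<lambda>x. u x + v x) \<simeq> (\<lambda>x. E A u x + E A v x)"
  and E_smult: "u \<in> L2 \<Longrightarrow> E A (\<lambda>x. c *s u x) \<simeq> (\<lambda>x. c *s E A u x)"
  and E_idem: "u \<in> L2 \<Longrightarrow> E A (E A u) \<simeq> E A u"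
  and E_sym: "u \<in> L2 \<Longrightarrow> v \<in> L2 \<Longrightarrow> L2_inner (E A u) v = L2_inner u (E A v)"
  using proj[OF A] unfolding L2_projection_def by blast+

lemma E_linear:
  assumes "u \<in> L2" "v \<in> L2"
  shows "E A (\<lambda>x. a *s u x + b *s v x) \<simeq> (\<lambda>x. a *s E A u x + b *s E A v x)"
  by (rule L2_eq_trans[OF E_add L2_eq_add[OF E_smult E_smult]]) (auto intro: L2_smult assms)

lemma inner_E_self: "u \<in> L2 \<Longrightarrow> L2_inner (E A u) u = of_real ((L2_norm (E A u))\<^sup>2)"
  using L2_inner_cong[OF E_idem L2_eq_refl, of u u] E_sym[of "E A u" u] E_L2
  by (simp add: L2_inner_self)

end

lemma E_empty: "u \<in> L2 \<Longrightarrow> E {} u \<simeq> (\<lambda>x. 0)"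
  and E_UNIV: "u \<in> L2 \<Longrightarrow> E UNIV u \<simeq> u"
  and E_inter: "A \<in> sets borel \<Longrightarrow> B \<in> sets borel \<Longrightarrow> u \<in> L2 \<Longrightarrow> E (A \<inter> B) u \<simeq> E A (E B u)"
  and E_countable: "range F \<subseteq> sets borel \<Longrightarrow> disjoint_family F \<Longrightarrow> u \<in> L2 \<Longrightarrow>
    (\<lambda>n. L2_norm (\<lambda>x. E (\<Union>i. F i) u x - (\<Sum>i<n. E (F i) u x))) \<longlonglongrightarrow> 0"
  using pvm unfolding projection_valued_measure_def by blast+

abbreviation \<mu> where "\<mu> u \<equiv> spectral_distribution E u"

lemma sets_\<mu> [simp, measurable_cong]: "sets (\<mu> u) = sets borel"
  and space_\<mu> [simp]: "space (\<mu> u) = UNIV"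
  unfolding spectral_distribution_def
  by (simp_all add: sets.sigma_sets_eq[of borel, simplified])

text \<open>Norm convergence of the partial sums passes to the form by Cauchy-Schwarz against the
  fixed vector \<open>u\<close>.\<close>

lemma E_sums:
  assumes F: "range F \<subseteq> sets borel" "disjoint_family F" and u: "u \<in> L2"
  shows "(\<lambda>i. Re (L2_inner (E (F i) u) u)) sums Re (L2_inner (E (\<Union>i. F i) u) u)"
proof -
  let ?U = "\<Union>i. F i"
  have U: "?U \<in> sets borel" and Fi: "F i \<in> sets borel" for i using F by auto
  have S: "(\<lambda>x. \<Sum>i<n. E (F i) u x) \<in> L2" for n
    by (intro L2_sum E_L2 Fi u)
  have Sinner: "L2_inner (\<lambda>x. \<Sum>i<n. E (F i) u x) u = (\<Sum>i<n. L2_inner (E (F i) u) u)" for n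
  proof (induction n)
    case 0
    then show ?case by (simp add: L2_inner_zero)
  next
    case (Suc n)
    then show ?case using L2_inner_add_left[OF S[of n] E_L2[OF Fi[of n] u] u] by simp
  qed
  have diff: "Re (L2_inner (E ?U u) u) - (\<Sum>i<n. Re (L2_inner (E (F i) u) u)) =
      Re (L2_inner (\<lambda>x. E ?U u x - (\<Sum>i<n. E (F i) u x)) u)" for n
  proof -
    have "L2_inner (\<lambda>x. E ?U u x - (\<Sum>i<n. E (F i) u x)) u =
       L2_inner (E ?U u) u - L2_inner (\<lambda>x. \<Sum>i<n. E (F i) u x) u"
      using L2_inner_add_left[OF L2_diff[OF E_L2[OF U u] S[of n]] S[of n] u] by simp
    then show ?thesis by (simp add: Sinner)
  qed
  have "(\<lambda>n. Re (L2_inner (E ?U u) u) - (\<Sum>i<n. Re (L2_inner (E (F i) u) u))) \<longlonglongrightarrow> 0"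
  proof (rule Lim_null_comparison)
    show "(\<lambda>n. L2_norm (\<lambda>x. E ?U u x - (\<Sum>i<n. E (F i) u x)) * L2_norm u) \<longlonglongrightarrow> 0"
      using tendsto_mult_right[OF E_countable[OF F u], of "L2_norm u"] by simp
    show "\<forall>\<^sub>F n in sequentially. norm (Re (L2_inner (E ?U u) u) - (\<Sum>i<n. Re (L2_inner (E (F i) u) u)))
       \<le> L2_norm (\<lambda>x. E ?U u x - (\<Sum>i<n. E (F i) u x)) * L2_norm u"
      unfolding diff using L2_Cauchy_Schwarz[OF L2_diff[OF E_L2[OF U u] S] u] by simp
  qed
  from tendsto_diff[OF tendsto_const[of "Re (L2_inner (E ?U u) u)"] this]
  show ?thesis by (simp add: sums_def)
qed

text \<open>\<open>measure_of\<close> yields the zero measure unless its set function is positive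
  and countably additive, so both properties must be established before the spectral distribution
  has its intended values.\<close>

lemma emeasure_\<mu>:
  assumes u: "u \<in> L2" and A: "A \<in> sets borel"
  shows "emeasure (\<mu> u) A = ennreal ((L2_norm (E A u))\<^sup>2)"
proof -
  have nn: "Re (L2_inner (E B u) u) \<ge> 0" if "B \<in> sets borel" for B
    using inner_E_self[OF that u] by simp
  have "emeasure (\<mu> u) A = ennreal (Re (L2_inner (E A u) u))"
  proof (rule emeasure_measure_of[OF spectral_distribution_def])
    show "positive (sets (\<mu> u)) (\<lambda>A. ennreal (Re (L2_inner (E A u) u)))"
      using L2_inner_cong[OF E_empty[OF u] L2_eq_refl E_L2[OF _ u] u L2_zero u]
      by (auto simp: positive_def L2_inner_zero)
    show "countably_additive (sets (\<mu> u)) (\<lambda>A. ennreal (Re (L2_inner (E A u) u)))"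
    proof (rule countably_additiveI)
      fix F :: "nat \<Rightarrow> real set"
      assume F: "range F \<subseteq> sets (\<mu> u)" "disjoint_family F"
      then have "range F \<subseteq> sets borel" by simp
      moreover from this have "Re (L2_inner (E (F i) u) u) \<ge> 0" for i by (intro nn) auto
      ultimately show "(\<Sum>i. ennreal (Re (L2_inner (E (F i) u) u))) = ennreal (Re (L2_inner (E (\<Union> (range F)) u) u))"
        using F(2) by (intro suminf_ennreal_eq E_sums u) auto
    qed
  qed (use A in auto)
  then show ?thesis using inner_E_self[OF A u] by simp
qed

lemma finite_\<mu>: "u \<in> L2 \<Longrightarrow> finite_measure (\<mu> u)"
  by (rule finite_measureI) (simp add: emeasure_\<mu>)

lemma measure_\<mu>: "u \<in> L2 \<Longrightarrow> A \<in> sets borel \<Longrightarrow> measure (\<mu> u) A = (L2_norm (E A u))\<^sup>2"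
  by (simp add: measure_def emeasure_\<mu>)

lemma measure_\<mu>_UNIV: "u \<in> L2 \<Longrightarrow> measure (\<mu> u) UNIV = (L2_norm u)\<^sup>2"
  using L2_norm_cong[OF E_UNIV, of u] by (simp add: measure_\<mu> E_L2)

lemma D_eq: "D = {u \<in> L2. integrable (\<mu> u) (\<lambda>t. t\<^sup>2)}"
  and T_inner_self: "u \<in> D \<Longrightarrow> L2_inner (T u) u = of_real (\<integral>t. t \<partial>\<mu> u)"
  using spectral by (auto simp: is_spectral_measure_def)

lemma D_L2: "u \<in> D \<Longrightarrow> u \<in> L2"
  by (simp add: D_eq)

lemma integrable_id_\<mu>: "u \<in> D \<Longrightarrow> integrable (\<mu> u) (\<lambda>t. t)"
proof (rule Bochner_Integration.integrable_bound)
  assume u: "u \<in> D"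
  interpret finite_measure "\<mu> u" by (rule finite_\<mu>[OF D_L2[OF u]])
  show "integrable (\<mu> u) (\<lambda>t. 1 + t\<^sup>2)" using u by (simp add: D_eq)
  have "\<bar>t\<bar> \<le> 1 + t\<^sup>2" for t :: real
    using zero_le_power2[of "\<bar>t\<bar> - 1"] by (simp add: power2_diff) 
  then show "AE t in \<mu> u. norm t \<le> norm (1 + t\<^sup>2)" by (intro AE_I2) simp
qed simp

lemma add_smult_D:
  assumes "u \<in> D" "v \<in> D"
  shows "(\<lambda>x. u x + c *s v x) \<in> D" "T (\<lambda>x. u x + c *s v x) \<simeq> (\<lambda>x. T u x + c *s T v x)"
  using D_linear[OF assms, of 1 c] T_linear[OF assms, of 1 c] by simp_all

lemma T_inner_add_smult:
  assumes "u \<in> D" "v \<in> D"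
  shows "L2_inner (T (\<lambda>x. u x + c *s v x)) (\<lambda>x. u x + c *s v x) =
     L2_inner (T u) u + cnj c * L2_inner (T u) v + c * L2_inner (T v) u + c * cnj c * L2_inner (T v) v"
proof -
  note L = assms[THEN D_L2] assms[THEN T_L2]
  have "L2_inner (T (\<lambda>x. u x + c *s v x)) (\<lambda>x. u x + c *s v x) =
      L2_inner (\<lambda>x. T u x + c *s T v x) (\<lambda>x. u x + c *s v x)"
    by (intro L2_inner_cong add_smult_D assms T_L2 L2_add L2_smult L L2_eq_refl)
  also have "\<dots> = L2_inner (T u) u + cnj c * L2_inner (T u) v + c * L2_inner (T v) u + c * cnj c * L2_inner (T v) v"
    using L by (simp add: L2_inner_add_left L2_inner_add_right L2_inner_smult_left L2_inner_smult_right
        L2_smult L2_add algebra_simps)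
  finally show ?thesis .
qed

text \<open>The form is real on \<open>D\<close>, being an integral of \<open>t\<close>. Reality at
  \<open>u + v\<close> controls the imaginary parts of the cross terms, reality at
  \<open>u + i v\<close> the real parts.\<close>

lemma T_hermitian:
  assumes "u \<in> D" "v \<in> D"
  shows "L2_inner (T v) u = cnj (L2_inner (T u) v)"
proof -
  have real: "Im (L2_inner (T w) w) = 0" if "w \<in> D" for w
    using T_inner_self[OF that] by simp
  have "Im (L2_inner (T u) v) + Im (L2_inner (T v) u) = 0"
    using real[OF add_smult_D(1)[OF assms, of 1]] real[OF assms(1)] real[OF assms(2)]
    unfolding T_inner_add_smult[OF assms] by simp
  moreover have "Re (L2_inner (T v) u) - Re (L2_inner (T u) v) = 0"
    using real[OF add_smult_D(1)[OF assms, of \<i>]] real[OF assms(1)] real[OF assms(2)]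
    unfolding T_inner_add_smult[OF assms] by simp
  ultimately show ?thesis by (simp add: complex_eq_iff)
qed

lemma Re_T_inner_add:
  assumes "u \<in> D" "v \<in> D"
  shows "Re (L2_inner (T (\<lambda>x. u x + of_real s *s v x)) (\<lambda>x. u x + of_real s *s v x)) =
     Re (L2_inner (T u) u) + 2 * s * Re (L2_inner (T u) v) + s\<^sup>2 * Re (L2_inner (T v) v)"
  unfolding T_inner_add_smult[OF assms] T_hermitian[OF assms]
  by (simp add: power2_eq_square)

end

text \<open>Additivity of the integral in the measure, used to split integrals against the spectral
  distribution of a sum of two vectors from complementary spectral subspaces.\<close>

lemma nn_integral_add_measure:
  assumes sets: "sets M = sets M1" "sets M = sets M2"
    and add: "\<And>A. A \<in> sets M \<Longrightarrow> emeasure M A = emeasure M1 A + emeasure M2 A"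
    and f: "f \<in> borel_measurable M"
  shows "(\<integral>\<^sup>+x. f x \<partial>M) = (\<integral>\<^sup>+x. f x \<partial>M1) + (\<integral>\<^sup>+x. f x \<partial>M2)"
  using f
proof induction
  case (cong f g)
  have "space M1 = space M" "space M2 = space M" using sets sets_eq_imp_space_eq by metis+
  then have "(\<integral>\<^sup>+x. f x \<partial>N) = (\<integral>\<^sup>+x. g x \<partial>N)" if "N \<in> {M, M1, M2}" for N
    using that cong by (intro nn_integral_cong) auto
  then show ?case using cong by simp
next
  case (set A)
  then show ?case using sets add by simp
next
  case (mult u c)
  then have "u \<in> borel_measurable M1" "u \<in> borel_measurable M2"
    using sets measurable_cong_sets by blast+
  then show ?case using mult by (simp add: nn_integral_cmult distrib_left)
next
  case (add u v)
  then have "u \<in> borel_measurable M1" "u \<in> borel_measurable M2" "v \<in> borel_measurable M1" "v \<in> borel_measurable M2"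
    using sets measurable_cong_sets by blast+
  then show ?case using add by (simp add: nn_integral_add algebra_simps)
next
  case (seq U)
  then have m: "U i \<in> borel_measurable M" "U i \<in> borel_measurable M1" "U i \<in> borel_measurable M2" for i
    using sets measurable_cong_sets by blast+
  have "(\<integral>\<^sup>+x. (SUP i. U i) x \<partial>N) = (SUP i. \<integral>\<^sup>+x. U i x \<partial>N)" if "\<And>i. U i \<in> borel_measurable N" for N
    unfolding SUP_apply using seq(3) that by (intro nn_integral_monotone_convergence_SUP) auto
  moreover have "incseq (\<lambda>i. \<integral>\<^sup>+x. U i x \<partial>N)" for N
    using seq(3) by (auto intro!: monoI nn_integral_mono simp: incseq_def le_fun_def)
  ultimately show ?case
    using m seq by (simp add: ennreal_SUP_add)
qed

lemma integral_add_measure: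
  fixes f :: "'a \<Rightarrow> real"
  assumes sets: "sets M = sets M1" "sets M = sets M2"
    and add: "\<And>A. A \<in> sets M \<Longrightarrow> emeasure M A = emeasure M1 A + emeasure M2 A"
    and f: "integrable M f" "integrable M1 f" "integrable M2 f"
  shows "(\<integral>x. f x \<partial>M) = (\<integral>x. f x \<partial>M1) + (\<integral>x. f x \<partial>M2)"
proof -
  have "(\<integral>\<^sup>+x. g x \<partial>M) = (\<integral>\<^sup>+x. g x \<partial>M1) + (\<integral>\<^sup>+x. g x \<partial>M2)"
    if "g \<in> borel_measurable M" for g
    by (rule nn_integral_add_measure[OF sets add that])
  moreover have "f \<in> borel_measurable M" using f by simp
  moreover have "(\<integral>\<^sup>+x. ennreal (f x) \<partial>N) < top" "(\<integral>\<^sup>+x. ennreal (- f x) \<partial>N) < top" if "integrable N f" for N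
    using that by (auto simp: real_integrable_def less_top)
  ultimately show ?thesis
    using f by (simp add: real_lebesgue_integral_def enn2real_plus)
qed

context spectral_resolution begin

text \<open>\<open>E A\<close> commutes with \<open>E I\<close>, so \<open>E A u\<close> is still
  annihilated by \<open>E I\<close>. Hence \<open>E A u\<close> and \<open>E A v\<close> are
  orthogonal and Pythagoras applies.\<close>

lemma \<mu>_add_orthogonal:
  assumes u: "u \<in> L2" and v: "v \<in> L2" and I: "I \<in> sets borel"
    and Iu: "E I u \<simeq> (\<lambda>x. 0)" and Iv: "E I v \<simeq> v" and A: "A \<in> sets borel"
  shows "emeasure (\<mu> (\<lambda>x. u x + v x)) A = emeasure (\<mu> u) A + emeasure (\<mu> v) A"
proof -
  note EL = E_L2[OF A u] E_L2[OF A v]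
  have "E A (E I u) \<simeq> E I (E A u)"
    using E_inter[OF A I u] E_inter[OF I A u] by (auto simp: Int_commute intro: L2_eq_trans L2_eq_sym)
  moreover have "E A (E I u) \<simeq> (\<lambda>x. 0)"
  proof -
    have "E A (\<lambda>x. 0 *s u x) \<simeq> (\<lambda>x. 0 *s E A u x)" by (rule E_smult[OF A u])
    then have "E A (\<lambda>x. 0) \<simeq> (\<lambda>x. 0)" by simp
    then show ?thesis using E_cong[OF A E_L2[OF I u] L2_zero Iu] L2_eq_trans by blast
  qed
  ultimately have z: "E I (E A u) \<simeq> (\<lambda>x. 0)" using L2_eq_trans L2_eq_sym by blast
  have "L2_inner (E A u) (E A v) = L2_inner (E A (E A u)) v"
    by (rule E_sym[OF A EL(1) v, symmetric])
  also have "\<dots> = L2_inner (E A u) (E I v)"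
    by (intro L2_inner_cong E_idem A u E_L2 EL v I L2_eq_sym[OF Iv])
  also have "\<dots> = L2_inner (E I (E A u)) v"
    by (rule E_sym[OF I EL(1) v, symmetric])
  also have "\<dots> = 0"
    using L2_inner_cong[OF z L2_eq_refl E_L2[OF I EL(1)] v L2_zero v] by (simp add: L2_inner_zero)
  finally have orth: "L2_inner (E A u) (E A v) = 0" .
  have "L2_norm (E A (\<lambda>x. u x + v x)) = L2_norm (\<lambda>x. E A u x + E A v x)"
    by (intro L2_norm_cong E_add A u v E_L2 L2_add)
  then have "(L2_norm (E A (\<lambda>x. u x + v x)))\<^sup>2 = (L2_norm (E A u))\<^sup>2 + (L2_norm (E A v))\<^sup>2"
    using L2_norm_add_sq[OF EL] orth by simp
  then show ?thesis
    by (simp add: emeasure_\<mu> A u v L2_add flip: ennreal_plus)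
qed

text \<open>The spectral distribution of \<open>u + v\<close> is the sum of the two, so the form is
  additive here and the cross term in its expansion must vanish. This replaces commutation of
  \<open>T\<close> with \<open>E I\<close>.\<close>

lemma Re_T_inner_orthogonal:
  assumes u: "u \<in> D" and v: "v \<in> D" and I: "I \<in> sets borel"
    and Iu: "E I u \<simeq> (\<lambda>x. 0)" and Iv: "E I v \<simeq> v"
  shows "Re (L2_inner (T u) v) = 0"
proof -
  have w: "(\<lambda>x. u x + v x) \<in> D" using add_smult_D(1)[OF u v, of 1] by simp
  have "(\<integral>t. t \<partial>\<mu> (\<lambda>x. u x + v x)) = (\<integral>t. t \<partial>\<mu> u) + (\<integral>t. t \<partial>\<mu> v)"
    by (rule integral_add_measure) (auto intro!: \<mu>_add_orthogonal[OF D_L2[OF u] D_L2[OF v] I Iu Iv] integrable_id_\<mu> u v w)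
  then show ?thesis
    using Re_T_inner_add[OF u v, of 1] T_inner_self[OF w] T_inner_self[OF u] T_inner_self[OF v] by simp
qed

section \<open>Vectors with spectrum in a short interval\<close>

context
  fixes I :: "real set" and c \<delta> :: real assumes I: "I \<in> sets borel" and Ic: "I \<subseteq> {c - \<delta>..c + \<delta>}" and \<delta>: "\<delta> > 0"
begin

lemma AE_\<mu>_localized:
  assumes h: "h \<in> L2" and Ih: "E I h \<simeq> h"
  shows "AE t in \<mu> h. t \<in> I"
proof -
  have "E (- I) h \<simeq> E (- I) (E I h)"
    by (intro E_cong L2_eq_sym[OF Ih] h E_L2) (use I in auto)
  also have "\<dots> \<simeq> E (- I \<inter> I) h"
    by (rule L2_eq_sym[OF E_inter]) (use I h in auto)
  also have "\<dots> \<simeq> (\<lambda>x. 0)" using E_empty[OF h] by (simp add: Int_commute)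
  finally have "L2_norm (E (- I) h) = 0"
    using L2_norm_cong[of "E (- I) h" "\<lambda>x. 0"] I h by (simp add: L2_norm_zero L2_zero E_L2)
  then have "- I \<in> null_sets (\<mu> h)" using I h by (simp add: null_sets_def emeasure_\<mu>)
  from AE_not_in[OF this] show ?thesis by simp
qed

text \<open>Boundedness of \<open>t\<close> on \<open>I\<close> makes \<open>t^2\<close> integrable,
  and the spectral measure describes \<open>D\<close> by exactly this condition. So the range of
  \<open>E I\<close> lies in the domain.\<close>

lemma localized_in_D:
  assumes h: "h \<in> L2" and Ih: "E I h \<simeq> h"
  shows "h \<in> D"
proof -
  interpret finite_measure "\<mu> h" by (rule finite_\<mu>[OF h])
  have "integrable (\<mu> h) (\<lambda>t. t\<^sup>2)"
  proof (rule integrable_const_bound)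
    show "AE t in \<mu> h. norm (t\<^sup>2) \<le> (\<bar>c\<bar> + \<delta>)\<^sup>2"
      using AE_\<mu>_localized[OF assms]
    proof eventually_elim
      case (elim t)
      then have "c - \<delta> \<le> t" "t \<le> c + \<delta>" using Ic by auto
      then have "\<bar>t\<bar> \<le> \<bar>c\<bar> + \<delta>" by linarith
      from power_mono[OF this, of 2] show ?case by simp
    qed
  qed simp
  then show ?thesis using h by (simp add: D_eq)
qed

lemma localized_form_bound:
  assumes h: "h \<in> L2" and Ih: "E I h \<simeq> h"
  shows "\<bar>Re (L2_inner (T h) h) - c * (L2_norm h)\<^sup>2\<bar> \<le> \<delta> * (L2_norm h)\<^sup>2"
proof -
  interpret finite_measure "\<mu> h" by (rule finite_\<mu>[OF h])
  note hD = localized_in_D[OF assms]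
  have int: "integrable (\<mu> h) (\<lambda>t. t)" by (rule integrable_id_\<mu>[OF hD])
  have M: "measure (\<mu> h) (space (\<mu> h)) = (L2_norm h)\<^sup>2" using measure_\<mu>_UNIV[OF h] by simp
  have AE: "AE t in \<mu> h. t \<le> c + \<delta>" "AE t in \<mu> h. c - \<delta> \<le> t"
    by (rule eventually_mono[OF AE_\<mu>_localized[OF assms]], use Ic in auto)+
  have "(\<integral>t. t \<partial>\<mu> h) \<le> (\<integral>t. c + \<delta> \<partial>\<mu> h)"
    by (intro integral_mono_AE int AE) simp
  moreover have "(\<integral>t. c - \<delta> \<partial>\<mu> h) \<le> (\<integral>t. t \<partial>\<mu> h)"
    by (intro integral_mono_AE int AE) simp
  ultimately show ?thesis
    using T_inner_self[OF hD] M by (simp add: algebra_simps abs_le_iff)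
qed

text \<open>With \<open>h = E I g\<close> and \<open>r = E I (T g) - c h\<close>, testing
  \<open>r\<close> against itself gives \<open>||r||^2 = Re <(T - c) h, r>\<close>. Both vectors lie
  in the range of \<open>E I\<close>, where the form of \<open>T - c\<close> is bounded by
  \<open>\<delta>\<close>; polarization turns this form bound into a norm bound.\<close>

lemma localized_T_bound:
  assumes g: "g \<in> D"
  shows "L2_norm (\<lambda>x. E I (T g) x - of_real c *s E I g x) \<le> \<delta> * L2_norm (E I g)"
proof -
  define h where "h = E I g"
  define r where "r = (\<lambda>x. E I (T g) x + of_real (- c) *s h x)"
  note gL = D_L2[OF g] and TgL = T_L2[OF g]
  have hL: "h \<in> L2" and Ih: "E I h \<simeq> h" unfolding h_def by (auto intro: E_L2 E_idem I gL)
  have ETL: "E I (T g) \<in> L2" by (intro E_L2 I TgL)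
  have rL: "r \<in> L2" unfolding r_def by (intro L2_add L2_smult ETL hL)
  have rr: "r = (\<lambda>x. 1 *s E I (T g) x + of_real (- c) *s h x)" by (simp add: r_def)
  have Ir: "E I r \<simeq> r"
  proof -
    have "E I r \<simeq> (\<lambda>x. 1 *s E I (E I (T g)) x + of_real (- c) *s E I h x)"
      unfolding rr by (rule E_linear[OF I ETL hL])
    also have "\<dots> \<simeq> r" unfolding rr
      by (intro L2_eq_add L2_eq_smult E_idem I TgL Ih)
    finally show ?thesis .
  qed
  note hD = localized_in_D[OF hL Ih] and rD = localized_in_D[OF rL Ir]
  \<comment> \<open>The part of \<open>g\<close> outside the spectral subspace of \<open>I\<close>;
    its cross term with \<open>r\<close> drops out by \<open>Re_T_inner_orthogonal\<close>, so
    \<open>T g\<close> may be replaced by \<open>T h\<close>.\<close>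
  define k where "k = (\<lambda>x. g x + (-1) *s h x)"
  have kD: "k \<in> D" unfolding k_def by (rule add_smult_D[OF g hD])
  have Ik: "E I k \<simeq> (\<lambda>x. 0)"
  proof -
    have kk: "k = (\<lambda>x. 1 *s g x + (-1) *s h x)" by (simp add: k_def)
    have "E I k \<simeq> (\<lambda>x. 1 *s E I g x + (-1) *s E I h x)"
      unfolding kk by (rule E_linear[OF I gL hL])
    also have "\<dots> \<simeq> (\<lambda>x. 1 *s h x + (-1) *s h x)"
      unfolding h_def[symmetric] by (intro L2_eq_add L2_eq_smult Ih L2_eq_refl)
    finally show ?thesis by simp
  qed
  have Tg: "T g \<simeq> (\<lambda>x. T h x + T k x)"
  proof -
    have "T (\<lambda>x. h x + 1 *s k x) \<simeq> (\<lambda>x. T h x + 1 *s T k x)" by (rule add_smult_D[OF hD kD])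
    moreover have "(\<lambda>x. h x + 1 *s k x) = g" by (simp add: k_def)
    ultimately show ?thesis by simp
  qed
  have Eh: "L2_inner h r = L2_inner h (E I r)"
    by (intro L2_inner_cong L2_eq_sym[OF Ir] E_L2 I rL hL L2_eq_refl)
  have "L2_inner (E I (T g)) r = L2_inner (T g) (E I r)" by (rule E_sym[OF I TgL rL])
  also have "\<dots> = L2_inner (\<lambda>x. T h x + T k x) r"
    by (intro L2_inner_cong Tg Ir TgL E_L2 I rL L2_add T_L2 hD kD)
  also have "\<dots> = L2_inner (T h) r + L2_inner (T k) r"
    by (intro L2_inner_add_left T_L2 hD kD rL)
  finally have "Re (L2_inner (E I (T g)) r) = Re (L2_inner (T h) r)"
    using Re_T_inner_orthogonal[OF kD rD I Ik Ir] by simp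
  moreover have "L2_inner r r = L2_inner (E I (T g)) r + of_real (- c) * L2_inner h r"
    using L2_inner_add_left[OF ETL L2_smult[OF hL, of "of_real (- c)"] rL] L2_inner_smult_left[OF hL rL, of "of_real (- c)"]
    by (simp add: r_def)
  moreover have "(L2_norm r)\<^sup>2 = Re (L2_inner r r)" by (simp add: L2_inner_self)
  ultimately have rsq: "(L2_norm r)\<^sup>2 = Re (L2_inner (T h) r) - c * Re (L2_inner h r)" by simp
  \<comment> \<open>Polarization of the form bound, applied to \<open>h \<plusminus> s r\<close>; the optimal choice is \<open>s = 1 / \<delta>\<close>.\<close>
  have bound: "\<bar>Re (L2_inner (T h) h) + 2 * s * Re (L2_inner (T h) r) + s\<^sup>2 * Re (L2_inner (T r) r)
      - c * ((L2_norm h)\<^sup>2 + s\<^sup>2 * (L2_norm r)\<^sup>2 + 2 * s * Re (L2_inner h r))\<bar>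
      \<le> \<delta> * ((L2_norm h)\<^sup>2 + s\<^sup>2 * (L2_norm r)\<^sup>2 + 2 * s * Re (L2_inner h r))" for s
  proof -
    let ?w = "\<lambda>x. h x + of_real s *s r x"
    have ww: "?w = (\<lambda>x. 1 *s h x + of_real s *s r x)" by simp
    have wL: "?w \<in> L2" by (intro L2_add L2_smult hL rL)
    have "E I ?w \<simeq> (\<lambda>x. 1 *s E I h x + of_real s *s E I r x)"
      unfolding ww by (rule E_linear[OF I hL rL])
    also have "\<dots> \<simeq> ?w" unfolding ww
      by (intro L2_eq_add L2_eq_smult Ih Ir)
    finally have Iw: "E I ?w \<simeq> ?w" .
    have "(L2_norm ?w)\<^sup>2 = (L2_norm h)\<^sup>2 + s\<^sup>2 * (L2_norm r)\<^sup>2 + 2 * s * Re (L2_inner h r)"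
      using L2_norm_add_sq[OF hL L2_smult[OF rL, of "of_real s"]]
      by (simp add: L2_norm_smult L2_inner_smult_right[OF hL rL] power_mult_distrib)
    then show ?thesis
      using localized_form_bound[OF wL Iw] Re_T_inner_add[OF hD rD, of s] by simp
  qed
  define a b where "a = (L2_norm h)\<^sup>2" and "b = (L2_norm r)\<^sup>2"
  have b1: "(2 / \<delta>) * b \<le> \<delta> * (a + (1 / \<delta>)\<^sup>2 * b)"
  proof -
    define X Y where "X = Re (L2_inner (T h) h)" and "Y = Re (L2_inner (T r) r)"
    define P Q where "P = Re (L2_inner (T h) r)" and "Q = Re (L2_inner h r)"
    have bPQ: "b = P - c * Q" using rsq by (simp add: b_def P_def Q_def)
    have bd: "\<bar>X + 2 * s * P + s\<^sup>2 * Y - c * (a + s\<^sup>2 * b + 2 * s * Q)\<bar> \<le> \<delta> * (a + s\<^sup>2 * b + 2 * s * Q)" for s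
      using bound[of s] by (simp add: a_def b_def X_def Y_def P_def Q_def)
    \<comment> \<open>Combining the upper bound at \<open>s\<close> with the lower bound at
      \<open>- s\<close> cancels the diagonal terms \<open>X\<close>, \<open>Y\<close> on the left
      and \<open>Q\<close> on the right.\<close>
    have "4 * s * b \<le> 2 * \<delta> * (a + s\<^sup>2 * b)" for s
      using bd[of s] bd[of "- s"] unfolding bPQ by (simp add: abs_le_iff algebra_simps)
    from this[of "1 / \<delta>"] show ?thesis by simp
  qed
  have "b \<le> \<delta>\<^sup>2 * a"
    using b1 \<delta> by (simp add: power2_eq_square field_simps)
  then have "(L2_norm r)\<^sup>2 \<le> (\<delta> * L2_norm h)\<^sup>2"
    by (simp add: a_def b_def power_mult_distrib)
  then have "L2_norm r \<le> \<delta> * L2_norm h"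
    by (rule power2_le_imp_le) (use \<delta> L2_norm_nonneg[of h] in auto)
  moreover have "r = (\<lambda>x. E I (T g) x - of_real c *s E I g x)"
    by (simp add: r_def h_def)
  ultimately show ?thesis by (simp add: h_def)
qed

text \<open>Applying \<open>E I\<close> to \<open>f = (T - z) g\<close> gives
  \<open>E I f = (c - z) E I g + r\<close> with \<open>||r|| \<le> \<delta> ||E I g||\<close>; the
  triangle inequality is used in both directions.\<close>

lemma localized_resolvent_bound:
  assumes g: "g \<in> D" and f: "f \<in> L2" and eq: "f \<simeq> (\<lambda>x. T g x - z *s g x)"
  shows "\<bar>L2_norm (E I f) - norm (of_real c - z) * L2_norm (E I g)\<bar> \<le> \<delta> * L2_norm (E I g)"
proof -
  note gL = D_L2[OF g] and TgL = T_L2[OF g]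
  define r where "r = (\<lambda>x. E I (T g) x - of_real c *s E I g x)"
  have rL: "r \<in> L2" unfolding r_def by (intro L2_diff L2_smult E_L2 I TgL gL)
  have r: "L2_norm r \<le> \<delta> * L2_norm (E I g)" unfolding r_def by (rule localized_T_bound[OF g])
  have EgL: "E I g \<in> L2" by (intro E_L2 I gL)
  have "E I f \<simeq> E I (\<lambda>x. 1 *s T g x + (- z) *s g x)"
    using eq by (intro E_cong I f L2_linear gL TgL) simp
  also have "\<dots> \<simeq> (\<lambda>x. 1 *s E I (T g) x + (- z) *s E I g x)"
    by (rule E_linear[OF I TgL gL])
  also have "(\<lambda>x. 1 *s E I (T g) x + (- z) *s E I g x) = (\<lambda>x. r x + (of_real c - z) *s E I g x)"
    by (simp add: r_def vector_sub_rdistrib)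
  finally have Ef: "E I f \<simeq> (\<lambda>x. r x + (of_real c - z) *s E I g x)" .
  have "L2_norm (E I f) = L2_norm (\<lambda>x. r x + (of_real c - z) *s E I g x)"
    by (intro L2_norm_cong Ef E_L2 I f L2_add rL L2_smult gL)
  moreover have "\<dots> \<le> L2_norm r + norm (of_real c - z) * L2_norm (E I g)"
    using L2_norm_triangle[OF rL L2_smult[OF EgL, of "of_real c - z"]] by (simp only: L2_norm_smult)
  moreover have "norm (of_real c - z) * L2_norm (E I g) \<le>
      L2_norm (\<lambda>x. r x + (of_real c - z) *s E I g x) + L2_norm r"
  proof -
    have "norm (of_real c - z) * L2_norm (E I g) = L2_norm (\<lambda>x. (r x + (of_real c - z) *s E I g x) + (-1) *s r x)"
    proof -
      have "(\<lambda>x. (r x + (of_real c - z) *s E I g x) + (-1) *s r x) = (\<lambda>x. (of_real c - z) *s E I g x)"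
        by simp
      then show ?thesis by (simp only: L2_norm_smult)
    qed
    also have "\<dots> \<le> L2_norm (\<lambda>x. r x + (of_real c - z) *s E I g x) + L2_norm (\<lambda>x. (-1) *s r x)"
      by (intro L2_norm_triangle L2_add L2_smult rL EgL)
    also have "L2_norm (\<lambda>x. (-1) *s r x) = L2_norm r" by (simp only: L2_norm_smult norm_minus_cancel norm_one mult_1)
    finally show ?thesis .
  qed
  ultimately show ?thesis using r by (simp add: abs_le_iff)
qed

end

end

subsection \<open>The resolvent and the spectral distribution\<close>

text \<open>The cell containing \<open>t\<close> is read off the ceiling of
  \<open>t / \<delta>\<close>. The integers are recoded as naturals because countable sums of
  measures run over \<open>nat\<close>.\<close>

lemma real_partition_int:
  assumes "\<delta> > (0::real)"
  defines "A \<equiv> \<lambda>n. {of_int (int_decode n) * \<delta><..(of_int (int_decode n) + 1) * \<delta>}"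
  shows "disjoint_family A" "(\<Union>n. A n) = UNIV"
proof -
  have mem: "t \<in> A n \<longleftrightarrow> \<lceil>t / \<delta>\<rceil> = int_decode n + 1" for t n
    using assms(1) by (auto simp: A_def ceiling_eq_iff pos_less_divide_eq pos_divide_le_eq)
  show "disjoint_family A"
    unfolding disjoint_family_on_def
  proof (intro ballI impI)
    fix m n :: nat assume "m \<noteq> n"
    then have "int_decode m \<noteq> int_decode n" using inj_int_decode by (simp add: inj_eq)
    then show "A m \<inter> A n = {}" using mem by auto
  qed
  have "t \<in> A (int_encode (\<lceil>t / \<delta>\<rceil> - 1))" for t unfolding mem by simp
  then show "(\<Union>n. A n) = UNIV" by blast
qed

context spectral_resolution begin

text \<open>On a cell near \<open>c\<close>, with \<open>d = |c - z|\<close>, both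
  \<open>||E f|| / ||E g||\<close> (where the denominator is nonzero) and \<open>|t - z|\<close> lie
  between \<open>d - \<delta>\<close> and \<open>d + \<delta>\<close>. The resulting two-sided
  comparison of \<open>N\<close> with \<open>\<mu> g\<close> has a constant independent of the cell,
  so it survives summation, and the constant tends to 1 with \<open>\<delta>\<close>.\<close>

theorem nn_integral_resolvent:
  assumes g: "g \<in> D" and f: "f \<in> L2" and eq: "f \<simeq> (\<lambda>x. T g x - z *s g x)" and z: "Im z \<noteq> 0"
  shows "(\<integral>\<^sup>+t. ennreal (1 / (norm (of_real t - z))\<^sup>2) \<partial>\<mu> f) = ennreal ((L2_norm g)\<^sup>2)"
proof -
  note gL = D_L2[OF g]
  define \<epsilon> where "\<epsilon> = \<bar>Im z\<bar>"
  have \<epsilon>: "\<epsilon> > 0" using z by (simp add: \<epsilon>_def)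
  have norm_ge: "\<epsilon> \<le> norm (of_real t - z)" for t
    using abs_Im_le_cmod[of "of_real t - z"] by (simp add: \<epsilon>_def)
  define F where "F t = ennreal (1 / (norm (of_real t - z))\<^sup>2)" for t
  have [measurable]: "F \<in> borel_measurable borel"
    unfolding F_def by measurable
  define N where "N = density (\<mu> f) F"
  have setsN: "sets N = sets borel" by (simp add: N_def)
  define x where "x = emeasure N UNIV"
  have x: "x = (\<integral>\<^sup>+t. F t \<partial>\<mu> f)"
    unfolding x_def N_def by (subst emeasure_density) (auto simp: measurable_cong_sets[OF sets_\<mu> refl])
  define G where "G = (L2_norm g)\<^sup>2"
  have Gm: "emeasure (\<mu> g) UNIV = ennreal G"
    using measure_\<mu>_UNIV[OF gL] finite_measure.emeasure_eq_measure[OF finite_\<mu>[OF gL]] by (simp add: G_def)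
  have main: "x \<le> ennreal (R\<^sup>2) * ennreal G \<and> ennreal G \<le> ennreal (R\<^sup>2) * x"
    if \<delta>: "0 < \<delta>" "\<delta> < \<epsilon>" and R: "R = (\<epsilon> + \<delta>) / (\<epsilon> - \<delta>)" for \<delta> R
  proof -
    define A where "A n = {of_int (int_decode n) * \<delta><..(of_int (int_decode n) + 1) * \<delta>}" for n
    note part = real_partition_int[OF \<delta>(1), folded A_def]
    have Ab: "A n \<in> sets borel" for n by (simp add: A_def)
    have loc: "emeasure N (A n) \<le> ennreal (R\<^sup>2) * emeasure (\<mu> g) (A n) \<and>
          emeasure (\<mu> g) (A n) \<le> ennreal (R\<^sup>2) * emeasure N (A n)" for n
    proof -
      define c where "c = of_int (int_decode n) * \<delta>"
      define d where "d = norm (of_real c - z)"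
      define a b where "a = L2_norm (E (A n) f)" and "b = L2_norm (E (A n) g)"
      have sub: "A n \<subseteq> {c - \<delta>..c + \<delta>}" using \<delta> by (auto simp: A_def c_def algebra_simps)
      have ab: "\<bar>a - d * b\<bar> \<le> \<delta> * b"
        using localized_resolvent_bound[OF Ab sub \<delta>(1) g f eq] by (simp add: a_def b_def d_def)
      have nn: "a \<ge> 0" "b \<ge> 0" by (simp_all add: a_def b_def L2_norm_nonneg)
      have d: "d \<ge> \<epsilon>" unfolding d_def by (rule norm_ge)
      have pos: "d - \<delta> > 0" "d + \<delta> > 0" "R > 0" using d \<delta> \<epsilon> R by auto
      \<comment> \<open>The ratio \<open>(d + \<delta>) / (d - \<delta>)\<close> decreases in
        \<open>d\<close>, so its value \<open>R\<close> at the lower bound \<open>\<epsilon>\<close>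
        of \<open>d\<close> serves all cells.\<close>
      have dR: "d + \<delta> \<le> R * (d - \<delta>)"
      proof -
        have "(d + \<delta>) * (\<epsilon> - \<delta>) \<le> (\<epsilon> + \<delta>) * (d - \<delta>)"
          using mult_left_mono[OF d, of \<delta>] \<delta> by (simp add: algebra_simps)
        then show ?thesis using \<delta> by (simp add: R field_simps)
      qed
      have dt: "\<bar>norm (of_real t - z) - d\<bar> \<le> \<delta>" if "t \<in> A n" for t
      proof -
        have "\<bar>norm (of_real t - z) - d\<bar> \<le> norm ((of_real t - z) - (of_real c - z))"
          unfolding d_def by (rule norm_triangle_ineq3)
        also have "\<dots> = \<bar>t - c\<bar>" by (simp flip: of_real_diff)
        also have "\<dots> \<le> \<delta>" using sub that by (auto simp: abs_le_iff)
        finally show ?thesis .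
      qed
      have Na: "emeasure N (A n) = (\<integral>\<^sup>+t. F t * indicator (A n) t \<partial>\<mu> f)"
        unfolding N_def using Ab by (subst emeasure_density) (auto simp: measurable_cong_sets[OF sets_\<mu> refl])
      have const: "(\<integral>\<^sup>+t. ennreal C * indicator (A n) t \<partial>\<mu> f) = ennreal (C * a\<^sup>2)" if "C \<ge> 0" for C
        using that Ab by (subst nn_integral_cmult_indicator) (auto simp: emeasure_\<mu>[OF f] a_def ennreal_mult)
      have up: "emeasure N (A n) \<le> ennreal (1 / (d - \<delta>)\<^sup>2 * a\<^sup>2)"
      proof -
        have "F t * indicator (A n) t \<le> ennreal (1 / (d - \<delta>)\<^sup>2) * indicator (A n) t" for t
        proof (cases "t \<in> A n")
          case True
          have "(d - \<delta>)\<^sup>2 \<le> (norm (of_real t - z))\<^sup>2" using dt[OF True] pos by (intro power_mono) auto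
          then show ?thesis using True pos unfolding F_def by (auto intro!: ennreal_leI divide_left_mono mult_pos_pos zero_less_power intro: less_le_trans[of 0 "(d - \<delta>)\<^sup>2"])
        qed simp
        then have "emeasure N (A n) \<le> (\<integral>\<^sup>+t. ennreal (1 / (d - \<delta>)\<^sup>2) * indicator (A n) t \<partial>\<mu> f)"
          unfolding Na by (intro nn_integral_mono)
        then show ?thesis by (subst (asm) const) auto
      qed
      have lo: "emeasure N (A n) \<ge> ennreal (1 / (d + \<delta>)\<^sup>2 * a\<^sup>2)"
      proof -
        have "F t * indicator (A n) t \<ge> ennreal (1 / (d + \<delta>)\<^sup>2) * indicator (A n) t" for t
        proof (cases "t \<in> A n")
          case True
          have "(norm (of_real t - z))\<^sup>2 \<le> (d + \<delta>)\<^sup>2" using dt[OF True] by (intro power_mono) auto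
          moreover have "0 < (norm (of_real t - z))\<^sup>2" using norm_ge[of t] \<epsilon> by (intro zero_less_power) linarith
          ultimately show ?thesis using True pos unfolding F_def
            by (auto intro!: ennreal_leI divide_left_mono mult_pos_pos)
        qed simp
        then have "emeasure N (A n) \<ge> (\<integral>\<^sup>+t. ennreal (1 / (d + \<delta>)\<^sup>2) * indicator (A n) t \<partial>\<mu> f)"
          unfolding Na by (intro nn_integral_mono)
        then show ?thesis by (subst (asm) const) auto
      qed
      have gA: "emeasure (\<mu> g) (A n) = ennreal (b\<^sup>2)"
        using emeasure_\<mu>[OF gL Ab] by (simp add: b_def)
      have "1 / (d - \<delta>)\<^sup>2 * a\<^sup>2 \<le> R\<^sup>2 * b\<^sup>2"
      proof -
        have "a \<le> (d + \<delta>) * b" using ab by (simp add: algebra_simps abs_le_iff)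
        also have "\<dots> \<le> R * (d - \<delta>) * b" by (intro mult_right_mono dR nn)
        finally have "a\<^sup>2 \<le> (R * (d - \<delta>) * b)\<^sup>2" using nn by (intro power_mono)
        also have "\<dots> = R\<^sup>2 * b\<^sup>2 * (d - \<delta>)\<^sup>2" by (simp only: power_mult_distrib mult_ac)
        finally show ?thesis using pos by (simp add: pos_divide_le_eq)
      qed
      then have 1: "emeasure N (A n) \<le> ennreal (R\<^sup>2) * emeasure (\<mu> g) (A n)"
        unfolding gA by (intro order_trans[OF up]) (simp add: ennreal_leI flip: ennreal_mult)
      have "b\<^sup>2 \<le> R\<^sup>2 * (1 / (d + \<delta>)\<^sup>2 * a\<^sup>2)"
      proof -
        have "(d - \<delta>) * b \<le> a" using ab by (simp add: algebra_simps abs_le_iff)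
        have "(d + \<delta>) * b \<le> R * (d - \<delta>) * b" by (intro mult_right_mono dR nn)
        also have "\<dots> \<le> R * a" using \<open>(d - \<delta>) * b \<le> a\<close> pos by (simp add: mult.assoc)
        finally have "((d + \<delta>) * b)\<^sup>2 \<le> (R * a)\<^sup>2" using nn pos by (intro power_mono) auto
        then have "b\<^sup>2 * (d + \<delta>)\<^sup>2 \<le> R\<^sup>2 * a\<^sup>2" by (simp only: power_mult_distrib mult_ac)
        then show ?thesis using pos by (simp add: pos_le_divide_eq)
      qed
      then have 2: "emeasure (\<mu> g) (A n) \<le> ennreal (R\<^sup>2) * emeasure N (A n)"
        unfolding gA by (intro order_trans[OF _ mult_left_mono[OF lo]]) (simp_all add: ennreal_leI flip: ennreal_mult)
      show ?thesis using 1 2 by simp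
    qed
    have sumN: "x = (\<Sum>n. emeasure N (A n))" and sumg: "ennreal G = (\<Sum>n. emeasure (\<mu> g) (A n))"
      unfolding x_def Gm[symmetric] part(2)[symmetric]
      using part(1) Ab by (auto intro!: suminf_emeasure[symmetric] simp: setsN)
    show ?thesis
      unfolding sumN sumg ennreal_suminf_cmult[symmetric]
      by (intro conjI suminf_le) (use loc in auto)
  qed
  \<comment> \<open>One admissible value of \<open>\<delta>\<close> already shows that
    \<open>x\<close> is finite, so the limit can be taken among real numbers.\<close>
  have half: "0 < \<epsilon> / 2" "\<epsilon> / 2 < \<epsilon>" using \<epsilon> by auto
  have "x \<le> ennreal (((\<epsilon> + \<epsilon> / 2) / (\<epsilon> - \<epsilon> / 2))\<^sup>2) * ennreal G"
    using main[OF half refl] by (rule conjunct1)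
  also have "\<dots> < top" by (simp add: ennreal_mult_less_top)
  finally have "x < top" .
  then obtain x' where x': "x = ennreal x'" "x' \<ge> 0" by (cases x) auto
  have G0: "G \<ge> 0" by (simp add: G_def)
  have lim: "((\<lambda>\<delta>. ((\<epsilon> + \<delta>) / (\<epsilon> - \<delta>))\<^sup>2 * y) \<longlongrightarrow> y) (at_right 0)" for y
  proof -
    have "((\<lambda>\<delta>. ((\<epsilon> + \<delta>) / (\<epsilon> - \<delta>))\<^sup>2 * y) \<longlongrightarrow> ((\<epsilon> + 0) / (\<epsilon> - 0))\<^sup>2 * y) (at_right 0)"
      using \<epsilon> by (intro tendsto_intros) auto
    then show ?thesis using \<epsilon> by simp
  qed
  have ev: "\<forall>\<^sub>F \<delta> in at_right 0. 0 < \<delta> \<and> \<delta> < \<epsilon>"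
    using \<epsilon> by (auto simp: eventually_at_right_field)
  have "x' \<le> G"
  proof (rule tendsto_lowerbound[OF lim])
    show "\<forall>\<^sub>F \<delta> in at_right 0. x' \<le> ((\<epsilon> + \<delta>) / (\<epsilon> - \<delta>))\<^sup>2 * G"
      using ev
    proof eventually_elim
      case (elim \<delta>)
      then show ?case using main[of \<delta>, OF _ _ refl] G0 x' by (simp flip: ennreal_mult)
    qed
  qed simp
  moreover have "G \<le> x'"
  proof (rule tendsto_lowerbound[OF lim])
    show "\<forall>\<^sub>F \<delta> in at_right 0. G \<le> ((\<epsilon> + \<delta>) / (\<epsilon> - \<delta>))\<^sup>2 * x'"
      using ev
    proof eventually_elim
      case (elim \<delta>)
      then show ?case using main[of \<delta>, OF _ _ refl] G0 x' by (simp flip: ennreal_mult)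
    qed
  qed simp
  ultimately show ?thesis using x x' by (simp add: F_def G_def)
qed

text \<open>Since \<open><Tg, g>\<close> is real, \<open><f, g> = <Tg, g> - z ||g||^2\<close> gives
  \<open>Im <g, f> = Im z ||g||^2\<close>. The sign is recorded separately because
  \<open>ennreal\<close> maps negative numbers to 0.\<close>

lemma nn_integral_Poisson:
  assumes g: "g \<in> D" and f: "f \<in> L2" and eq: "f \<simeq> (\<lambda>x. T g x - z *s g x)" and z: "Im z > 0"
  shows "(\<integral>\<^sup>+t. ennreal (Im z / ((t - Re z)\<^sup>2 + (Im z)\<^sup>2)) \<partial>\<mu> f) = ennreal (Im (L2_inner g f))"
    and "Im (L2_inner g f) \<ge> 0"
proof -
  note gL = D_L2[OF g] and TgL = T_L2[OF g]
  have "L2_inner f g = L2_inner (\<lambda>x. T g x + (- z) *s g x) g"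
    using eq by (intro L2_inner_cong f gL L2_add TgL L2_smult L2_eq_refl) simp
  also have "\<dots> = L2_inner (T g) g + (- z) * L2_inner g g"
    using L2_inner_add_left[OF TgL L2_smult[OF gL, of "- z"] gL] L2_inner_smult_left[OF gL gL, of "- z"] by simp
  finally have fg: "L2_inner f g = L2_inner (T g) g + (- z) * L2_inner g g" .
  have Im: "Im (L2_inner g f) = Im z * (L2_norm g)\<^sup>2"
    using fg T_inner_self[OF g] L2_inner_commute[OF f gL] by (simp add: L2_inner_self)
  then show "Im (L2_inner g f) \<ge> 0" using z by simp
  have "(norm (of_real t - z))\<^sup>2 = (t - Re z)\<^sup>2 + (Im z)\<^sup>2" for t
    by (simp add: cmod_power2)
  then have "(\<integral>\<^sup>+t. ennreal (Im z / ((t - Re z)\<^sup>2 + (Im z)\<^sup>2)) \<partial>\<mu> f) =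
      (\<integral>\<^sup>+t. ennreal (Im z) * ennreal (1 / (norm (of_real t - z))\<^sup>2) \<partial>\<mu> f)"
    using z by (intro nn_integral_cong) (simp flip: ennreal_mult)
  also have "\<dots> = ennreal (Im z) * (\<integral>\<^sup>+t. ennreal (1 / (norm (of_real t - z))\<^sup>2) \<partial>\<mu> f)"
    by (intro nn_integral_cmult) simp
  also have "\<dots> = ennreal (Im (L2_inner g f))"
    using nn_integral_resolvent[OF g f eq] z Im by (simp flip: ennreal_mult)
  finally show "(\<integral>\<^sup>+t. ennreal (Im z / ((t - Re z)\<^sup>2 + (Im z)\<^sup>2)) \<partial>\<mu> f) = ennreal (Im (L2_inner g f))" .
qed

end

subsection \<open>Stieltjes inversion\<close>

lemma nn_integral_Poisson_interval:
  assumes "a \<le> b" "\<epsilon> > (0::real)"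
  shows "(\<integral>\<^sup>+s. ennreal (\<epsilon> / ((t - s)\<^sup>2 + \<epsilon>\<^sup>2)) * indicator {a..b} s \<partial>lborel) =
     ennreal (arctan ((b - t) / \<epsilon>) - arctan ((a - t) / \<epsilon>))"
proof (rule nn_integral_FTC_Icc)
  fix s assume "s \<in> {a..b}"
  have "((\<lambda>s. arctan ((s - t) / \<epsilon>)) has_real_derivative inverse (1 + ((s - t) / \<epsilon>)\<^sup>2) * (1 / \<epsilon>)) (at s)"
    by (rule DERIV_chain2[OF DERIV_arctan]) (use assms in \<open>auto intro!: derivative_eq_intros\<close>)
  moreover have "inverse (1 + ((s - t) / \<epsilon>)\<^sup>2) * (1 / \<epsilon>) = \<epsilon> / ((t - s)\<^sup>2 + \<epsilon>\<^sup>2)"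
  proof -
    have "1 + ((s - t) / \<epsilon>)\<^sup>2 = ((t - s)\<^sup>2 + \<epsilon>\<^sup>2) / \<epsilon>\<^sup>2"
      using assms by (simp add: power_divide power2_commute[of t] field_simps)
    then show ?thesis using assms by (simp add: power2_eq_square)
  qed
  ultimately show "((\<lambda>s. arctan ((s - t) / \<epsilon>)) has_real_derivative \<epsilon> / ((t - s)\<^sup>2 + \<epsilon>\<^sup>2)) (at s)"
    by simp
qed (use assms in auto)

text \<open>Fubini reduces the inner integral to a difference of arctangents, which is at most
  \<open>pi\<close> and tends to \<open>pi\<close> inside the interval and to 0 outside.\<close>

lemma Stieltjes_inversion:
  fixes M :: "real measure" and a b :: real
  assumes M: "finite_measure M" "sets M = sets borel" and ab: "a < b"
    and atoms: "emeasure M {a} = 0" "emeasure M {b} = 0"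
  shows "(\<lambda>n. \<integral>\<^sup>+s. (\<integral>\<^sup>+t. ennreal ((1 / real (Suc n)) / ((t - s)\<^sup>2 + (1 / real (Suc n))\<^sup>2)) \<partial>M) * indicator {a..b} s \<partial>lborel)
     \<longlonglongrightarrow> ennreal pi * emeasure M {a<..b}"
proof -
  interpret finite_measure M by fact
  interpret pair_sigma_finite M lborel
    by (intro pair_sigma_finite.intro sigma_finite_measure_axioms sigma_finite_lborel)
  note [measurable_cong] = M(2)
  let ?\<epsilon> = "\<lambda>n. 1 / real (Suc n)"
  let ?h = "\<lambda>n t. arctan ((b - t) / ?\<epsilon> n) - arctan ((a - t) / ?\<epsilon> n)"
  have eq: "(\<integral>\<^sup>+s. (\<integral>\<^sup>+t. ennreal (\<epsilon> / ((t - s)\<^sup>2 + \<epsilon>\<^sup>2)) \<partial>M) * indicator {a..b} s \<partial>lborel) =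
     (\<integral>\<^sup>+t. ennreal (arctan ((b - t) / \<epsilon>) - arctan ((a - t) / \<epsilon>)) \<partial>M)" if "\<epsilon> > 0" for \<epsilon>
  proof -
    have "(\<integral>\<^sup>+s. (\<integral>\<^sup>+t. ennreal (\<epsilon> / ((t - s)\<^sup>2 + \<epsilon>\<^sup>2)) \<partial>M) * indicator {a..b} s \<partial>lborel) =
       (\<integral>\<^sup>+s. (\<integral>\<^sup>+t. ennreal (\<epsilon> / ((t - s)\<^sup>2 + \<epsilon>\<^sup>2)) * indicator {a..b} s \<partial>M) \<partial>lborel)"
      by (intro nn_integral_cong nn_integral_multc[symmetric]) measurable
    also have "\<dots> = (\<integral>\<^sup>+t. (\<integral>\<^sup>+s. ennreal (\<epsilon> / ((t - s)\<^sup>2 + \<epsilon>\<^sup>2)) * indicator {a..b} s \<partial>lborel) \<partial>M)"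
      by (rule Fubini') measurable
    also have "\<dots> = (\<integral>\<^sup>+t. ennreal (arctan ((b - t) / \<epsilon>) - arctan ((a - t) / \<epsilon>)) \<partial>M)"
      using ab that by (intro nn_integral_cong nn_integral_Poisson_interval) auto
    finally show ?thesis .
  qed
  have lim: "(\<lambda>n. arctan (r / ?\<epsilon> n)) \<longlonglongrightarrow> sgn r * (pi / 2)" for r
  proof -
    have top: "filterlim (\<lambda>n. r * real (Suc n)) at_top sequentially" if "r > 0" for r :: real
      by (intro filterlim_tendsto_pos_mult_at_top[OF tendsto_const that]
          filterlim_compose[OF filterlim_real_sequentially filterlim_Suc])
    have pos: "(\<lambda>n. arctan (r * real (Suc n))) \<longlonglongrightarrow> pi / 2" if "r > 0" for r
      by (rule filterlim_compose[OF tendsto_arctan_at_top top[OF that]])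
    consider "r > 0" | "r = 0" | "r < 0" by linarith
    then show ?thesis
    proof cases
      case 1
      then show ?thesis using pos[of r] by (simp add: sgn_if)
    next
      case 3
      then show ?thesis using tendsto_minus[OF pos[of "- r"]] by (simp add: sgn_if arctan_minus)
    qed simp
  qed
  have "(\<lambda>n. \<integral>\<^sup>+t. ennreal (?h n t) \<partial>M) \<longlonglongrightarrow> (\<integral>\<^sup>+t. ennreal (pi * indicator {a<..b} t) \<partial>M)"
  proof (rule nn_integral_dominated_convergence)
    show "AE t in M. ennreal (?h n t) \<le> ennreal pi" for n
    proof (intro AE_I2 ennreal_leI)
      fix t show "?h n t \<le> pi"
        using arctan_ubound[of "(b - t) / ?\<epsilon> n"] arctan_lbound[of "(a - t) / ?\<epsilon> n"] by linarith
    qed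
    show "(\<integral>\<^sup>+t. ennreal pi \<partial>M) < \<infinity>"
      by (simp add: ennreal_mult_less_top emeasure_eq_measure)
    have "AE t in M. t \<noteq> a" "AE t in M. t \<noteq> b"
      using AE_not_in[of "{a}" M] AE_not_in[of "{b}" M] atoms M(2) by (simp_all add: null_sets_def)
    then show "AE t in M. (\<lambda>n. ennreal (?h n t)) \<longlonglongrightarrow> ennreal (pi * indicator {a<..b} t)"
    proof eventually_elim
      case (elim t)
      have "(\<lambda>n. ?h n t) \<longlonglongrightarrow> sgn (b - t) * (pi / 2) - sgn (a - t) * (pi / 2)"
        by (intro tendsto_diff lim)
      \<comment> \<open>At \<open>t = a\<close> or \<open>t = b\<close> the left side would be
        \<open>pi / 2\<close>; this is why the endpoints must carry no mass.\<close>
      moreover have "sgn (b - t) * (pi / 2) - sgn (a - t) * (pi / 2) = pi * indicator {a<..b} t"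
        using elim ab by (auto simp: sgn_if indicator_def)
      ultimately show ?case by (intro tendsto_ennrealI) (simp only:)
    qed
  qed measurable
  moreover have "(\<integral>\<^sup>+t. ennreal (pi * indicator {a<..b} t) \<partial>M) = ennreal pi * emeasure M {a<..b}"
    using M(2) by (subst nn_integral_cmult_indicator[symmetric]) (auto intro!: nn_integral_cong simp: indicator_def)
  ultimately show ?thesis by (subst eq) auto
qed

subsection \<open>Explicit resolvent of the star graph\<close>

lemma L2_exp_tail:
  fixes g :: "real \<Rightarrow> complex"
  assumes g: "continuous_on UNIV g" and tail: "\<And>x. x \<ge> q \<Longrightarrow> g x = A * exp (- \<kappa> * of_real x)" and \<kappa>: "Re \<kappa> > 0"
  shows "g \<in> L2"
proof -
  have "compact (g ` {0..q})"
    by (intro compact_continuous_image continuous_on_subset[OF g]) auto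
  then obtain C where C: "\<And>x. x \<in> {0..q} \<Longrightarrow> norm (g x) \<le> C"
    using compact_imp_bounded bounded_iff by (metis image_eqI)
  have "norm (g x) \<le> (\<bar>C\<bar> * exp (Re \<kappa> * q) + norm A) * exp (- Re \<kappa> * x)" if "x > 0" for x
  proof (cases "x \<ge> q")
    case True
    have "norm (g x) = norm A * exp (- Re \<kappa> * x)" by (simp add: tail[OF True] norm_mult)
    also have "\<dots> \<le> (\<bar>C\<bar> * exp (Re \<kappa> * q) + norm A) * exp (- Re \<kappa> * x)"
      by (intro mult_right_mono) auto
    finally show ?thesis .
  next
    case False
    have "norm (g x) \<le> \<bar>C\<bar> * 1" using C[of x] False that by auto
    also have "\<dots> \<le> \<bar>C\<bar> * exp (Re \<kappa> * q + - Re \<kappa> * x)"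
    proof -
      have "Re \<kappa> * x \<le> Re \<kappa> * q" using False \<kappa> by (intro mult_left_mono) auto
      then show ?thesis by (intro mult_left_mono) auto
    qed
    also have "\<dots> = \<bar>C\<bar> * exp (Re \<kappa> * q) * exp (- Re \<kappa> * x)" by (simp only: exp_add mult.assoc)
    also have "\<dots> \<le> (\<bar>C\<bar> * exp (Re \<kappa> * q) + norm A) * exp (- Re \<kappa> * x)"
      by (intro mult_right_mono) auto
    finally show ?thesis .
  qed
  then show ?thesis
    using g \<kappa> by (intro L2_exp_decay[where k="Re \<kappa>"] continuous_half_line_measurable) (auto intro: continuous_on_subset)
qed

text \<open>The integrals at \<open>\<kappa>\<close> and \<open>- \<kappa>\<close> are the two
  primitives of variation of constants. At \<open>\<kappa> = i \<omega>\<close> and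
  \<open>x = q\<close> this is the Fourier integral of the source.\<close>

definition partial_laplace :: "(real \<Rightarrow> complex) \<Rightarrow> complex \<Rightarrow> real \<Rightarrow> complex" where
  "partial_laplace \<phi> \<kappa> x = integral {0..x} (\<lambda>y. exp (\<kappa> * of_real y) * \<phi> y)"

locale source =
  fixes \<phi> :: "real \<Rightarrow> complex" and p q :: real
  assumes pq: "0 < p" "p < q" and \<phi>_cont: "continuous_on UNIV \<phi>"
    and \<phi>_zero: "\<And>x. x \<notin> {p<..<q} \<Longrightarrow> \<phi> x = 0"
    and \<phi>_real: "cnj (\<phi> x) = \<phi> x"
begin

abbreviation J where "J \<equiv> partial_laplace \<phi>"

lemma \<phi>_contI [continuous_intros]: "continuous_on S f \<Longrightarrow> continuous_on S (\<lambda>x. \<phi> (f x))"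
  by (rule continuous_on_compose2[OF \<phi>_cont]) auto

lemma J_0: "x \<le> p \<Longrightarrow> J \<kappa> x = 0"
  unfolding partial_laplace_def by (rule integral_unique, rule has_integral_is_0) (auto simp: \<phi>_zero)
  
text \<open>The integral starts at 0, so the fundamental theorem covers only \<open>x > 0\<close>.
  Left of \<open>p\<close> the function vanishes identically, and \<open>p > 0\<close> makes the two
  ranges cover the line.\<close>

lemma J_deriv: "(J \<kappa> has_vector_derivative exp (\<kappa> * of_real x) * \<phi> x) (at x)"
proof (cases "x < p")
  case True
  have "((\<lambda>x. 0) has_vector_derivative 0) (at x)" by simp
  then have "(J \<kappa> has_vector_derivative 0) (at x)"
    by (rule has_vector_derivative_transform_within_open[where S="{..<p}"]) (use True J_0 in auto)
  then show ?thesis using True \<phi>_zero[of x] by simp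
next
  case False
  then have x: "x > 0" using pq by simp
  have "((\<lambda>u. integral {0..u} (\<lambda>y. exp (\<kappa> * of_real y) * \<phi> y)) has_vector_derivative exp (\<kappa> * of_real x) * \<phi> x)
     (at x within {0..x + 1})"
    by (rule integral_has_vector_derivative) (use x in \<open>auto intro!: continuous_intros\<close>)
  moreover have "at x within {0..x + 1} = at x"
    by (rule at_within_Icc_at) (use x in auto)
  ultimately show ?thesis by (simp add: partial_laplace_def[abs_def])
qed

lemma J_tail: "x \<ge> q \<Longrightarrow> J \<kappa> x = J \<kappa> q"
proof -
  assume x: "x \<ge> q"
  have "integral {0..q} (\<lambda>y. exp (\<kappa> * of_real y) * \<phi> y) + integral {q..x} (\<lambda>y. exp (\<kappa> * of_real y) * \<phi> y)
      = integral {0..x} (\<lambda>y. exp (\<kappa> * of_real y) * \<phi> y)"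
    by (rule Henstock_Kurzweil_Integration.integral_combine) (use pq x in \<open>auto intro!: integrable_continuous_interval continuous_intros\<close>)
  moreover have "integral {q..x} (\<lambda>y. exp (\<kappa> * of_real y) * \<phi> y) = 0"
    by (rule integral_unique, rule has_integral_is_0) (auto simp: \<phi>_zero)
  ultimately show ?thesis by (simp add: partial_laplace_def)
qed

text \<open>Substituting \<open>y = x s\<close> moves the variable upper limit into the integrand;
  continuity of a parameter integral over \<open>[0, 1]\<close> then gives joint continuity in
  \<open>\<kappa>\<close> and \<open>x\<close>.\<close>

lemma J_cont2: "continuous_on (UNIV \<times> {0..b}) (\<lambda>(\<kappa>, x). J \<kappa> x)"
proof -
  have eq: "J \<kappa> x = of_real x * integral {0..1} (\<lambda>s. exp (\<kappa> * of_real (x * s)) * \<phi> (x * s))" if "x \<ge> 0" for \<kappa> x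
  proof -
    have "((\<lambda>s. x *\<^sub>R (\<lambda>y. exp (\<kappa> * of_real y) * \<phi> y) (x * s)) has_integral
        integral {x * 0..x * 1} (\<lambda>y. exp (\<kappa> * of_real y) * \<phi> y)) {0..1}"
      by (rule has_integral_substitution[where c=0 and d=x])
         (use that in \<open>auto intro!: continuous_intros derivative_eq_intros mult_left_le\<close>)
    then have "integral {0..1} (\<lambda>s. x *\<^sub>R (exp (\<kappa> * of_real (x * s)) * \<phi> (x * s))) = J \<kappa> x"
      by (auto simp: partial_laplace_def dest: integral_unique)
    then show ?thesis by (simp add: scaleR_conv_of_real)
  qed
  have "continuous_on (UNIV \<times> {0..b}) (\<lambda>kx. integral (cbox 0 1) (\<lambda>s. exp (fst kx * of_real (snd kx * s)) * \<phi> (snd kx * s)))"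
    by (rule integral_continuous_on_param) (auto intro!: continuous_intros simp: split_beta)
  then have "continuous_on (UNIV \<times> {0..b}) (\<lambda>kx. of_real (snd kx) * integral {0..1} (\<lambda>s. exp (fst kx * of_real (snd kx * s)) * \<phi> (snd kx * s)))"
    by (auto intro!: continuous_intros)
  then show ?thesis
    by (rule continuous_on_eq) (auto simp: eq)
qed

text \<open>This is the convolution of \<open>\<phi>\<close> with the whole-line Green function
  \<open>exp(- \<kappa> |x - y|) / (2 \<kappa>)\<close>, with the integral split at
  \<open>y = x\<close>.\<close>

definition free_solution :: "complex \<Rightarrow> real \<Rightarrow> complex" where
  "free_solution \<kappa> x = (exp (- \<kappa> * of_real x) * J \<kappa> x + exp (\<kappa> * of_real x) * (J (- \<kappa>) q - J (- \<kappa>) x)) / (2 * \<kappa>)"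

definition free_solution' :: "complex \<Rightarrow> real \<Rightarrow> complex" where
  "free_solution' \<kappa> x = (exp (\<kappa> * of_real x) * (J (- \<kappa>) q - J (- \<kappa>) x) - exp (- \<kappa> * of_real x) * J \<kappa> x) / 2"

lemma exp_deriv: "((\<lambda>x. exp (c * of_real x)) has_vector_derivative c * exp (c * of_real x)) (at x)" for c :: complex
proof -
  have "((\<lambda>w. exp (c * w)) has_field_derivative exp (c * of_real x) * c) (at (of_real x))"
    by (auto intro!: derivative_eq_intros)
  from has_vector_derivative_real_field[OF this] show ?thesis by (simp add: mult.commute)
qed

lemma exp_exp_minus: "exp (- \<kappa> * of_real x) * (exp (\<kappa> * of_real x) * w) = w" for \<kappa> w :: complex
  by (simp add: exp_minus flip: mult.assoc)

lemma free_solution_deriv: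
  assumes "\<kappa> \<noteq> 0"
  shows "(free_solution \<kappa> has_vector_derivative free_solution' \<kappa> x) (at x)"
    "(free_solution' \<kappa> has_vector_derivative \<kappa>\<^sup>2 * free_solution \<kappa> x - \<phi> x) (at x)"
proof -
  have 1: "((\<lambda>x. exp (- \<kappa> * of_real x) * J \<kappa> x) has_vector_derivative
      exp (- \<kappa> * of_real x) * (exp (\<kappa> * of_real x) * \<phi> x) + (- \<kappa> * exp (- \<kappa> * of_real x)) * J \<kappa> x) (at x)"
    by (rule has_vector_derivative_mult[OF exp_deriv J_deriv])
  have 2: "((\<lambda>x. exp (\<kappa> * of_real x) * (J (- \<kappa>) q - J (- \<kappa>) x)) has_vector_derivative
      exp (\<kappa> * of_real x) * (0 - exp (- \<kappa> * of_real x) * \<phi> x) + (\<kappa> * exp (\<kappa> * of_real x)) * (J (- \<kappa>) q - J (- \<kappa>) x)) (at x)"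
    by (intro has_vector_derivative_mult[OF exp_deriv] has_vector_derivative_diff J_deriv has_vector_derivative_const)
  have e: "exp (- \<kappa> * of_real x) * (exp (\<kappa> * of_real x) * \<phi> x) = \<phi> x"
      "exp (\<kappa> * of_real x) * (exp (- \<kappa> * of_real x) * \<phi> x) = \<phi> x"
    using exp_exp_minus[of \<kappa> x "\<phi> x"] exp_exp_minus[of "- \<kappa>" x "\<phi> x"] by simp_all
  have s: "((\<lambda>x. f x / c) has_vector_derivative f' / c) (at x)"
    if "(f has_vector_derivative f') (at x)" for f f' and c :: complex
    using has_vector_derivative_mult_left[OF that, of "1 / c"] by simp
  have "(free_solution \<kappa> has_vector_derivative
      ((exp (- \<kappa> * of_real x) * (exp (\<kappa> * of_real x) * \<phi> x) + (- \<kappa> * exp (- \<kappa> * of_real x)) * J \<kappa> x) +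
      (exp (\<kappa> * of_real x) * (0 - exp (- \<kappa> * of_real x) * \<phi> x) + (\<kappa> * exp (\<kappa> * of_real x)) * (J (- \<kappa>) q - J (- \<kappa>) x))) / (2 * \<kappa>)) (at x)"
    unfolding free_solution_def[abs_def] by (intro s has_vector_derivative_add 1 2)
  moreover have "((exp (- \<kappa> * of_real x) * (exp (\<kappa> * of_real x) * \<phi> x) + (- \<kappa> * exp (- \<kappa> * of_real x)) * J \<kappa> x) +
      (exp (\<kappa> * of_real x) * (0 - exp (- \<kappa> * of_real x) * \<phi> x) + (\<kappa> * exp (\<kappa> * of_real x)) * (J (- \<kappa>) q - J (- \<kappa>) x))) / (2 * \<kappa>)
      = free_solution' \<kappa> x"
    unfolding right_diff_distrib e free_solution'_def using assms by (simp add: field_simps)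
  ultimately show "(free_solution \<kappa> has_vector_derivative free_solution' \<kappa> x) (at x)" by simp
  have "(free_solution' \<kappa> has_vector_derivative
      ((exp (\<kappa> * of_real x) * (0 - exp (- \<kappa> * of_real x) * \<phi> x) + (\<kappa> * exp (\<kappa> * of_real x)) * (J (- \<kappa>) q - J (- \<kappa>) x)) -
      (exp (- \<kappa> * of_real x) * (exp (\<kappa> * of_real x) * \<phi> x) + (- \<kappa> * exp (- \<kappa> * of_real x)) * J \<kappa> x)) / 2) (at x)"
    unfolding free_solution'_def[abs_def] by (intro s has_vector_derivative_diff 1 2)
  moreover have "((exp (\<kappa> * of_real x) * (0 - exp (- \<kappa> * of_real x) * \<phi> x) + (\<kappa> * exp (\<kappa> * of_real x)) * (J (- \<kappa>) q - J (- \<kappa>) x)) -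
      (exp (- \<kappa> * of_real x) * (exp (\<kappa> * of_real x) * \<phi> x) + (- \<kappa> * exp (- \<kappa> * of_real x)) * J \<kappa> x)) / 2
      = \<kappa>\<^sup>2 * free_solution \<kappa> x - \<phi> x"
    unfolding right_diff_distrib e free_solution_def using assms by (simp add: field_simps power2_eq_square)
  ultimately show "(free_solution' \<kappa> has_vector_derivative \<kappa>\<^sup>2 * free_solution \<kappa> x - \<phi> x) (at x)" by (simp only:)
qed

lemma free_solution_0: "free_solution \<kappa> 0 = J (- \<kappa>) q / (2 * \<kappa>)" "free_solution' \<kappa> 0 = J (- \<kappa>) q / 2"
  using pq by (simp_all add: free_solution_def free_solution'_def J_0)

lemma free_solution_tail:
  "x \<ge> q \<Longrightarrow> free_solution \<kappa> x = J \<kappa> q / (2 * \<kappa>) * exp (- \<kappa> * of_real x)"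
  "x \<ge> q \<Longrightarrow> free_solution' \<kappa> x = - J \<kappa> q / 2 * exp (- \<kappa> * of_real x)"
  using J_tail[of x \<kappa>] J_tail[of x "- \<kappa>"] by (simp_all add: free_solution_def free_solution'_def)

end

section \<open>Matching the free solution to the vertex condition\<close>

locale star_source = source \<phi> p q for \<phi> p q +
  fixes j :: "'n::finite" and \<alpha> N :: real
  assumes \<alpha>: "\<alpha> > 0" and N: "N = real CARD('n)"
begin

definition f :: "real \<Rightarrow> complex^'n" where
  "f x = (\<chi> l. if l = j then \<phi> x else 0)"

text \<open>This is the common value \<open>B\<close> at the vertex. With the reflected amplitudes
  fixed by continuity, the derivatives at 0 sum to \<open>J (- \<kappa>) q - N \<kappa> B\<close>;
  equating this with \<open>\<alpha> B\<close> determines \<open>B\<close>.\<close>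

definition vertex_amplitude :: "complex \<Rightarrow> complex" where
  "vertex_amplitude \<kappa> = J (- \<kappa>) q / (of_real N * \<kappa> + of_real \<alpha>)"

definition reflected_amplitude :: "complex \<Rightarrow> 'n \<Rightarrow> complex" where
  "reflected_amplitude \<kappa> l = vertex_amplitude \<kappa> - (if l = j then J (- \<kappa>) q / (2 * \<kappa>) else 0)"

definition resolvent :: "complex \<Rightarrow> real \<Rightarrow> complex^'n" where
  "resolvent \<kappa> x = (\<chi> l. (if l = j then free_solution \<kappa> x else 0) + reflected_amplitude \<kappa> l * exp (- \<kappa> * of_real x))"

lemma edge_f: "edge f l = (if l = j then \<phi> else (\<lambda>x. 0))"
  by (auto simp: edge_def f_def)

lemma f_L2: "f \<in> L2"
proof (rule L2_vecI)
  show "edge f l \<in> L2" for l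
  proof (cases "l = j")
    case True
    have "\<phi> \<in> L2" by (rule L2_compact_support[OF \<phi>_cont, where a=p and b=q]) (auto simp: \<phi>_zero)
    then show ?thesis using True by (simp add: edge_f)
  qed (simp add: edge_f L2_zero)
qed

text \<open>Positivity of \<open>\<alpha>\<close> places the zero \<open>- \<alpha> / N\<close> in
  the open left half-plane. The imaginary axis is included because the boundary values are taken
  there.\<close>

lemma denominator_nonzero: "Re \<kappa> \<ge> 0 \<Longrightarrow> of_real N * \<kappa> + of_real \<alpha> \<noteq> 0"
proof
  assume "Re \<kappa> \<ge> 0" "of_real N * \<kappa> + of_real \<alpha> = 0"
  then have "Re (of_real N * \<kappa> + of_real \<alpha>) = 0" by simp
  then have "N * Re \<kappa> + \<alpha> = 0" by simp
  moreover have "N * Re \<kappa> \<ge> 0" using \<open>Re \<kappa> \<ge> 0\<close> N by simp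
  ultimately show False using \<alpha> by linarith
qed

context
  fixes \<kappa> :: complex assumes \<kappa>: "Re \<kappa> > 0"
begin

text \<open>Writing the second derivative through the differential equation reduces its square
  integrability to that of \<open>u\<close> and \<open>f\<close>. Beyond \<open>q\<close> both
  \<open>u\<close> and \<open>u'\<close> are multiples of \<open>exp(- \<kappa> x)\<close>.\<close>

lemma resolvent_edge:
  fixes l
  defines "u \<equiv> edge (resolvent \<kappa>) l"
    and "u' \<equiv> \<lambda>x. (if l = j then free_solution' \<kappa> x else 0) - \<kappa> * reflected_amplitude \<kappa> l * exp (- \<kappa> * of_real x)"
    and "u'' \<equiv> \<lambda>x. \<kappa>\<^sup>2 * edge (resolvent \<kappa>) l x - edge f l x"
  shows "u \<in> sobolev_H2" "weak_deriv u \<simeq> u'" "weak_deriv (weak_deriv u) \<simeq> u''"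
    "continuous_on {0..} u" "continuous_on {0..} u'" "u \<in> L2"
proof -
  define C where "C = reflected_amplitude \<kappa> l"
  have \<kappa>0: "\<kappa> \<noteq> 0" using \<kappa> by auto
  have u: "u = (\<lambda>x. (if l = j then free_solution \<kappa> x else 0) + C * exp (- \<kappa> * of_real x))"
    by (simp add: u_def edge_def resolvent_def C_def)
  have u': "u' = (\<lambda>x. (if l = j then free_solution' \<kappa> x else 0) - \<kappa> * C * exp (- \<kappa> * of_real x))"
    by (simp add: u'_def C_def)
  have e: "((\<lambda>x. C * exp (- \<kappa> * of_real x)) has_vector_derivative C * (- \<kappa> * exp (- \<kappa> * of_real x))) (at x)" for C x
    by (rule has_vector_derivative_mult_right[OF exp_deriv])
  have du: "(u has_vector_derivative u' x) (at x)" for x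
  proof (cases "l = j")
    case True
    then show ?thesis
      unfolding u u' using has_vector_derivative_add[OF free_solution_deriv(1)[OF \<kappa>0] e[of C x]] by (simp add: algebra_simps)
  next
    case False
    then show ?thesis unfolding u u' using e[of C x] by (simp add: algebra_simps)
  qed
  have du': "(u' has_vector_derivative u'' x) (at x)" for x
  proof (cases "l = j")
    case True
    then show ?thesis
      unfolding u' u''_def u_def[symmetric] u
      using has_vector_derivative_diff[OF free_solution_deriv(2)[OF \<kappa>0] e[of "\<kappa> * C" x]] by (simp add: algebra_simps power2_eq_square edge_f)
  next
    case False
    then show ?thesis
      unfolding u' u''_def u_def[symmetric] u
      using e[of "- \<kappa> * C" x] by (simp add: algebra_simps power2_eq_square edge_f)
  qed
  have cu: "continuous_on UNIV u" "continuous_on UNIV u'"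
    using du du' by (auto intro!: continuous_at_imp_continuous_on has_vector_derivative_continuous)
  then show "continuous_on {0..} u" "continuous_on {0..} u'" by (auto intro: continuous_on_subset)
  show uL: "u \<in> L2"
    by (rule L2_exp_tail[OF cu(1) _ \<kappa>, where q=q and A="(if l = j then J \<kappa> q / (2 * \<kappa>) else 0) + C"])
       (auto simp: u free_solution_tail distrib_right)
  have u'L: "u' \<in> L2"
    by (rule L2_exp_tail[OF cu(2) _ \<kappa>, where q=q and A="(if l = j then - J \<kappa> q / 2 else 0) - \<kappa> * C"])
       (auto simp: u' free_solution_tail algebra_simps)
  have u''L: "u'' \<in> L2"
    unfolding u''_def u_def[symmetric] by (intro L2_diff L2_mult uL L2_edge f_L2)
  have cu'': "continuous_on {0<..} u''"
    unfolding u''_def u_def[symmetric] edge_f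
    by (intro continuous_intros continuous_on_subset[OF cu(1)]) (auto intro: continuous_on_subset[OF \<phi>_cont])
  show "u \<in> sobolev_H2" "weak_deriv u \<simeq> u'" "weak_deriv (weak_deriv u) \<simeq> u''"
    using sobolev_H2I_classical[OF du du' cu'' uL u'L u''L] by auto
qed

lemma resolvent_star_dom: "resolvent \<kappa> \<in> star_dom \<alpha>"
proof -
  define B where "B = vertex_amplitude \<kappa>"
  define d where "d l = (if l = j then J (- \<kappa>) q else 0) - \<kappa> * B" for l
  have \<kappa>0: "\<kappa> \<noteq> 0" using \<kappa> by auto
  have 1: "vertex_value (edge (resolvent \<kappa>) l) B" for l
    unfolding vertex_value_def using resolvent_edge(4)[of l]
    by (intro exI[of _ "edge (resolvent \<kappa>) l"])
       (auto simp: edge_def resolvent_def reflected_amplitude_def B_def free_solution_0)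
  have 2: "vertex_value (weak_deriv (edge (resolvent \<kappa>) l)) (d l)" for l
    unfolding vertex_value_def
    by (rule exI, intro conjI, rule resolvent_edge(5)[of l], rule L2_eq_sym[OF resolvent_edge(2)])
       (use \<kappa>0 in \<open>auto simp: d_def reflected_amplitude_def B_def free_solution_0 field_simps\<close>)
  have "(\<Sum>l\<in>UNIV. d l) = J (- \<kappa>) q - of_real N * \<kappa> * B"
    by (simp add: d_def sum_subtractf N)
  also have "\<dots> = of_real \<alpha> * B"
  proof -
    have "(of_real N * \<kappa> + of_real \<alpha>) * B = J (- \<kappa>) q"
      unfolding B_def vertex_amplitude_def using denominator_nonzero[of \<kappa>] \<kappa> by simp
    then show ?thesis by (simp add: algebra_simps)
  qed
  finally have 3: "(\<Sum>l\<in>UNIV. d l) = of_real \<alpha> * B" .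
  show ?thesis
    unfolding star_dom_def mem_Collect_eq
    by (intro conjI allI resolvent_edge(1) exI[of _ B] exI[of _ d] 1 2 3)
qed

lemma resolvent_equation: "f \<simeq> (\<lambda>x. star_op (resolvent \<kappa>) x - (- \<kappa>\<^sup>2) *s resolvent \<kappa> x)"
proof (rule L2_eq_vecI)
  fix l
  have "(\<lambda>x. - weak_deriv (weak_deriv (edge (resolvent \<kappa>) l)) x + \<kappa>\<^sup>2 * edge (resolvent \<kappa>) l x)
      \<simeq> (\<lambda>x. - (\<kappa>\<^sup>2 * edge (resolvent \<kappa>) l x - edge f l x) + \<kappa>\<^sup>2 * edge (resolvent \<kappa>) l x)"
    by (rule L2_eq_comp[OF resolvent_edge(3), where f="\<lambda>x y. - y + \<kappa>\<^sup>2 * edge (resolvent \<kappa>) l x"])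
  moreover have "(\<lambda>x. - (\<kappa>\<^sup>2 * edge (resolvent \<kappa>) l x - edge f l x) + \<kappa>\<^sup>2 * edge (resolvent \<kappa>) l x) = edge f l"
    by simp
  moreover have "edge (\<lambda>x. star_op (resolvent \<kappa>) x - (- \<kappa>\<^sup>2) *s resolvent \<kappa> x) l =
      (\<lambda>x. - weak_deriv (weak_deriv (edge (resolvent \<kappa>) l)) x + \<kappa>\<^sup>2 * edge (resolvent \<kappa>) l x)"
    by (simp add: edge_def star_op_def)
  ultimately show "edge f l \<simeq> edge (\<lambda>x. star_op (resolvent \<kappa>) x - (- \<kappa>\<^sup>2) *s resolvent \<kappa> x) l"
    by (simp only: L2_eq_sym)
qed

end

end

subsection \<open>Boundary values of the resolvent\<close>

context star_source begin

text \<open>The inner product \<open><resolvent, f>\<close>, written with integrals over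
  \<open>[0, q]\<close> so that it keeps its meaning on the imaginary axis, where the exponentials
  no longer decay.\<close>

definition green_form :: "complex \<Rightarrow> complex" where
  "green_form \<kappa> = integral {0..q} (\<lambda>x. free_solution \<kappa> x * \<phi> x) + reflected_amplitude \<kappa> j * J (- \<kappa>) q"

lemma inner_resolvent:
  assumes \<kappa>: "Re \<kappa> > 0"
  shows "L2_inner (resolvent \<kappa>) f = green_form \<kappa>"
proof -
  have \<kappa>0: "\<kappa> \<noteq> 0" using \<kappa> by auto
  have fc: "continuous_on S (free_solution \<kappa>)" for S
    by (intro continuous_at_imp_continuous_on ballI has_vector_derivative_continuous[OF free_solution_deriv(1)[OF \<kappa>0]])
  let ?r = "\<lambda>x. free_solution \<kappa> x + reflected_amplitude \<kappa> j * exp (- \<kappa> * of_real x)"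
  have rc: "continuous_on {0..q} (\<lambda>x. ?r x * \<phi> x)"
    by (intro continuous_intros fc)
  have sum: "(\<Sum>l\<in>UNIV. resolvent \<kappa> x $ l * cnj (f x $ l)) = ?r x * \<phi> x" for x
    by (simp add: resolvent_def f_def \<phi>_real if_distrib[where f=cnj] if_distrib[where f="\<lambda>c. _ * c"] cong: if_cong)
  have "L2_inner (resolvent \<kappa>) f = (\<integral>x. indicator {0<..} x *\<^sub>R (?r x * \<phi> x) \<partial>lborel)"
    unfolding L2_inner_def half_line_integral sum ..
  also have "\<dots> = (\<integral>x. indicator {0..q} x *\<^sub>R (?r x * \<phi> x) \<partial>lborel)"
  proof (rule Bochner_Integration.integral_cong[OF refl])
    show "indicator {0<..} x *\<^sub>R (?r x * \<phi> x) = indicator {0..q} x *\<^sub>R (?r x * \<phi> x)" for x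
      using \<phi>_zero[of x] pq by (cases "x \<in> {p<..<q}") (auto simp: indicator_def)
  qed
  also have "\<dots> = integral {0..q} (\<lambda>x. ?r x * \<phi> x)"
    using set_borel_integral_eq_integral(2)[of "{0..q}" "\<lambda>x. ?r x * \<phi> x"] borel_integrable_compact[OF _ rc]
    by (simp add: set_integrable_def set_lebesgue_integral_def)
  also have "\<dots> = integral {0..q} (\<lambda>x. free_solution \<kappa> x * \<phi> x + reflected_amplitude \<kappa> j * (exp (- \<kappa> * of_real x) * \<phi> x))"
    by (simp add: distrib_right mult.assoc)
  also have "\<dots> = integral {0..q} (\<lambda>x. free_solution \<kappa> x * \<phi> x) + integral {0..q} (\<lambda>x. reflected_amplitude \<kappa> j * (exp (- \<kappa> * of_real x) * \<phi> x))"
    by (intro Henstock_Kurzweil_Integration.integral_add integrable_continuous_interval continuous_intros fc)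
  also have "integral {0..q} (\<lambda>x. reflected_amplitude \<kappa> j * (exp (- \<kappa> * of_real x) * \<phi> x)) = reflected_amplitude \<kappa> j * J (- \<kappa>) q"
    by (simp add: partial_laplace_def)
  finally show ?thesis by (simp add: green_form_def)
qed

lemma J_cont_comp:
  assumes "continuous_on S g" "continuous_on S h" "\<And>s. s \<in> S \<Longrightarrow> 0 \<le> h s \<and> h s \<le> q"
  shows "continuous_on S (\<lambda>s. J (g s) (h s))"
proof -
  have "continuous_on S (\<lambda>s. (g s, h s))" by (intro continuous_intros assms)
  from continuous_on_compose2[OF J_cont2[of q] this] assms(3) show ?thesis by (auto simp: image_subset_iff)
qed

lemma green_form_cont:
  "continuous_on {\<kappa>. \<kappa> \<noteq> 0 \<and> of_real N * \<kappa> + of_real \<alpha> \<noteq> 0} green_form"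
proof -
  let ?S = "{\<kappa>. \<kappa> \<noteq> 0 \<and> of_real N * \<kappa> + of_real \<alpha> \<noteq> 0}"
  have q: "continuous_on S (\<lambda>s. J (g s) q)" if "continuous_on S g" for S :: "'b::topological_space set" and g
    by (rule J_cont_comp[OF that continuous_on_const]) (use pq in auto)
  have "continuous_on ?S (\<lambda>\<kappa>. integral (cbox 0 q) (\<lambda>x. free_solution \<kappa> x * \<phi> x))"
    unfolding free_solution_def
    by (rule integral_continuous_on_param)
       (auto intro!: continuous_intros J_cont_comp q simp: split_beta)
  then show ?thesis
    unfolding green_form_def[abs_def] reflected_amplitude_def vertex_amplitude_def
    by (auto intro!: continuous_intros q)
qed

lemma J_cnj: "J (cnj \<kappa>) x = cnj (J \<kappa> x)"
  unfolding partial_laplace_def Henstock_Kurzweil_Integration.integral_cnj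
  by (simp add: exp_cnj \<phi>_real)

text \<open>On the imaginary axis the free Green function is
  \<open>i exp(i \<omega> |x - y|) / (2 \<omega>)\<close>. Its imaginary part
  \<open>cos(\<omega> (x - y)) / (2 \<omega>)\<close> no longer sees the split at
  \<open>y = x\<close>, so the double integral factors into \<open>|Q|^2\<close>.\<close>

lemma Im_green_form:
  assumes \<omega>: "\<omega> > 0"
  defines "Q \<equiv> J (\<i> * of_real \<omega>) q"
  shows "Im (green_form (- \<i> * of_real \<omega>)) = (norm Q)\<^sup>2 / (2 * \<omega>)
    + Im (Q\<^sup>2 * (1 / (of_real \<alpha> - \<i> * of_real (N * \<omega>)) - \<i> / of_real (2 * \<omega>)))"
proof -
  define \<kappa> where "\<kappa> = - \<i> * of_real \<omega>"
  have \<kappa>0: "\<kappa> \<noteq> 0" and m: "- \<kappa> = \<i> * of_real \<omega>" and c: "cnj (\<i> * of_real \<omega>) = \<kappa>" using \<omega> by (simp_all add: \<kappa>_def)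
  have inv: "1 / (2 * \<kappa>) = \<i> / of_real (2 * \<omega>)"
    using \<omega> by (simp add: \<kappa>_def field_simps)
  have fc: "continuous_on S (free_solution \<kappa>)" for S
    by (intro continuous_at_imp_continuous_on ballI has_vector_derivative_continuous[OF free_solution_deriv(1)[OF \<kappa>0]])
  have Qm: "J (- \<kappa>) q = Q" by (simp add: Q_def m)
  have pw: "Im (free_solution \<kappa> x * \<phi> x) = Re (Q * cnj (exp (- \<kappa> * of_real x) * \<phi> x)) / (2 * \<omega>)" for x
  proof -
    define e where "e = exp (- \<kappa> * of_real x)"
    define r where "r = Re (\<phi> x)"
    define Jx where "Jx = J (- \<kappa>) x"
    have \<phi>r: "\<phi> x = of_real r" using \<phi>_real[of x] by (simp add: r_def complex_eq_iff)
    have e': "exp (\<kappa> * of_real x) = cnj e"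
      by (simp add: e_def exp_cnj \<kappa>_def)
    have J': "J \<kappa> x = cnj Jx" unfolding Jx_def m using J_cnj[of "\<i> * of_real \<omega>" x] c by simp
    have "free_solution \<kappa> x = 1 / (2 * \<kappa>) * (e * cnj Jx + cnj e * (Q - Jx))"
      unfolding free_solution_def e_def[symmetric] e' J' Jx_def[symmetric] Qm by simp
    also have "\<dots> = \<i> / of_real (2 * \<omega>) * (e * cnj Jx + cnj e * (Q - Jx))" by (simp only: inv)
    finally have "Im (free_solution \<kappa> x) = Re (e * cnj Jx + cnj e * (Q - Jx)) / (2 * \<omega>)"
      by (simp add: Im_divide_of_real)
    \<comment> \<open>The terms with \<open>Jx\<close> are a number minus its conjugate, so only the
      complete integral \<open>Q\<close> remains in the real part.\<close>
    also have "Re (e * cnj Jx + cnj e * (Q - Jx)) = Re (Q * cnj e)" by (simp add: algebra_simps)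
    finally show ?thesis unfolding e_def[symmetric] \<phi>r by (simp add: algebra_simps)
  qed
  \<comment> \<open>Only a real-linear functional, because of the conjugation; that is enough to
    exchange it with the integral.\<close>
  define h where "h w = Re (Q * cnj w) / (2 * \<omega>)" for w
  have bl: "bounded_linear h"
    unfolding h_def
    by (rule bounded_linear_compose[OF bounded_linear_divide bounded_linear_compose[OF bounded_linear_Re
          bounded_linear_compose[OF bounded_linear_mult_right bounded_linear_cnj]]])
  have Qint: "integral {0..q} (\<lambda>x. exp (- \<kappa> * of_real x) * \<phi> x) = Q"
    by (simp add: Q_def partial_laplace_def m)
  have "Im (integral {0..q} (\<lambda>x. free_solution \<kappa> x * \<phi> x)) = integral {0..q} (Im \<circ> (\<lambda>x. free_solution \<kappa> x * \<phi> x))"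
    by (intro Henstock_Kurzweil_Integration.integral_linear[symmetric] bounded_linear_Im integrable_continuous_interval continuous_intros fc)
  also have "\<dots> = integral {0..q} (h \<circ> (\<lambda>x. exp (- \<kappa> * of_real x) * \<phi> x))"
    using pw by (simp add: o_def h_def)
  also have "\<dots> = h Q"
    by (subst Henstock_Kurzweil_Integration.integral_linear[OF _ bl])
       (auto simp: Qint[symmetric] intro!: integrable_continuous_interval continuous_intros)
  also have "h Q = (norm Q)\<^sup>2 / (2 * \<omega>)"
    by (simp add: h_def complex_norm_square[symmetric] flip: of_real_power)
  finally have 1: "Im (integral {0..q} (\<lambda>x. free_solution \<kappa> x * \<phi> x)) = (norm Q)\<^sup>2 / (2 * \<omega>)" .
  have "reflected_amplitude \<kappa> j * J (- \<kappa>) q = Q\<^sup>2 * (1 / (of_real N * \<kappa> + of_real \<alpha>) - 1 / (2 * \<kappa>))"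
    by (simp add: reflected_amplitude_def vertex_amplitude_def Q_def m power2_eq_square right_diff_distrib left_diff_distrib)
  also have "of_real N * \<kappa> + of_real \<alpha> = of_real \<alpha> - \<i> * of_real (N * \<omega>)" by (simp add: \<kappa>_def)
  finally show ?thesis
    unfolding \<kappa>_def[symmetric] green_form_def inv using 1 by simp
qed

text \<open>The root of \<open>\<kappa>^2 = - (s + i \<epsilon>)\<close> for which \<open>exp(- \<kappa> x)\<close> decays.\<close>
definition spectral_kappa :: "real \<Rightarrow> real \<Rightarrow> complex" where
  "spectral_kappa \<epsilon> s = - \<i> * csqrt (Complex s \<epsilon>)"

lemma spectral_kappa_square: "- (spectral_kappa \<epsilon> s)\<^sup>2 = Complex s \<epsilon>"
  by (simp add: spectral_kappa_def power_mult_distrib)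

text \<open>The principal root \<open>w\<close> has \<open>Re w \<ge> 0\<close>, and
  \<open>2 Re w Im w = \<epsilon> > 0\<close> forces \<open>Im w > 0\<close>, which is the real part
  of \<open>- i w\<close>.\<close>

lemma Re_spectral_kappa: "\<epsilon> > 0 \<Longrightarrow> Re (spectral_kappa \<epsilon> s) > 0"
proof -
  assume \<epsilon>: "\<epsilon> > 0"
  define w where "w = csqrt (Complex s \<epsilon>)"
  have "w\<^sup>2 = Complex s \<epsilon>" by (simp add: w_def)
  then have "Im (w * w) = \<epsilon>" by (simp add: power2_eq_square)
  then have w: "2 * (Re w * Im w) = \<epsilon>" by (simp add: mult.commute)
  have "Re w \<ge> 0" using csqrt_principal[of "Complex s \<epsilon>"] unfolding w_def[symmetric] by auto
  moreover have "Re w * Im w > 0" using w \<epsilon> by simp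
  ultimately have "Im w > 0" by (auto simp: zero_less_mult_iff)
  then show ?thesis by (simp add: spectral_kappa_def w_def[symmetric])
qed

lemma spectral_kappa_0: "s > 0 \<Longrightarrow> spectral_kappa 0 s = - \<i> * of_real (sqrt s)"
  by (simp add: spectral_kappa_def)

text \<open>The bound \<open>s \<ge> a > 0\<close> keeps \<open>s + i \<epsilon>\<close> away from
  the branch cut, including at \<open>\<epsilon> = 0\<close>. Joint continuity on this compact
  rectangle later justifies passing to the limit under the integral.\<close>

lemma green_form_spectral_kappa_cont:
  assumes "0 < a"
  shows "continuous_on ({0..1} \<times> {a..b}) (\<lambda>(\<epsilon>, s). green_form (spectral_kappa \<epsilon> s))"
proof -
  have c: "continuous_on {z. Re z > 0} csqrt"
    by (intro continuous_at_imp_continuous_on ballI continuous_at_csqrt) (auto simp: complex_nonpos_Reals_iff)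
  have "continuous_on ({0..1} \<times> {a..b}) (\<lambda>x. csqrt (Complex (snd x) (fst x)))"
  proof (rule continuous_on_compose2[OF c])
    show "continuous_on ({0..1} \<times> {a..b}) (\<lambda>x. Complex (snd x) (fst x))"
      unfolding Complex_eq by (intro continuous_intros)
  qed (use assms in auto)
  then have k: "continuous_on ({0..1} \<times> {a..b}) (\<lambda>x. spectral_kappa (fst x) (snd x))"
    unfolding spectral_kappa_def by (intro continuous_intros)
  have mem: "spectral_kappa \<epsilon> s \<noteq> 0 \<and> of_real N * spectral_kappa \<epsilon> s + of_real \<alpha> \<noteq> 0" if "\<epsilon> \<ge> 0" "s > 0" for \<epsilon> s
  proof
    show "spectral_kappa \<epsilon> s \<noteq> 0" using that by (auto simp: spectral_kappa_def complex_eq_iff)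
    have "Re (spectral_kappa \<epsilon> s) \<ge> 0"
      using Re_spectral_kappa[of \<epsilon> s] spectral_kappa_0[of s] that by (cases "\<epsilon> = 0") auto
    then show "of_real N * spectral_kappa \<epsilon> s + of_real \<alpha> \<noteq> 0" by (rule denominator_nonzero)
  qed
  show ?thesis
    unfolding split_beta
    by (rule continuous_on_compose2[OF green_form_cont k]) (use mem assms in auto)
qed

text \<open>With \<open>z = - \<kappa>^2 = s + i \<epsilon>\<close>, the Poisson integral of the
  spectral distribution is the imaginary part of \<open>green_form\<close>. Inversion recovers the
  measure from these integrals, while continuity up to \<open>\<epsilon> = 0\<close> evaluates the
  same limit explicitly.\<close>

theorem Stone_formula:
  assumes E: "is_spectral_measure (star_dom \<alpha>) star_op E" and ab: "0 < a" "a < b"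
    and atoms: "emeasure (spectral_distribution E f) {a} = 0" "emeasure (spectral_distribution E f) {b} = 0"
  shows "pi * measure (spectral_distribution E f) {a<..b} =
     integral {a..b} (\<lambda>s. Im (green_form (- \<i> * of_real (sqrt s))))"
proof -
  interpret spectral_resolution "star_dom \<alpha>" star_op E
    by (rule spectral_resolution.intro[OF E star_dom_linear star_op_L2])
  interpret fm: finite_measure "\<mu> f" by (rule finite_\<mu>[OF f_L2])
  let ?\<epsilon> = "\<lambda>n. 1 / real (Suc n)"
  let ?G = "\<lambda>\<epsilon> s. Im (green_form (spectral_kappa \<epsilon> s))"
  have pois: "(\<integral>\<^sup>+t. ennreal (\<epsilon> / ((t - s)\<^sup>2 + \<epsilon>\<^sup>2)) \<partial>\<mu> f) = ennreal (?G \<epsilon> s) \<and> ?G \<epsilon> s \<ge> 0"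
    if \<epsilon>: "\<epsilon> > 0" for \<epsilon> s
  proof -
    let ?k = "spectral_kappa \<epsilon> s"
    note Rk = Re_spectral_kappa[OF \<epsilon>, of s]
    have eq: "f \<simeq> (\<lambda>x. star_op (resolvent ?k) x - Complex s \<epsilon> *s resolvent ?k x)"
      using resolvent_equation[OF Rk] unfolding spectral_kappa_square .
    from nn_integral_Poisson[OF resolvent_star_dom[OF Rk] f_L2 eq] \<epsilon>
    show ?thesis by (simp add: inner_resolvent[OF Rk])
  qed
  have cont: "continuous_on ({0..1} \<times> {a..b}) (\<lambda>(\<epsilon>, s). ?G \<epsilon> s)"
    using continuous_on_Im[OF green_form_spectral_kappa_cont[OF ab(1), of b]] by (simp add: split_beta)
  have contn: "continuous_on {a..b} (?G (?\<epsilon> n))" for n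
  proof -
    have "continuous_on {a..b} (\<lambda>s. (?\<epsilon> n, s))" by (intro continuous_intros)
    moreover have "(\<lambda>s. (?\<epsilon> n, s)) ` {a..b} \<subseteq> {0..1} \<times> {a..b}" by auto
    ultimately show ?thesis using continuous_on_compose2[OF cont] by fastforce
  qed
  have contI: "continuous_on {0..1} (\<lambda>\<epsilon>. integral {a..b} (?G \<epsilon>))"
    using integral_continuous_on_param[of "{0..1}" a b ?G] cont by simp
  have "(\<lambda>n. integral {a..b} (?G (?\<epsilon> n))) \<longlonglongrightarrow> integral {a..b} (?G 0)"
    by (rule continuous_on_tendsto_compose[OF contI])
       (use LIMSEQ_inverse_real_of_nat in \<open>auto simp: inverse_eq_divide\<close>)
  then have L1: "(\<lambda>n. ennreal (integral {a..b} (?G (?\<epsilon> n)))) \<longlonglongrightarrow> ennreal (integral {a..b} (?G 0))"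
    by (rule tendsto_ennrealI)
  have "(\<integral>\<^sup>+s. (\<integral>\<^sup>+t. ennreal (?\<epsilon> n / ((t - s)\<^sup>2 + (?\<epsilon> n)\<^sup>2)) \<partial>\<mu> f) * indicator {a..b} s \<partial>lborel)
      = ennreal (integral {a..b} (?G (?\<epsilon> n)))" for n
  proof -
    have e: "?\<epsilon> n > 0" by simp
    from contn have "(?G (?\<epsilon> n) has_integral integral {a..b} (?G (?\<epsilon> n))) {a..b}"
      by (intro integrable_integral integrable_continuous_interval)
    from nn_integral_has_integral_lebesgue'[OF _ this] pois[OF e] show ?thesis by simp
  qed
  then have "(\<lambda>n. ennreal (integral {a..b} (?G (?\<epsilon> n)))) \<longlonglongrightarrow> ennreal pi * emeasure (\<mu> f) {a<..b}"
    using Stieltjes_inversion[OF fm.finite_measure_axioms sets_\<mu> ab(2) atoms] by simp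
  from LIMSEQ_unique[OF this L1]
  have "ennreal (pi * measure (\<mu> f) {a<..b}) = ennreal (integral {a..b} (?G 0))"
    by (simp add: fm.emeasure_eq_measure ennreal_mult)
  \<comment> \<open>The limits were compared in \<open>ennreal\<close>, which identifies all
    negative numbers with 0; nonnegativity is needed to return to the reals.\<close>
  moreover have "integral {a..b} (?G 0) \<ge> 0"
  proof (rule tendsto_lowerbound[OF \<open>(\<lambda>n. integral {a..b} (?G (?\<epsilon> n))) \<longlonglongrightarrow> integral {a..b} (?G 0)\<close>])
    show "\<forall>\<^sub>F n in sequentially. 0 \<le> integral {a..b} (?G (?\<epsilon> n))"
    proof (rule always_eventually, rule allI)
      fix n
      have e: "?\<epsilon> n > 0" by simp
      show "0 \<le> integral {a..b} (?G (?\<epsilon> n))"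
        using pois[OF e] by (intro Henstock_Kurzweil_Integration.integral_nonneg integrable_continuous_interval contn) simp
    qed
  qed simp
  ultimately have "pi * measure (\<mu> f) {a<..b} = integral {a..b} (?G 0)" by simp
  also have "\<dots> = integral {a..b} (\<lambda>s. Im (green_form (- \<i> * of_real (sqrt s))))"
    using ab by (intro Henstock_Kurzweil_Integration.integral_cong) (simp add: spectral_kappa_0)
  finally show ?thesis .
qed

end

subsection \<open>The spectral density\<close>

text \<open>Applied with an indicator weight in \<open>\<omega>\<close> and with the bump as weight
  in \<open>x\<close> and \<open>y\<close>. Closeness to \<open>c\<close> is required only where the
  weight is nonzero, since it is known only on the support.\<close>

lemma weighted_mean_bound:
  fixes h :: "'a \<Rightarrow> complex" and w :: "'a \<Rightarrow> real"
  assumes w: "integrable M w" "\<And>x. w x \<ge> 0" and hw: "integrable M (\<lambda>x. h x * of_real (w x))"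
    and bound: "AE x in M. w x \<noteq> 0 \<longrightarrow> norm (h x - c) \<le> \<eta>"
  shows "norm ((\<integral>x. h x * of_real (w x) \<partial>M) - c * of_real (\<integral>x. w x \<partial>M)) \<le> \<eta> * (\<integral>x. w x \<partial>M)"
proof -
  have cw: "integrable M (\<lambda>x. c * of_real (w x))" using w(1) by simp
  have "(\<integral>x. h x * of_real (w x) \<partial>M) - c * of_real (\<integral>x. w x \<partial>M) = (\<integral>x. h x * of_real (w x) - c * of_real (w x) \<partial>M)"
    using hw cw by simp
  also have "norm \<dots> \<le> (\<integral>x. norm (h x * of_real (w x) - c * of_real (w x)) \<partial>M)"
    by (rule integral_norm_bound)
  also have "\<dots> \<le> (\<integral>x. \<eta> * w x \<partial>M)"
  proof (rule integral_mono_AE)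
    show "AE x in M. norm (h x * of_real (w x) - c * of_real (w x)) \<le> \<eta> * w x"
      using bound
    proof eventually_elim
      case (elim x)
      have "norm (h x * of_real (w x) - c * of_real (w x)) = norm (h x - c) * w x"
        using w(2)[of x] by (simp add: norm_mult flip: left_diff_distrib)
      also have "\<dots> \<le> \<eta> * w x" using elim w(2)[of x] by (cases "w x = 0") (auto intro: mult_right_mono)
      finally show ?case .
    qed
  qed (use hw cw w in auto)
  finally show ?thesis by simp
qed

section \<open>Averages over small windows\<close>

locale positive_star_source = star_source \<phi> p q j \<alpha> N
  for \<phi> p q and j :: "'n::finite" and \<alpha> N +
  assumes \<phi>_nonneg: "Re (\<phi> x) \<ge> 0" and \<phi>_test: "\<phi> \<in> test_functions"
begin

definition mass :: real where "mass = (\<integral>x. Re (\<phi> x) \<partial>half_line)"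

lemma \<phi>_of_real: "of_real (Re (\<phi> x)) = \<phi> x"
  using \<phi>_real[of x] by (simp add: complex_eq_iff)

lemma \<phi>_support: "Re (\<phi> x) \<noteq> 0 \<Longrightarrow> x \<in> {p<..<q}"
  using \<phi>_zero[of x] by (cases "x \<in> {p<..<q}") auto

lemma half_line_integral_source:
  assumes h: "continuous_on {0..q} h"
  shows "integrable half_line (\<lambda>x. h x * \<phi> x)"
    and "(\<integral>x. h x * \<phi> x \<partial>half_line) = integral {0..q} (\<lambda>x. h x * \<phi> x)"
proof -
  have eq: "indicator {0<..} x *\<^sub>R (h x * \<phi> x) = indicator {0..q} x *\<^sub>R (h x * \<phi> x)" for x
    using \<phi>_zero[of x] pq by (cases "x \<in> {p<..<q}") (auto simp: indicator_def)
  have int: "integrable lborel (\<lambda>x. indicator {0..q} x *\<^sub>R (h x * \<phi> x))"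
    by (intro borel_integrable_compact continuous_intros h) auto
  then show "integrable half_line (\<lambda>x. h x * \<phi> x)"
    unfolding half_line_integrable eq .
  show "(\<integral>x. h x * \<phi> x \<partial>half_line) = integral {0..q} (\<lambda>x. h x * \<phi> x)"
    unfolding half_line_integral eq
    using set_borel_integral_eq_integral(2)[of "{0..q}" "\<lambda>x. h x * \<phi> x"] int
    by (simp add: set_integrable_def set_lebesgue_integral_def)
qed

lemma Re_\<phi>_integrable: "integrable half_line (\<lambda>x. Re (\<phi> x))"
  using half_line_integral_source(1)[of "\<lambda>x. 1"] by simp

lemma J_near:
  assumes "\<And>y. y \<in> {p<..<q} \<Longrightarrow> norm (exp (\<kappa> * of_real y) - v) \<le> \<delta>"
  shows "norm (J \<kappa> q - v * of_real mass) \<le> \<delta> * mass"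
proof -
  have c: "continuous_on {0..q} (\<lambda>y. exp (\<kappa> * of_real y))" by (intro continuous_intros)
  have JE: "J \<kappa> q = (\<integral>y. exp (\<kappa> * of_real y) * of_real (Re (\<phi> y)) \<partial>half_line)"
    unfolding partial_laplace_def \<phi>_of_real half_line_integral_source(2)[OF c] ..
  show ?thesis
    unfolding JE mass_def
  proof (rule weighted_mean_bound[OF Re_\<phi>_integrable \<phi>_nonneg])
    show "integrable half_line (\<lambda>y. exp (\<kappa> * of_real y) * of_real (Re (\<phi> y)))"
      unfolding \<phi>_of_real by (rule half_line_integral_source(1)[OF c])
    show "AE y in half_line. Re (\<phi> y) \<noteq> 0 \<longrightarrow> norm (exp (\<kappa> * of_real y) - v) \<le> \<delta>"
      using assms \<phi>_support by (intro AE_I2) blast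
  qed
qed

text \<open>The source lives on edge \<open>j\<close>, so the form of the spectral projection at
  \<open>f\<close> is a triple integral of the single entry
  \<open>\<sigma> \<omega> x y $ j $ j\<close>. Bounding the mean successively in
  \<open>\<omega>\<close>, \<open>y\<close> and \<open>x\<close> produces the factors
  \<open>sqrt b - sqrt a\<close>, \<open>mass\<close> and \<open>mass\<close>.\<close>

lemma kernel_average:
  fixes \<sigma> :: "real \<Rightarrow> real \<Rightarrow> real \<Rightarrow> complex^'n^'n"
  assumes E: "is_spectral_measure (star_dom \<alpha>) star_op E"
    and int: "\<And>\<Lambda> x y. \<Lambda> > 0 \<Longrightarrow> x > 0 \<Longrightarrow> y > 0 \<Longrightarrow> set_integrable lborel {0<..sqrt \<Lambda>} (\<lambda>\<omega>. \<sigma> \<omega> x y $ j $ j)"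
    and int_y: "\<And>\<Lambda> x. \<Lambda> > 0 \<Longrightarrow> x > 0 \<Longrightarrow> integrable half_line (\<lambda>y. (LBINT \<omega>:{0<..sqrt \<Lambda>}. \<sigma> \<omega> x y $ j $ j) * \<phi> y)"
    and kernel: "\<And>\<Lambda>. \<Lambda> > 0 \<Longrightarrow> E {0..\<Lambda>} f \<simeq>
       (\<lambda>x. \<chi> i. \<Sum>l\<in>UNIV. \<integral>y. (LBINT \<omega>:{0<..sqrt \<Lambda>}. \<sigma> \<omega> x y $ i $ l) * f y $ l \<partial>half_line)"
    and ab: "0 < a" "a < b"
    and near: "\<And>\<omega> x y. \<omega> \<in> {sqrt a<..sqrt b} \<Longrightarrow> x \<in> {p<..<q} \<Longrightarrow> y \<in> {p<..<q} \<Longrightarrow> norm (\<sigma> \<omega> x y $ j $ j - c) \<le> \<eta>"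
  shows "norm (of_real (measure (spectral_distribution E f) {a<..b}) - c * of_real (mass\<^sup>2 * (sqrt b - sqrt a)))
     \<le> \<eta> * (mass\<^sup>2 * (sqrt b - sqrt a))"
proof -
  interpret spectral_resolution "star_dom \<alpha>" star_op E
    by (rule spectral_resolution.intro[OF E star_dom_linear star_op_L2])
  interpret fm: finite_measure "\<mu> f" by (rule finite_\<mu>[OF f_L2])
  define \<Delta> where "\<Delta> = sqrt b - sqrt a"
  have \<Delta>: "\<Delta> > 0" using ab by (simp add: \<Delta>_def)
  define K where "K \<Lambda> x y = (LBINT \<omega>:{0<..sqrt \<Lambda>}. \<sigma> \<omega> x y $ j $ j)" for \<Lambda> x y
  have b: "b > 0" using ab by simp
  have K: "norm (K b x y - K a x y - c * of_real \<Delta>) \<le> \<eta> * \<Delta>" if xy: "x \<in> {p<..<q}" "y \<in> {p<..<q}" for x y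
  proof -
    have pos: "x > 0" "y > 0" using xy pq by auto
    let ?I = "{sqrt a<..sqrt b}"
    have U: "{0<..sqrt b} = {0<..sqrt a} \<union> ?I"
    proof -
      have "{0<..v} = {0<..u} \<union> {u<..v}" if "0 < u" "u < v" for u v :: real
        using that by auto
      then show ?thesis using ab by simp
    qed
    have I: "set_integrable lborel ?I (\<lambda>\<omega>. \<sigma> \<omega> x y $ j $ j)"
      by (rule set_integrable_subset[OF int[OF b pos]]) (auto simp: U)
    have "K b x y = K a x y + (LBINT \<omega>:?I. \<sigma> \<omega> x y $ j $ j)"
      unfolding K_def U by (rule set_integral_Un) (use int[OF ab(1) pos] I in auto)
    then have "K b x y - K a x y = (\<integral>\<omega>. \<sigma> \<omega> x y $ j $ j * of_real (indicator ?I \<omega>) \<partial>lborel)"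
      by (simp add: set_lebesgue_integral_def scaleR_conv_of_real mult.commute)
    moreover have "(\<integral>\<omega>. indicator ?I \<omega> \<partial>lborel) = \<Delta>"
      using \<Delta> by (simp add: \<Delta>_def)
    moreover have "norm ((\<integral>\<omega>. \<sigma> \<omega> x y $ j $ j * of_real (indicator ?I \<omega>) \<partial>lborel) - c * of_real (\<integral>\<omega>. indicator ?I \<omega> \<partial>lborel))
        \<le> \<eta> * (\<integral>\<omega>. indicator ?I \<omega> \<partial>lborel)"
    proof (rule weighted_mean_bound)
      show "integrable lborel (indicator ?I :: real \<Rightarrow> real)" using ab by (simp add: integrable_indicator_iff)
      show "integrable lborel (\<lambda>\<omega>. \<sigma> \<omega> x y $ j $ j * of_real (indicator ?I \<omega>))"
        using I by (simp add: set_integrable_def scaleR_conv_of_real mult.commute)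
      show "AE \<omega> in lborel. indicator ?I \<omega> \<noteq> (0::real) \<longrightarrow> norm (\<sigma> \<omega> x y $ j $ j - c) \<le> \<eta>"
        using near xy by (intro AE_I2) (auto simp: indicator_def)
    qed simp
    ultimately show ?thesis by simp
  qed
  have EK: "AE x in half_line. E {0..\<Lambda>} f x $ j = (\<integral>y. K \<Lambda> x y * \<phi> y \<partial>half_line)" if "\<Lambda> > 0" for \<Lambda>
  proof -
    have "(\<Sum>l\<in>UNIV. \<integral>y. (LBINT \<omega>:{0<..sqrt \<Lambda>}. \<sigma> \<omega> x y $ j $ l) * f y $ l \<partial>half_line)
        = (\<integral>y. K \<Lambda> x y * \<phi> y \<partial>half_line)" for x
    proof -
      have "(\<integral>y. (LBINT \<omega>:{0<..sqrt \<Lambda>}. \<sigma> \<omega> x y $ j $ l) * f y $ l \<partial>half_line)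
          = (if l = j then (\<integral>y. K \<Lambda> x y * \<phi> y \<partial>half_line) else 0)" for l
        by (simp add: f_def K_def)
      then show ?thesis by simp
    qed
    then show ?thesis
      using kernel[OF that] unfolding L2_eq_def by (auto elim: eventually_mono)
  qed
  define D where "D x = E {0..b} f x $ j - E {0..a} f x $ j" for x
  have D: "AE x in half_line. Re (\<phi> x) \<noteq> 0 \<longrightarrow> norm (D x - c * of_real \<Delta> * of_real mass) \<le> \<eta> * \<Delta> * mass"
    using EK[OF b] EK[OF ab(1)]
  proof eventually_elim
    case (elim x)
    show ?case
    proof
      assume "Re (\<phi> x) \<noteq> 0"
      then have x: "x \<in> {p<..<q}" by (rule \<phi>_support)
      then have x0: "x > 0" using pq by auto
      have I: "integrable half_line (\<lambda>y. K b x y * \<phi> y)" "integrable half_line (\<lambda>y. K a x y * \<phi> y)"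
        using int_y[OF b x0] int_y[OF ab(1) x0] by (simp_all add: K_def)
      have "D x = (\<integral>y. K b x y * \<phi> y - K a x y * \<phi> y \<partial>half_line)"
        using elim I by (simp add: D_def)
      then have Dx: "D x = (\<integral>y. (K b x y - K a x y) * of_real (Re (\<phi> y)) \<partial>half_line)"
        by (simp add: \<phi>_of_real left_diff_distrib)
      have "integrable half_line (\<lambda>y. (K b x y - K a x y) * of_real (Re (\<phi> y)))"
        using I by (simp add: \<phi>_of_real left_diff_distrib)
      then show "norm (D x - c * of_real \<Delta> * of_real mass) \<le> \<eta> * \<Delta> * mass"
        unfolding Dx mass_def
        by (intro weighted_mean_bound Re_\<phi>_integrable \<phi>_nonneg AE_I2) (auto intro: K x dest: \<phi>_support)
    qed
  qed
  have Ej: "integrable half_line (\<lambda>x. E A f x $ j * \<phi> x)" 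
      "L2_inner (E A f) f = (\<integral>x. E A f x $ j * \<phi> x \<partial>half_line)" if A: "A \<in> sets borel" for A
  proof -
    have "f x $ j = \<phi> x" for x by (simp add: f_def)
    then show "integrable half_line (\<lambda>x. E A f x $ j * \<phi> x)"
      using L2_inner_integrand_integrable[OF E_L2[OF A f_L2] f_L2, of j] by (simp add: \<phi>_real)
    have "(\<Sum>l\<in>UNIV. E A f x $ l * cnj (f x $ l)) = E A f x $ j * \<phi> x" for x
      by (simp add: f_def \<phi>_real if_distrib[where f=cnj] if_distrib[where f="\<lambda>c. _ * c"] cong: if_cong)
    then show "L2_inner (E A f) f = (\<integral>x. E A f x $ j * \<phi> x \<partial>half_line)"
      by (simp add: L2_inner_def)
  qed
  \<comment> \<open>Both projections are over intervals closed at 0, so their difference is the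
    half-open interval that Stieltjes inversion delivers.\<close>
  have "{a<..b} = {0..b} - {0..a}" using ab by auto
  then have "measure (\<mu> f) {a<..b} = measure (\<mu> f) {0..b} - measure (\<mu> f) {0..a}"
    using ab by (simp add: fm.finite_measure_Diff)
  then have "complex_of_real (measure (\<mu> f) {a<..b}) = L2_inner (E {0..b} f) f - L2_inner (E {0..a} f) f"
    by (simp add: measure_\<mu>[OF f_L2] inner_E_self[OF _ f_L2])
  also have "\<dots> = (\<integral>x. D x * of_real (Re (\<phi> x)) \<partial>half_line)"
    using Ej[of "{0..a}"] Ej[of "{0..b}"] by (simp add: D_def left_diff_distrib \<phi>_of_real)
  finally have M: "complex_of_real (measure (\<mu> f) {a<..b}) = (\<integral>x. D x * of_real (Re (\<phi> x)) \<partial>half_line)" .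
  have "norm ((\<integral>x. D x * of_real (Re (\<phi> x)) \<partial>half_line) - c * of_real \<Delta> * of_real mass * of_real (\<integral>x. Re (\<phi> x) \<partial>half_line))
      \<le> \<eta> * \<Delta> * mass * (\<integral>x. Re (\<phi> x) \<partial>half_line)"
  proof (rule weighted_mean_bound[OF Re_\<phi>_integrable \<phi>_nonneg _ D])
    show "integrable half_line (\<lambda>x. D x * of_real (Re (\<phi> x)))"
      using Ej(1)[of "{0..a}"] Ej(1)[of "{0..b}"] by (simp add: D_def left_diff_distrib \<phi>_of_real)
  qed
  then show ?thesis
    unfolding M mass_def[symmetric] \<Delta>_def[symmetric] by (simp add: power2_eq_square mult_ac)
qed

lemma green_form_sqrt_cont:
  "0 < a \<Longrightarrow> continuous_on {a..b} (\<lambda>s. Im (green_form (- \<i> * of_real (sqrt s))))"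
  by (intro continuous_on_Im continuous_on_compose2[OF green_form_cont] continuous_intros)
     (auto intro!: denominator_nonzero)

lemma integral_inverse_sqrt:
  assumes "0 < a" "a \<le> b"
  shows "((\<lambda>s. 1 / (2 * sqrt s)) has_integral (sqrt b - sqrt a)) {a..b}"
proof (rule fundamental_theorem_of_calculus[OF assms(2)])
  fix s assume "s \<in> {a..b}"
  then have s: "s > 0" using assms by auto
  have "(sqrt has_real_derivative inverse (sqrt s) / 2) (at s)" by (rule DERIV_real_sqrt[OF s])
  then have "(sqrt has_real_derivative 1 / (2 * sqrt s)) (at s)" by (simp add: field_simps)
  then show "(sqrt has_vector_derivative 1 / (2 * sqrt s)) (at s within {a..b})"
    unfolding has_real_derivative_iff_has_vector_derivative[symmetric] by (rule has_field_derivative_at_within)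
qed

text \<open>The counterpart of \<open>kernel_average\<close> on the resolvent side. The substitution
  \<open>s = t^2\<close> is carried out by comparison: the density in \<open>s\<close> is near
  \<open>pi d / (2 sqrt s)\<close>, whose integral is \<open>pi d (sqrt b - sqrt a)\<close>.\<close>

lemma green_average:
  assumes E: "is_spectral_measure (star_dom \<alpha>) star_op E" and ab: "0 < a" "a < b"
    and atoms: "emeasure (spectral_distribution E f) {a} = 0" "emeasure (spectral_distribution E f) {b} = 0"
    and near: "\<And>t. t \<in> {sqrt a..sqrt b} \<Longrightarrow> \<bar>2 * t / pi * Im (green_form (- \<i> * of_real t)) - d\<bar> \<le> \<eta>"
  shows "\<bar>measure (spectral_distribution E f) {a<..b} - d * (sqrt b - sqrt a)\<bar> \<le> \<eta> * (sqrt b - sqrt a)"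
proof -
  let ?G = "\<lambda>s. Im (green_form (- \<i> * of_real (sqrt s)))"
  let ?m = "measure (spectral_distribution E f) {a<..b}"
  have S: "pi * ?m = integral {a..b} ?G" by (rule Stone_formula[OF E ab atoms])
  note inv = integral_inverse_sqrt[OF ab(1) less_imp_le[OF ab(2)]]
  have Gi: "(?G has_integral pi * ?m) {a..b}"
    unfolding S by (intro integrable_integral integrable_continuous_interval green_form_sqrt_cont ab)
  have 1: "((\<lambda>s. ?G s - pi * d * (1 / (2 * sqrt s))) has_integral pi * ?m - pi * d * (sqrt b - sqrt a)) {a..b}"
    by (intro has_integral_diff Gi has_integral_mult_right inv)
  have 2: "((\<lambda>s. pi * \<eta> * (1 / (2 * sqrt s))) has_integral pi * \<eta> * (sqrt b - sqrt a)) {a..b}"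
    by (intro has_integral_mult_right inv)
  have "norm (integral {a..b} (\<lambda>s. ?G s - pi * d * (1 / (2 * sqrt s)))) \<le> integral {a..b} (\<lambda>s. pi * \<eta> * (1 / (2 * sqrt s)))"
  proof (rule integral_norm_bound_integral)
    fix s assume s: "s \<in> {a..b}"
    define t where "t = sqrt s"
    have t: "t > 0" "t \<in> {sqrt a..sqrt b}" using s ab by (auto simp: t_def)
    have "?G s - pi * d * (1 / (2 * sqrt s)) = pi / (2 * t) * (2 * t / pi * Im (green_form (- \<i> * of_real t)) - d)"
      using t unfolding t_def[symmetric] by (simp add: field_simps)
    then have "norm (?G s - pi * d * (1 / (2 * sqrt s))) = pi / (2 * t) * \<bar>2 * t / pi * Im (green_form (- \<i> * of_real t)) - d\<bar>"
      using t by (simp add: abs_mult)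
    also have "\<dots> \<le> pi / (2 * t) * \<eta>"
      using near[OF t(2)] t by (intro mult_left_mono) auto
    finally show "norm (?G s - pi * d * (1 / (2 * sqrt s))) \<le> pi * \<eta> * (1 / (2 * sqrt s))"
      by (simp add: t_def)
  qed (use 1 2 in auto)
  then have "\<bar>pi * (?m - d * (sqrt b - sqrt a))\<bar> \<le> pi * (\<eta> * (sqrt b - sqrt a))"
    unfolding integral_unique[OF 1] integral_unique[OF 2] by (simp add: algebra_simps)
  then show ?thesis by (simp add: abs_mult)
qed

end

text \<open>
  This is \<open>2 t / pi\<close> times the imaginary part of the boundary value of the resolvent form at \<open>t^2\<close>, as a
  function of the Fourier integral \<open>v\<close> of the source.
\<close>
definition spectral_profile :: "real \<Rightarrow> real \<Rightarrow> real \<Rightarrow> complex \<Rightarrow> real" where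
  "spectral_profile \<alpha> N t v = (norm v)\<^sup>2 / pi
     + 2 * t / pi * Im (v\<^sup>2 * (1 / (of_real \<alpha> - \<i> * of_real (N * t)) - \<i> / of_real (2 * t)))"

text \<open>Quadratic homogeneity under real scaling lets the total mass of the bump be divided out
  as \<open>mass^2\<close>, the same factor as in \<open>kernel_average\<close>.\<close>

lemma spectral_profile_scale: "spectral_profile \<alpha> N t (v * of_real m) = m\<^sup>2 * spectral_profile \<alpha> N t v"
proof -
  have Im: "Im (of_real c * w) = c * Im w" for c w by simp
  have "Im (v\<^sup>2 * (of_real m)\<^sup>2 * A) = m\<^sup>2 * Im (v\<^sup>2 * A)" for A
  proof -
    have "v\<^sup>2 * (of_real m)\<^sup>2 * A = of_real (m\<^sup>2) * (v\<^sup>2 * A)" by simp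
    then show ?thesis by (simp only: Im)
  qed
  then show ?thesis
    by (simp only: spectral_profile_def norm_mult norm_of_real power_mult_distrib power2_abs)
       (simp only: distrib_left mult_ac times_divide_eq_right times_divide_eq_left)
qed

lemma spectral_profile_exp:
  assumes "\<omega> > 0" "\<alpha> > 0" "N > 0"
  shows "spectral_profile \<alpha> N \<omega> (exp (\<i> * of_real \<omega> * of_real x)) =
     1 / pi + 1 / pi * (2 / N - 1) * cos (2 * \<omega> * x)
     + (2 * \<alpha> / pi) / (\<alpha>\<^sup>2 + N\<^sup>2 * \<omega>\<^sup>2) * (\<omega> * sin (2 * \<omega> * x) - \<alpha> / N * cos (2 * \<omega> * x))"
proof -
  define D where "D = \<alpha>\<^sup>2 + N\<^sup>2 * \<omega>\<^sup>2"
  have D: "D > 0" using assms by (simp add: D_def add_pos_pos)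
  have e: "(exp (\<i> * of_real \<omega> * of_real x))\<^sup>2 = cis (2 * \<omega> * x)"
    by (simp add: cis_conv_exp exp_double[symmetric] mult_ac)
  have n: "norm (exp (\<i> * of_real \<omega> * of_real x)) = 1" by simp
  have "1 / (of_real \<alpha> - \<i> * of_real (N * \<omega>)) = Complex (\<alpha> / D) (N * \<omega> / D)"
    using D by (simp add: complex_eq_iff Re_divide Im_divide D_def power_mult_distrib)
  then have "1 / (of_real \<alpha> - \<i> * of_real (N * \<omega>)) - \<i> / of_real (2 * \<omega>) = Complex (\<alpha> / D) (N * \<omega> / D - 1 / (2 * \<omega>))"
    using assms by (simp add: complex_eq_iff Re_divide Im_divide power2_eq_square)
  then have "spectral_profile \<alpha> N \<omega> (exp (\<i> * of_real \<omega> * of_real x)) =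
      1 / pi + 2 * \<omega> / pi * (cos (2 * \<omega> * x) * (N * \<omega> / D - 1 / (2 * \<omega>)) + sin (2 * \<omega> * x) * (\<alpha> / D))"
    unfolding spectral_profile_def e n by simp
  also have "\<dots> = 1 / pi + 1 / pi * (2 / N * ((N\<^sup>2 * \<omega>\<^sup>2) / D) - 1) * cos (2 * \<omega> * x) + (2 * \<alpha> / pi) / D * (\<omega> * sin (2 * \<omega> * x))"
    using assms D by (simp add: field_simps power2_eq_square)
  \<comment> \<open>This splits off the contribution with coefficient \<open>2 / N - 1\<close>,
    which does not involve \<open>\<alpha>\<close>; the remainder carries the factor
    \<open>\<alpha> / D\<close>.\<close>
  also have "N\<^sup>2 * \<omega>\<^sup>2 / D = 1 - \<alpha>\<^sup>2 / D" using D by (simp add: D_def field_simps)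
  also have "1 / pi + 1 / pi * (2 / N * (1 - \<alpha>\<^sup>2 / D) - 1) * cos (2 * \<omega> * x) + (2 * \<alpha> / pi) / D * (\<omega> * sin (2 * \<omega> * x))
      = 1 / pi + 1 / pi * (2 / N - 1) * cos (2 * \<omega> * x) + (2 * \<alpha> / pi) / D * (\<omega> * sin (2 * \<omega> * x) - \<alpha> / N * cos (2 * \<omega> * x))"
    using assms D by (simp add: field_simps power2_eq_square)
  finally show ?thesis unfolding D_def .
qed

lemma spectral_profile_cont:
  assumes "\<alpha> > 0"
  shows "continuous_on ({0<..} \<times> UNIV) (\<lambda>(t, v). spectral_profile \<alpha> N t v)"
proof -
  have "of_real \<alpha> - \<i> * of_real (N * t) \<noteq> 0" for t using assms by (auto simp: complex_eq_iff)
  then show ?thesis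
    unfolding spectral_profile_def split_beta by (intro continuous_intros) auto
qed

lemma (in star_source) Im_green_form_profile:
  "t > 0 \<Longrightarrow> 2 * t / pi * Im (green_form (- \<i> * of_real t)) = spectral_profile \<alpha> N t (J (\<i> * of_real t) q)"
  unfolding spectral_profile_def Im_green_form by (simp add: field_simps)

lemma dist_Pair_le: "dist (a, b) (c, d) \<le> dist a c + dist b d"
  by (simp add: dist_Pair_Pair sqrt_sum_squares_le_sum)

text \<open>A zero integral would make the bump vanish almost everywhere, against its positivity on
  \<open>(p, q)\<close>. Positivity of the mass is needed to normalize by it.\<close>

lemma bump_mass_pos:
  assumes "0 < p" "p < q"
  shows "(\<integral>x. bump 1 p q x \<partial>half_line) > 0"
proof -
  let ?M = "\<integral>x. bump 1 p q x \<partial>half_line"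
  have "integrable half_line (\<lambda>x. complex_of_real (bump 1 p q x))"
  proof -
    have "(\<lambda>x. complex_of_real (bump 1 p q x)) \<in> test_functions" by (rule bump_test_function[OF assms(1)]) simp
    from test_functionD[OF this] obtain a b where ab: "0 < a" "\<And>x. x \<notin> {a..b} \<Longrightarrow> complex_of_real (bump 1 p q x) = 0"
      "continuous_on UNIV (\<lambda>x. complex_of_real (bump 1 p q x))" by metis
    have "integrable lborel (\<lambda>x. indicator {a..b} x *\<^sub>R complex_of_real (bump 1 p q x))"
      by (intro borel_integrable_compact continuous_on_subset[OF ab(3)]) auto
    moreover have "indicator {a..b} x *\<^sub>R complex_of_real (bump 1 p q x) = indicator {0<..} x *\<^sub>R complex_of_real (bump 1 p q x)" for x
      using ab(1) ab(2)[of x] by (cases "x \<in> {a..b}") (auto simp: indicator_def)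
    ultimately show ?thesis unfolding half_line_integrable by simp
  qed
  then have int: "integrable half_line (bump 1 p q)"
    using integrable_Re by fastforce
  have "?M \<noteq> 0"
  proof
    assume "?M = 0"
    then have "AE x in half_line. bump 1 p q x = 0"
      using integral_nonneg_eq_0_iff_AE[OF int] bump_nonneg by auto
    then have "AE x in lborel. x \<notin> {p<..<q}"
      unfolding half_line_AE
    proof eventually_elim
      case (elim x)
      then show ?case using bump_pos[of 1 p x q] assms by auto
    qed
    then have "{p<..<q} \<in> null_sets lborel" by (subst AE_iff_null_sets) auto
    then show False using assms by (simp add: null_sets_def)
  qed
  moreover have "?M \<ge> 0" by (intro Bochner_Integration.integral_nonneg bump_nonneg)
  ultimately show ?thesis by simp
qed

theorem mainTheorem5:
  fixes \<sigma> :: "real \<Rightarrow> real \<Rightarrow> real \<Rightarrow> complex^'n^'n" and \<alpha> x \<omega> :: real and j :: 'n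
  defines "N \<equiv> real CARD('n)"
  assumes "\<alpha> > 0"
    and "is_spectral_density_kernel \<alpha> \<sigma>"
    and "x > 0" and "\<omega> > 0"
  shows "\<sigma> \<omega> x x $ j $ j = complex_of_real
    (1 / pi + 1 / pi * (2 / N - 1) * cos (2 * \<omega> * x)
     + (2 * \<alpha> / pi) / (\<alpha>\<^sup>2 + N\<^sup>2 * \<omega>\<^sup>2) * (\<omega> * sin (2 * \<omega> * x) - \<alpha> / N * cos (2 * \<omega> * x)))"
proof -
  have N: "N > 0" by (simp add: N_def)
  define v0 where "v0 = exp (\<i> * of_real \<omega> * of_real x)"
  define s0 where "s0 = spectral_profile \<alpha> N \<omega> v0"
  define \<sigma>0 where "\<sigma>0 = \<sigma> \<omega> x x $ j $ j"
  note ker = assms(3)[unfolded is_spectral_density_kernel_def]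
  note cont = conjunct1[OF ker]
  from conjunct2[OF ker] obtain E where E: "is_spectral_measure (star_dom \<alpha>) star_op E"
    and K: "\<forall>\<Lambda>>0.
         (\<forall>x>0. \<forall>y>0. \<forall>j l. set_integrable lborel {0<..sqrt \<Lambda>} (\<lambda>\<omega>. \<sigma> \<omega> x y $ j $ l)) \<and>
         (\<forall>f. (\<forall>l. edge f l \<in> test_functions) \<longrightarrow>
           (\<forall>x>0. \<forall>j l. integrable half_line
              (\<lambda>y. (LBINT \<omega>:{0<..sqrt \<Lambda>}. \<sigma> \<omega> x y $ j $ l) * f y $ l)) \<and>
           E {0..\<Lambda>} f \<simeq>
             (\<lambda>x. \<chi> j. \<Sum>l\<in>UNIV. \<integral>y. (LBINT \<omega>:{0<..sqrt \<Lambda>}. \<sigma> \<omega> x y $ j $ l) * f y $ l \<partial>half_line))"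
    by (elim exE conjE)
  have int: "set_integrable lborel {0<..sqrt \<Lambda>} (\<lambda>\<omega>. \<sigma> \<omega> x y $ j $ l)" if "\<Lambda> > 0" "x > 0" "y > 0" for \<Lambda> x y j l
    using K[rule_format, OF that(1), THEN conjunct1] that by simp
  have int_y: "integrable half_line (\<lambda>y. (LBINT \<omega>:{0<..sqrt \<Lambda>}. \<sigma> \<omega> x y $ j $ l) * f y $ l)"
    if "\<Lambda> > 0" "\<And>l. edge f l \<in> test_functions" "x > 0" for \<Lambda> f x j l
    using K[rule_format, OF that(1), THEN conjunct2, rule_format, OF that(2), THEN conjunct1] that(3) by simp
  have kernel: "E {0..\<Lambda>} f \<simeq>
        (\<lambda>x. \<chi> j. \<Sum>l\<in>UNIV. \<integral>y. (LBINT \<omega>:{0<..sqrt \<Lambda>}. \<sigma> \<omega> x y $ j $ l) * f y $ l \<partial>half_line)"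
    if "\<Lambda> > 0" "\<And>l. edge f l \<in> test_functions" for \<Lambda> f
    by (rule K[rule_format, OF that(1), THEN conjunct2, rule_format, OF that(2), THEN conjunct2])
  have cont_jj: "continuous_on ({0<..} \<times> {0<..} \<times> {0<..}) (\<lambda>z. (case z of (\<omega>, x, y) \<Rightarrow> \<sigma> \<omega> x y) $ j $ j)"
    by (intro continuous_on_component cont)
  \<comment> \<open>One \<open>\<eta>\<close> accounts for the oscillation of the kernel, the other
    for that of the profile; both are compared with the same spectral mass.\<close>
  have main: "norm (\<sigma>0 - of_real s0) \<le> 2 * \<eta>" if \<eta>: "\<eta> > 0" for \<eta>
  proof -
    obtain d1 where d1: "d1 > 0" "\<And>t y z. t > 0 \<Longrightarrow> y > 0 \<Longrightarrow> z > 0 \<Longrightarrow> dist (t, y, z) (\<omega>, x, x) < d1 \<Longrightarrow>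
        norm (\<sigma> t y z $ j $ j - \<sigma>0) < \<eta>"
    proof -
      have "(\<omega>, x, x) \<in> {0<..} \<times> {0<..} \<times> {0<..}" using assms by simp
      from cont_jj[unfolded continuous_on_iff, rule_format, OF this \<eta>]
      obtain d where "d > 0" "\<And>z. z \<in> {0<..} \<times> {0<..} \<times> {0<..} \<Longrightarrow> dist z (\<omega>, x, x) < d \<Longrightarrow>
         dist ((case z of (\<omega>, x, y) \<Rightarrow> \<sigma> \<omega> x y) $ j $ j) ((case (\<omega>, x, x) of (\<omega>, x, y) \<Rightarrow> \<sigma> \<omega> x y) $ j $ j) < \<eta>" by blast
      from this(1) this(2)[of "(t, y, z)" for t y z] show ?thesis
        by (intro that[of d]) (simp_all add: dist_norm \<sigma>0_def)
    qed
    obtain d2 where d2: "d2 > 0" "\<And>t v. t > 0 \<Longrightarrow> dist (t, v) (\<omega>, v0) < d2 \<Longrightarrow> \<bar>spectral_profile \<alpha> N t v - s0\<bar> < \<eta>"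
    proof -
      have "(\<omega>, v0) \<in> {0<..} \<times> UNIV" using assms by simp
      from spectral_profile_cont[OF assms(2), of N, unfolded continuous_on_iff, rule_format, OF this \<eta>]
      obtain d where "d > 0" "\<And>z. z \<in> {0<..} \<times> UNIV \<Longrightarrow> dist z (\<omega>, v0) < d \<Longrightarrow>
         dist (case z of (t, v) \<Rightarrow> spectral_profile \<alpha> N t v) (case (\<omega>, v0) of (t, v) \<Rightarrow> spectral_profile \<alpha> N t v) < \<eta>" by blast
      from this(1) this(2)[of "(t, v)" for t v] show ?thesis
        by (intro that[of d]) (simp_all add: dist_real_def s0_def)
    qed
    obtain d3 where d3: "d3 > 0" "\<And>t y. dist (t, y) (\<omega>, x) < d3 \<Longrightarrow> norm (exp (\<i> * of_real t * of_real y) - v0) < d2 / 2"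
    proof -
      have "continuous_on UNIV (\<lambda>z :: real \<times> real. exp (\<i> * of_real (fst z) * of_real (snd z)))"
        by (intro continuous_intros)
      moreover have "d2 / 2 > 0" using d2 by simp
      ultimately obtain d where "d > 0" "\<And>z. dist z (\<omega>, x) < d \<Longrightarrow>
         dist (exp (\<i> * of_real (fst z) * of_real (snd z))) (exp (\<i> * of_real (fst (\<omega>, x)) * of_real (snd (\<omega>, x)))) < d2 / 2"
        unfolding continuous_on_iff by blast
      from this(1) this(2)[of "(t, y)" for t y] show ?thesis
        by (intro that[of d]) (simp_all add: dist_norm v0_def)
    qed
    \<comment> \<open>Three coordinates within \<open>r\<close> stay within \<open>d1\<close>, and
      two within \<open>d3\<close>. For \<open>d2\<close>, the frequency contributes less than
      \<open>d2 / 2\<close> and the normalized Fourier integral the other half. The bounds by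
      \<open>\<omega>\<close> and \<open>x\<close> keep the windows positive, and the final halving
      makes all inequalities strict.\<close>
    define r where "r = Min {\<omega>, x, d1 / 3, d2 / 2, d3 / 2} / 2"
    have "Min {\<omega>, x, d1 / 3, d2 / 2, d3 / 2} > 0"
      using assms d1 d2 d3 by (subst Min_gr_iff) auto
    moreover have "Min {\<omega>, x, d1 / 3, d2 / 2, d3 / 2} \<le> z" if "z \<in> {\<omega>, x, d1 / 3, d2 / 2, d3 / 2}" for z
      using that by (intro Min_le) auto
    ultimately have r: "r > 0" "r < \<omega>" "r < x" "3 * r < d1" "2 * r < d2" "2 * r < d3"
      unfolding r_def by force+
    define p q where "p = x - r" and "q = x + r"
    have pq: "0 < p" "p < q" using r by (auto simp: p_def q_def)
    have test: "(\<lambda>y. complex_of_real (bump 1 p q y)) \<in> test_functions"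
      by (rule bump_test_function[OF pq(1)]) simp
    obtain bump_cont: "continuous_on UNIV (\<lambda>y. complex_of_real (bump 1 p q y))"
      using test_functionD[OF test] by metis
    interpret positive_star_source "\<lambda>y. complex_of_real (bump 1 p q y)" p q j \<alpha> N
      by unfold_locales (use pq test bump_cont assms(2) bump_nonneg bump_eq_0 in \<open>auto simp: N_def\<close>)
    define M where "M = spectral_distribution E f"
    have m: "mass > 0" using bump_mass_pos[OF pq] by (simp add: mass_def)
    have near_r: "\<bar>t - \<omega>\<bar> < r \<Longrightarrow> t > 0" for t using r by linarith
    have f_test: "edge f l \<in> test_functions" for l
    proof -
      have "(\<lambda>y. 0) \<in> test_functions"
        unfolding test_functions_def by (auto intro!: exI[of _ "\<lambda>n y. 0"] exI[of _ "{}"])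
      then show ?thesis using test by (simp add: edge_f)
    qed
    have fj: "f y $ j = complex_of_real (bump 1 p q y)" for y by (simp add: f_def)
    have A: "norm (of_real (measure M {a<..b}) - \<sigma>0 * of_real (mass\<^sup>2 * (sqrt b - sqrt a))) \<le> \<eta> * (mass\<^sup>2 * (sqrt b - sqrt a))"
      if ab: "0 < a" "a < b" "\<omega> - r < sqrt a" "sqrt b < \<omega> + r" for a b
      unfolding M_def
    proof (rule kernel_average[OF E int _ kernel ab(1,2)])
      show "integrable half_line (\<lambda>y. (LBINT \<omega>:{0<..sqrt \<Lambda>}. \<sigma> \<omega> x y $ j $ j) * complex_of_real (bump 1 p q y))"
        if "\<Lambda> > 0" "x > 0" for \<Lambda> x
        using int_y[OF that(1) f_test that(2), of j j] by (simp only: fj)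
      show "norm (\<sigma> t y z $ j $ j - \<sigma>0) \<le> \<eta>"
        if "t \<in> {sqrt a<..sqrt b}" "y \<in> {p<..<q}" "z \<in> {p<..<q}" for t y z
      proof (rule less_imp_le, rule d1(2))
        have t: "\<bar>t - \<omega>\<bar> < r" "\<bar>y - x\<bar> < r" "\<bar>z - x\<bar> < r" using that ab by (auto simp: p_def q_def abs_less_iff)
        show "t > 0" "y > 0" "z > 0" using near_r t that pq by auto
        have "dist (t, y, z) (\<omega>, x, x) \<le> dist t \<omega> + (dist y x + dist z x)"
          by (rule order_trans[OF dist_Pair_le add_left_mono[OF dist_Pair_le]])
        also have "\<dots> < d1" using t r by (simp add: dist_real_def)
        finally show "dist (t, y, z) (\<omega>, x, x) < d1" .
      qed
    qed (use f_test in auto)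
    interpret spectral_resolution "star_dom \<alpha>" star_op E
      by (rule spectral_resolution.intro[OF E star_dom_linear star_op_L2])
    interpret fm: finite_measure M unfolding M_def by (rule finite_\<mu>[OF f_L2])
    have setsM: "sets M = sets borel" by (simp add: M_def)
    \<comment> \<open>The estimate \<open>A\<close> does not presuppose the absence of atoms. On
      \<open>(a, b]\<close> with \<open>sqrt a = sqrt b - h\<close> it bounds the mass by a multiple
      of \<open>h\<close>, which tends to 0.\<close>
    have atom: "emeasure M {b} = 0" if b: "\<omega> - r < sqrt b" "sqrt b < \<omega> + r" for b
    proof -
      have b0: "sqrt b > 0" using b r by linarith
      have bound: "measure M {b} \<le> (norm \<sigma>0 + \<eta>) * (mass\<^sup>2 * h)" if h: "0 < h" "h < sqrt b - (\<omega> - r)" for h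
      proof -
        define a where "a = (sqrt b - h)\<^sup>2"
        have s: "sqrt b - h > 0" using h r by linarith
        then have sa: "sqrt a = sqrt b - h" by (simp add: a_def)
        have ab: "0 < a" "a < b"
        proof -
          show "0 < a" using s by (simp add: a_def)
          have "sqrt a < sqrt b" unfolding sa using h by simp
          then show "a < b" by (simp only: real_sqrt_less_iff)
        qed
        have "measure M {b} \<le> measure M {a<..b}"
          using ab by (intro fm.finite_measure_mono) (auto simp: setsM)
        also have "\<dots> \<le> norm (of_real (measure M {a<..b}) - \<sigma>0 * of_real (mass\<^sup>2 * h)) + norm (\<sigma>0 * of_real (mass\<^sup>2 * h))"
          using norm_triangle_sub[of "complex_of_real (measure M {a<..b})" "\<sigma>0 * of_real (mass\<^sup>2 * h)"] by simp
        also have "\<dots> \<le> \<eta> * (mass\<^sup>2 * h) + norm \<sigma>0 * (mass\<^sup>2 * h)"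
          using A[OF ab] b h sa by (intro add_mono) (auto simp: norm_mult norm_power)
        finally show ?thesis by (simp add: algebra_simps)
      qed
      have "((\<lambda>h. (norm \<sigma>0 + \<eta>) * (mass\<^sup>2 * h)) \<longlongrightarrow> (norm \<sigma>0 + \<eta>) * (mass\<^sup>2 * 0)) (at_right 0)"
        by (intro tendsto_intros)
      moreover have "\<forall>\<^sub>F h in at_right 0. measure M {b} \<le> (norm \<sigma>0 + \<eta>) * (mass\<^sup>2 * h)"
        using b bound by (auto simp: eventually_at_right_field intro!: exI[of _ "sqrt b - (\<omega> - r)"])
      ultimately have "measure M {b} \<le> 0" using tendsto_lowerbound by fastforce
      then show ?thesis by (simp add: fm.emeasure_eq_measure ennreal_eq_0_iff)
    qed
    \<comment> \<open>A one-sided window suffices: its frequencies run from \<open>\<omega>\<close>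
      to \<open>\<omega> + r / 2\<close>, and both ends lie where \<open>atom\<close>
      applies.\<close>
    define a b where "a = \<omega>\<^sup>2" and "b = (\<omega> + r / 2)\<^sup>2"
    have sq: "sqrt a = \<omega>" "sqrt b = \<omega> + r / 2" using assms r by (simp_all add: a_def b_def)
    have ab: "0 < a" "a < b" using assms r by (auto simp: a_def b_def intro!: power_strict_mono)
    have "\<bar>measure M {a<..b} - mass\<^sup>2 * s0 * (sqrt b - sqrt a)\<bar> \<le> mass\<^sup>2 * \<eta> * (sqrt b - sqrt a)"
      unfolding M_def
    proof (rule green_average[OF E ab])
      show "emeasure (spectral_distribution E f) {a} = 0" "emeasure (spectral_distribution E f) {b} = 0"
        unfolding M_def[symmetric] using r sq by (auto intro: atom)
      fix t assume "t \<in> {sqrt a..sqrt b}"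
      then have t: "\<bar>t - \<omega>\<bar> < r" "t > 0" using sq r assms by auto
      define w where "w = J (\<i> * of_real t) q"
      have "norm (exp (\<i> * of_real t * of_real y) - v0) \<le> d2 / 2" if "y \<in> {p<..<q}" for y
      proof (rule less_imp_le, rule d3(2))
        have "dist (t, y) (\<omega>, x) \<le> dist t \<omega> + dist y x" by (rule dist_Pair_le)
        also have "\<dots> < d3" using t r that by (auto simp: dist_real_def p_def q_def abs_if)
        finally show "dist (t, y) (\<omega>, x) < d3" .
      qed
      from J_near[OF this] have w: "norm (w - v0 * of_real mass) \<le> d2 / 2 * mass" by (simp add: w_def)
      \<comment> \<open>The normalized Fourier integral is a weighted mean of
        \<open>exp(i t y)\<close> over the support of the bump, hence close to
        \<open>v0\<close>.\<close>
      define u where "u = w / of_real mass"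
      have wu: "w = u * of_real mass" using m by (simp add: u_def)
      have "norm (w - v0 * of_real mass) = norm (u - v0) * mass"
        using m unfolding wu by (simp add: norm_mult flip: left_diff_distrib)
      then have "norm (u - v0) \<le> d2 / 2" using w m by simp
      have "dist (t, u) (\<omega>, v0) \<le> dist t \<omega> + dist u v0" by (rule dist_Pair_le)
      also have "\<dots> < d2" using \<open>norm (u - v0) \<le> d2 / 2\<close> t r by (simp add: dist_norm dist_real_def)
      finally have "\<bar>spectral_profile \<alpha> N t u - s0\<bar> \<le> \<eta>" using d2(2)[OF t(2)] by (simp add: less_imp_le)
      moreover have "2 * t / pi * Im (green_form (- \<i> * of_real t)) = mass\<^sup>2 * spectral_profile \<alpha> N t u"
        unfolding Im_green_form_profile[OF t(2)] w_def[symmetric] wu spectral_profile_scale ..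
      ultimately show "\<bar>2 * t / pi * Im (green_form (- \<i> * of_real t)) - mass\<^sup>2 * s0\<bar> \<le> mass\<^sup>2 * \<eta>"
        by (simp add: abs_mult flip: right_diff_distrib) (simp add: mult_left_mono)
    qed
    then have B: "norm (of_real (measure M {a<..b}) - complex_of_real (mass\<^sup>2 * s0 * (sqrt b - sqrt a))) \<le> mass\<^sup>2 * \<eta> * (sqrt b - sqrt a)"
      by (simp only: norm_of_real flip: of_real_diff)
    \<comment> \<open>The common weight of both estimates; dividing by it leaves an inequality
      independent of the chosen bump and window.\<close>
    define X where "X = mass\<^sup>2 * (sqrt b - sqrt a)"
    have X: "X > 0" using m r by (simp add: X_def sq)
    have A': "norm (of_real (measure M {a<..b}) - \<sigma>0 * of_real X) \<le> \<eta> * X"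
      unfolding X_def using r by (intro A ab) (simp_all add: sq)
    have B': "norm (of_real (measure M {a<..b}) - of_real s0 * complex_of_real X) \<le> \<eta> * X"
      using B by (simp add: X_def mult_ac)
    have "norm (\<sigma>0 - of_real s0) * X = norm (\<sigma>0 * of_real X - of_real s0 * of_real X)"
      using X by (simp add: norm_mult flip: left_diff_distrib)
    also have "\<dots> \<le> \<eta> * X + \<eta> * X"
      using norm_triangle_ineq4[of "of_real (measure M {a<..b}) - of_real s0 * complex_of_real X" "of_real (measure M {a<..b}) - \<sigma>0 * of_real X"] A' B'
      by (simp add: algebra_simps)
    also have "\<dots> = (2 * \<eta>) * X" by simp
    finally show ?thesis using X by (simp only: mult_le_cancel_right_pos)
  qed
  have "norm (\<sigma>0 - of_real s0) \<le> 0"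
  proof (rule field_le_epsilon)
    fix e :: real assume "e > 0"
    then show "norm (\<sigma>0 - of_real s0) \<le> 0 + e" using main[of "e / 2"] by simp
  qed
  then have "\<sigma>0 = of_real s0" by simp
  then show ?thesis
    unfolding \<sigma>0_def s0_def v0_def spectral_profile_exp[OF assms(5,2) N] .
qed

end
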